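(* There exists $\varepsilon_0>0$ such that $$K_G<\frac{\pi}{2\log\left(1+\sqrt{2}\right)}-\varepsilon_0,$$ where $K_G$ denotes the (real) Grothendieck constant.
   Context: The (real) Grothendieck constant $K_G$ is the infimum over those $K\in(0,\infty)$ such that for every $m,n\in\mathbb{N}$, every $m\times n$ matrix $(a_{ij})$ with real entries, and every $m+n$ unit vectors $x_1,\ldots,x_m,y_1,\ldots,y_n\in S^{m+n-1}$ (the Euclidean unit sphere of $\mathbb{R}^{m+n}$), there exist signs $\varepsilon_1,\ldots,\varepsilon_m,\delta_1,\ldots,\delta_n\in\{-1,1\}$ satisfying $$\sum_{i=1}^m\sum_{j=1}^n a_{ij}\langle x_i,y_j\rangle\le K\sum_{i=1}^m\sum_{j=1}^n a_{ij}\varepsilon_i\delta_j,$$ where $\langle\cdot,\cdot\rangle$ is the standard scalar product on $\mathbb{R}^{m+n}$. Here $\log$ is the natural logarithm. *)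

theory Defs
  imports "HOL-Analysis.Analysis"
begin

(* The dimension m + n is quantified inside the definition of the constant, so R^d is the
   carrier of the library space "Euclidean_space d": real sequences vanishing from index d on. *)
definition std_inner :: "nat \<Rightarrow> (nat \<Rightarrow> real) \<Rightarrow> (nat \<Rightarrow> real) \<Rightarrow> real" where
  "std_inner d u v = (\<Sum>k<d. u k * v k)"

(* "topspace (nsphere p)" is the Euclidean unit sphere of R^(p + 1).
   Indices start at 0, and only the entries a i j with i < m, j < n, the vectors x i, y j and the
   signs in the same ranges matter. Positivity of m and n keeps m + n - 1 from truncating. *)
definition grothendieck_bound :: "real \<Rightarrow> bool" where
  "grothendieck_bound K \<longleftrightarrow>
    (\<forall>m\<ge>1. \<forall>n\<ge>1. \<forall>(a :: nat \<Rightarrow> nat \<Rightarrow> real) (x :: nat \<Rightarrow> nat \<Rightarrow> real) (y :: nat \<Rightarrow> nat \<Rightarrow> real).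
      (\<forall>i<m. x i \<in> topspace (nsphere (m + n - 1))) \<longrightarrow>
      (\<forall>j<n. y j \<in> topspace (nsphere (m + n - 1))) \<longrightarrow>
      (\<exists>\<epsilon> \<delta> :: nat \<Rightarrow> real.
        (\<forall>i<m. \<epsilon> i \<in> {-1, 1}) \<and> (\<forall>j<n. \<delta> j \<in> {-1, 1}) \<and>
        (\<Sum>i<m. \<Sum>j<n. a i j * std_inner (m + n) (x i) (y j))
          \<le> K * (\<Sum>i<m. \<Sum>j<n. a i j * \<epsilon> i * \<delta> j)))"

(* The set is bounded below by 0, and nonempty by Grothendieck's inequality, so the real-valued
   Inf is its infimum. *)
definition grothendieck_constant :: real where
  "grothendieck_constant = Inf {K. 0 < K \<and> grothendieck_bound K}"

end

theory Submission
  imports Defs "HOL-Probability.Probability" "HOL-Complex_Analysis.Complex_Analysis"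
    "HOL-Real_Asymp.Real_Asymp"
begin

text \<open>
  Put \<open>l = arsinh 1 = ln (1 + sqrt 2)\<close> and \<open>c = 2 l / pi\<close>, so that Krivine's bound is \<open>1 / c\<close>. Fix a real
  matrix \<open>a\<close>. Let \<open>\<beta>\<close> be the largest value of \<open>\<Sum> a i j * \<epsilon> i * \<delta> j\<close> over signs and \<open>\<Gamma>\<close> the supremum of
  \<open>\<Sum> a i j * M i j\<close> over the matrices \<open>M\<close> of inner products of unit vectors. The goal is \<open>\<Gamma> \<le> K * \<beta>\<close> with
  one \<open>K < 1 / c\<close> for all \<open>a\<close>.

  Call \<open>R\<close> a rounding function if \<open>\<Sum> a i j * R (M i j) \<le> \<beta>\<close> for all \<open>a\<close> and \<open>M\<close>. Taking signs of Gaussian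
  projections shows that \<open>2 / pi * arcsin\<close> is one (\<open>arcsin_rounding\<close>). Matrices of inner products are closed
  under entrywise products and under linear combinations whose coefficients have absolute sum at most 1,
  so \<open>2 / pi * arcsin \<circ> F\<close> is a rounding function as well when the Taylor coefficients of \<open>F\<close> have absolute
  sum at most 1. For \<open>F t = sin (l * t)\<close> this sum is \<open>sinh l = 1\<close>, and \<open>c * \<Gamma> \<le> \<beta>\<close> is Krivine's bound.

  The improvement rests on a linearisation of this constraint. The Taylor coefficients of \<open>sin (l * t)\<close> have
  the signs of the powers of \<open>\<i>\<close>, hence for odd \<open>b\<close> and small \<open>p > 0\<close> the absolute coefficient sum of
  \<open>sin (l * t + p * b t)\<close> is, to first order, \<open>1 + p * Im (b \<i>) * cosh l\<close>. So every direction with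
  \<open>Im (b \<i>) < 0\<close> is admissible (\<open>sin_perturbation\<close>). Given a rounding function \<open>h\<close> with an absolutely
  convergent power series and \<open>Im (h \<i>) > c + \<kappa>\<close>, take for \<open>2 / pi * b\<close> the function \<open>(c + \<kappa>) * t - h t\<close>. The
  nonlinear terms cancel in the sum of the perturbed rounding function and \<open>p * h\<close>, which leaves
  \<open>(c + p * (c + \<kappa>)) * \<Gamma> \<le> (1 + p) * \<beta>\<close>, and this is better than Krivine's bound (\<open>gram_sup_bound\<close>). It is
  therefore enough to find a rounding function whose value at \<open>\<i>\<close> beats that of \<open>2 / pi * arcsin\<close>.

  Such a function comes from random rotations. For all angles the matrix \<open>M i j * cos (\<theta> i - \<phi> j)\<close> is again
  a matrix of inner products. Let \<open>\<theta> i = \<eta> * Q (x i)\<close> and \<open>\<phi> j = - \<eta> * Q (y j)\<close> with the quadratic Gaussian form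
  \<open>Q x = \<langle>G1, x\<rangle> * \<langle>G2, x\<rangle> + \<langle>G3, x\<rangle> * \<langle>G4, x\<rangle>\<close>. The expectation of \<open>cos (m * (\<theta> i - \<phi> j))\<close> is a rational
  function of \<open>t = \<langle>x i, y j\<rangle>\<close> (\<open>expectation_cos_chaos\<close>). Its value at \<open>t = \<i>\<close> is \<open>1 / (1 + 4 * (m * \<eta>) ^ 4)\<close>,
  which is the integral of \<open>cos (2 * m * \<eta> * y)\<close> against the signed density \<open>exp (- y) * (cos y + sin y)\<close> on
  the half-line. Thus \<open>h t = 2 / pi * E (arcsin (t * cos (\<theta> i - \<phi> j)))\<close> has
  \<open>Im (h \<i>) = 2 / pi * \<integral> arsinh (cos (2 * \<eta> * y)) * exp (- y) * (cos y + sin y) dy\<close>. The density has vanishing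
  second moment, and the fourth-order term in \<open>\<eta>\<close> has a positive coefficient, so for small \<open>\<eta>\<close> the integral exceeds
  \<open>arsinh 1\<close> (\<open>arsinh_cos_gain\<close>). Truncating the arcsine series keeps everything inside finite sums, at the
  price of a small multiple of \<open>\<Gamma>\<close> (\<open>improved_rounding\<close>).
\<close>

section \<open>Gram matrices of unit vectors\<close>

text \<open>The rows are indexed by all of \<open>nat\<close>, so that the class does not depend on the size of the matrix \<open>a\<close>.
  Vectors in the unit ball give the same matrices as unit vectors (\<open>gram_unit\<close>), and make closure under
  linear combinations immediate.\<close>

definition gram_matrices :: "(nat \<Rightarrow> nat \<Rightarrow> real) set" where
  "gram_matrices = {M. \<exists>I u v. finite I \<and> (\<forall>i. (\<Sum>k\<in>I. (u i k)\<^sup>2) \<le> 1) \<and> (\<forall>j. (\<Sum>k\<in>I. (v j k)\<^sup>2) \<le> 1) \<and>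
     M = (\<lambda>i j. \<Sum>k\<in>(I :: nat set). u i k * v j k)}"

lemma gramI:
  fixes u v :: "nat \<Rightarrow> 'k::countable \<Rightarrow> real"
  assumes "finite I" "\<And>i. (\<Sum>k\<in>I. (u i k)\<^sup>2) \<le> 1" "\<And>j. (\<Sum>k\<in>I. (v j k)\<^sup>2) \<le> 1"
    "\<And>i j. M i j = (\<Sum>k\<in>I. u i k * v j k)"
  shows "M \<in> gram_matrices"
proof -
  have inj: "inj_on to_nat I" by (metis inj_on_subset inj_to_nat subset_UNIV)
  show ?thesis unfolding gram_matrices_def
    apply (rule CollectI, rule exI[of _ "to_nat ` I"], rule exI[of _ "\<lambda>i k. u i (from_nat k)"], rule exI[of _ "\<lambda>j k. v j (from_nat k)"])
    using assms by (auto simp: sum.reindex[OF inj] o_def fun_eq_iff)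
qed

text \<open>Two extra coordinates, one for each family, absorb the missing length without changing any inner product
  between the families.\<close>

lemma gram_unit:
  assumes "M \<in> gram_matrices"
  obtains I :: "nat set" and u v where "finite I" "\<And>i. (\<Sum>k\<in>I. (u i k)\<^sup>2) = 1" "\<And>j. (\<Sum>k\<in>I. (v j k)\<^sup>2) = 1"
    "\<And>i j. M i j = (\<Sum>k\<in>I. u i k * v j k)"
proof -
  obtain I u v where I: "finite I" "\<And>i. (\<Sum>k\<in>I. (u i k)\<^sup>2) \<le> 1" "\<And>j. (\<Sum>k\<in>I. (v j k)\<^sup>2) \<le> 1"
     "M = (\<lambda>i j. \<Sum>k\<in>(I :: nat set). u i k * v j k)"
    using assms unfolding gram_matrices_def by blast
  obtain p where p: "p \<notin> I" using I(1) by (meson ex_new_if_finite infinite_UNIV_nat)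
  obtain q where q: "q \<notin> insert p I" using I(1) by (meson ex_new_if_finite infinite_UNIV_nat finite_insert)
  define u' where "u' i k = (if k = p then sqrt (1 - (\<Sum>k\<in>I. (u i k)\<^sup>2)) else if k = q then 0 else u i k)" for i k
  define v' where "v' j k = (if k = p then 0 else if k = q then sqrt (1 - (\<Sum>k\<in>I. (v j k)\<^sup>2)) else v j k)" for j k
  have eq: "u' i k = u i k" "v' j k = v j k" if "k \<in> I" for i j k
    using that p q by (auto simp: u'_def v'_def)
  have pq: "p \<noteq> q" using q by auto
  show ?thesis
  proof (rule that[of "insert q (insert p I)" u' v'])
    show "(\<Sum>k\<in>insert q (insert p I). (u' i k)\<^sup>2) = 1" for i
      using I p q pq eq by (simp add: u'_def[of _ p] u'_def[of _ q])
    show "(\<Sum>k\<in>insert q (insert p I). (v' j k)\<^sup>2) = 1" for j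
      using I p q pq eq by (simp add: v'_def[of _ p] v'_def[of _ q])
    show "M i j = (\<Sum>k\<in>insert q (insert p I). u' i k * v' j k)" for i j
      using I p q pq eq by (simp add: u'_def[of _ p] u'_def[of _ q] v'_def[of _ p] v'_def[of _ q])
  qed (use I in auto)
qed

text \<open>The inner product of tensor products is the product of the inner products.\<close>

lemma gram_mult:
  assumes "M \<in> gram_matrices" "N \<in> gram_matrices" shows "(\<lambda>i j. M i j * N i j) \<in> gram_matrices"
proof -
  obtain I u v where I: "finite I" "\<And>i. (\<Sum>k\<in>I. (u i k)\<^sup>2) \<le> 1" "\<And>j. (\<Sum>k\<in>I. (v j k)\<^sup>2) \<le> 1"
     "M = (\<lambda>i j. \<Sum>k\<in>(I :: nat set). u i k * v j k)"
    using assms(1) unfolding gram_matrices_def by blast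
  obtain J w z where J: "finite J" "\<And>i. (\<Sum>k\<in>J. (w i k)\<^sup>2) \<le> 1" "\<And>j. (\<Sum>k\<in>J. (z j k)\<^sup>2) \<le> 1"
     "N = (\<lambda>i j. \<Sum>k\<in>(J :: nat set). w i k * z j k)"
    using assms(2) unfolding gram_matrices_def by blast
  show ?thesis
  proof (rule gramI[of "I \<times> J" "\<lambda>i (k, l). u i k * w i l" "\<lambda>i (k, l). v i k * z i l"])
    have prod: "(\<Sum>x\<in>I \<times> J. (case x of (k, l) \<Rightarrow> f k * g l)) = sum f I * sum g J" for f g :: "nat \<Rightarrow> real"
      by (simp add: sum_product sum.cartesian_product)
    have sq: "(\<Sum>x\<in>I \<times> J. (case x of (k, l) \<Rightarrow> f k * g l)\<^sup>2) \<le> 1"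
      if "(\<Sum>k\<in>I. (f k)\<^sup>2) \<le> 1" "(\<Sum>k\<in>J. (g k)\<^sup>2) \<le> 1" for f g :: "nat \<Rightarrow> real"
    proof -
      have "(\<Sum>x\<in>I \<times> J. (case x of (k, l) \<Rightarrow> f k * g l)\<^sup>2) = (\<Sum>k\<in>I. (f k)\<^sup>2) * (\<Sum>k\<in>J. (g k)\<^sup>2)"
        unfolding prod[symmetric] by (intro sum.cong) (auto simp: power_mult_distrib)
      also have "\<dots> \<le> 1 * 1" using that by (intro mult_mono) (auto intro: sum_nonneg)
      finally show ?thesis by simp
    qed
    show "(\<Sum>x\<in>I \<times> J. (case x of (k, l) \<Rightarrow> u i k * w i l)\<^sup>2) \<le> 1"
      "(\<Sum>x\<in>I \<times> J. (case x of (k, l) \<Rightarrow> v i k * z i l)\<^sup>2) \<le> 1" for i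
      using I J by (auto intro!: sq)
    show "M i j * N i j = (\<Sum>x\<in>I \<times> J. (case x of (k, l) \<Rightarrow> u i k * w i l) * (case x of (k, l) \<Rightarrow> v j k * z j l))" for i j
      unfolding I J prod[symmetric] by (intro sum.cong) auto
  qed (use I J in auto)
qed

text \<open>Scale the two families by \<open>sqrt \<bar>a\<bar>\<close> and \<open>sqrt \<bar>b\<bar>\<close>, put the signs of \<open>a\<close> and \<open>b\<close> on one side, and take the
  direct sum.\<close>

lemma gram_combine:
  assumes "M \<in> gram_matrices" "N \<in> gram_matrices" and ab: "\<bar>a\<bar> + \<bar>b\<bar> \<le> 1"
  shows "(\<lambda>i j. a * M i j + b * N i j) \<in> gram_matrices"
proof -
  obtain I u v where I: "finite I" "\<And>i. (\<Sum>k\<in>I. (u i k)\<^sup>2) \<le> 1" "\<And>j. (\<Sum>k\<in>I. (v j k)\<^sup>2) \<le> 1"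
     "M = (\<lambda>i j. \<Sum>k\<in>(I :: nat set). u i k * v j k)"
    using assms(1) unfolding gram_matrices_def by blast
  obtain J w z where J: "finite J" "\<And>i. (\<Sum>k\<in>J. (w i k)\<^sup>2) \<le> 1" "\<And>j. (\<Sum>k\<in>J. (z j k)\<^sup>2) \<le> 1"
     "N = (\<lambda>i j. \<Sum>k\<in>(J :: nat set). w i k * z j k)"
    using assms(2) unfolding gram_matrices_def by blast
  let ?u = "\<lambda>i. case_sum (\<lambda>k. sqrt \<bar>a\<bar> * u i k) (\<lambda>k. sqrt \<bar>b\<bar> * w i k)"
  let ?v = "\<lambda>i. case_sum (\<lambda>k. sgn a * sqrt \<bar>a\<bar> * v i k) (\<lambda>k. sgn b * sqrt \<bar>b\<bar> * z i k)"
  have bd: "\<bar>a\<bar> * x + \<bar>b\<bar> * y \<le> 1" if "x \<le> 1" "y \<le> 1" for x y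
    using ab mult_left_mono[OF that(1), of "\<bar>a\<bar>"] mult_left_mono[OF that(2), of "\<bar>b\<bar>"] by simp
  have s2: "(sgn c)\<^sup>2 * \<bar>c\<bar> = \<bar>c\<bar>" "sqrt \<bar>c\<bar> * (sgn c * sqrt \<bar>c\<bar>) = c" for c :: real
    by (auto simp: sgn_if)
  show ?thesis
  proof (rule gramI[of "I <+> J" ?u ?v])
    show "(\<Sum>k\<in>I <+> J. (?u i k)\<^sup>2) \<le> 1" "(\<Sum>k\<in>I <+> J. (?v i k)\<^sup>2) \<le> 1" for i
      using bd[OF I(2)[of i] J(2)[of i]] bd[OF I(3)[of i] J(3)[of i]] I(1) J(1)
      by (simp_all add: sum.Plus power_mult_distrib sum_distrib_left s2)
    show "a * M i j + b * N i j = (\<Sum>k\<in>I <+> J. ?u i k * ?v j k)" for i j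
    proof -
      have "sqrt \<bar>c\<bar> * x * (sgn c * sqrt \<bar>c\<bar> * y) = c * (x * y)" for c x y :: real
        using arg_cong[OF s2(2)[of c], of "\<lambda>t. t * (x * y)"] by (simp only: mult_ac)
      then show ?thesis using I J by (simp only: sum.Plus sum_distrib_left sum.case o_def)
    qed
  qed (use I J in auto)
qed

lemma gram_bound:
  assumes "M \<in> gram_matrices" shows "\<bar>M i j\<bar> \<le> 1"
proof -
  obtain I u v where I: "finite I" "\<And>i. (\<Sum>k\<in>I. (u i k)\<^sup>2) \<le> 1" "\<And>j. (\<Sum>k\<in>I. (v j k)\<^sup>2) \<le> 1"
     "M = (\<lambda>i j. \<Sum>k\<in>(I :: nat set). u i k * v j k)"
    using assms(1) unfolding gram_matrices_def by blast
  have "\<bar>M i j\<bar> \<le> (\<Sum>k\<in>I. \<bar>u i k\<bar> * \<bar>v j k\<bar>)"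
    unfolding I by (auto intro!: order_trans[OF sum_abs] simp: abs_mult)
  also have "\<dots> \<le> L2_set (u i) I * L2_set (v j) I" by (rule L2_set_mult_ineq)
  also have "\<dots> \<le> 1 * 1" using I by (intro mult_mono) (auto simp: L2_set_def sum_nonneg)
  finally show ?thesis by simp
qed

lemma gram_zero: "(\<lambda>i j. 0) \<in> gram_matrices"
  by (rule gramI[of "{} :: nat set" "\<lambda>_ _. 0" "\<lambda>_ _. 0"]) auto

lemma gram_one: "(\<lambda>i j. 1) \<in> gram_matrices"
  by (rule gramI[of "{0} :: nat set" "\<lambda>_ _. 1" "\<lambda>_ _. 1"]) auto

text \<open>These are inner products of points of the unit circle.\<close>

lemma gram_cos: "(\<lambda>i j. cos (\<theta> i - \<phi> j)) \<in> gram_matrices"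
  by (rule gramI[of "UNIV :: bool set" "\<lambda>i b. if b then cos (\<theta> i) else sin (\<theta> i)" "\<lambda>j b. if b then cos (\<phi> j) else sin (\<phi> j)"])
     (auto simp: UNIV_bool cos_diff)

text \<open>This is the closure in the topology of entrywise convergence. It is needed because the matrices obtained from
  infinite power series are only limits of inner products of finite-dimensional vectors.\<close>

definition gram_closure :: "(nat \<Rightarrow> nat \<Rightarrow> real) set" where
  "gram_closure = {M. \<forall>\<epsilon>>0. \<forall>b. \<exists>N\<in>gram_matrices. \<forall>i<b. \<forall>j<b. \<bar>M i j - N i j\<bar> < \<epsilon>}"

lemma gram_closure_seq:
  "M \<in> gram_closure \<longleftrightarrow> (\<exists>S. (\<forall>n. S n \<in> gram_matrices) \<and> (\<forall>i j. (\<lambda>n. S n i j) \<longlonglongrightarrow> M i j))"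
proof
  assume M: "M \<in> gram_closure"
  have "\<exists>N\<in>gram_matrices. \<forall>i<n. \<forall>j<n. \<bar>M i j - N i j\<bar> < 1 / real (Suc n)" for n
    using M unfolding gram_closure_def by simp
  then obtain S where S: "\<And>n. S n \<in> gram_matrices" "\<And>n i j. i < n \<Longrightarrow> j < n \<Longrightarrow> \<bar>M i j - S n i j\<bar> < 1 / real (Suc n)"
    by metis
  have "(\<lambda>n. S n i j) \<longlonglongrightarrow> M i j" for i j
  proof (rule LIM_zero_cancel, rule Lim_null_comparison)
    show "(\<lambda>n. 1 / real (Suc n)) \<longlonglongrightarrow> 0"
      using LIMSEQ_inverse_real_of_nat by (simp add: divide_inverse)
    show "\<forall>\<^sub>F n in sequentially. norm (S n i j - M i j) \<le> 1 / real (Suc n)"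
      using eventually_gt_at_top[of "max i j"]
      by eventually_elim (use S(2) in \<open>auto simp: abs_minus_commute less_imp_le\<close>)
  qed
  then show "\<exists>S. (\<forall>n. S n \<in> gram_matrices) \<and> (\<forall>i j. (\<lambda>n. S n i j) \<longlonglongrightarrow> M i j)" using S(1) by blast
next
  assume "\<exists>S. (\<forall>n. S n \<in> gram_matrices) \<and> (\<forall>i j. (\<lambda>n. S n i j) \<longlonglongrightarrow> M i j)"
  then obtain S where S: "\<And>n. S n \<in> gram_matrices" "\<And>i j. (\<lambda>n. S n i j) \<longlonglongrightarrow> M i j" by blast
  show "M \<in> gram_closure" unfolding gram_closure_def
  proof (intro CollectI allI impI)
    fix \<epsilon> :: real and b :: nat assume "\<epsilon> > 0"
    then have "\<forall>\<^sub>F n in sequentially. \<bar>M i j - S n i j\<bar> < \<epsilon>" for i j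
      using tendstoD[OF S(2)] by (simp add: dist_real_def abs_minus_commute)
    then have "\<forall>\<^sub>F n in sequentially. \<forall>i\<in>{..<b}. \<forall>j\<in>{..<b}. \<bar>M i j - S n i j\<bar> < \<epsilon>"
      by (intro eventually_ball_finite ballI finite_lessThan)
    then obtain n where "\<forall>i\<in>{..<b}. \<forall>j\<in>{..<b}. \<bar>M i j - S n i j\<bar> < \<epsilon>"
      by (auto simp: eventually_sequentially)
    then show "\<exists>N\<in>gram_matrices. \<forall>i<b. \<forall>j<b. \<bar>M i j - N i j\<bar> < \<epsilon>" using S(1) by blast
  qed
qed

lemma gram_closure_limit:
  assumes "\<And>n. S n \<in> gram_closure" "\<And>i j. (\<lambda>n. S n i j) \<longlonglongrightarrow> M i j"
  shows "M \<in> gram_closure"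
  unfolding gram_closure_def
proof (intro CollectI allI impI)
  fix \<epsilon> :: real and b :: nat assume e: "\<epsilon> > 0"
  then have "\<forall>\<^sub>F n in sequentially. \<bar>M i j - S n i j\<bar> < \<epsilon> / 2" for i j
    using tendstoD[OF assms(2), of "\<epsilon> / 2"] by (simp add: dist_real_def abs_minus_commute)
  then have "\<forall>\<^sub>F n in sequentially. \<forall>i\<in>{..<b}. \<forall>j\<in>{..<b}. \<bar>M i j - S n i j\<bar> < \<epsilon> / 2"
    by (intro eventually_ball_finite ballI finite_lessThan)
  then obtain n where n: "\<forall>i\<in>{..<b}. \<forall>j\<in>{..<b}. \<bar>M i j - S n i j\<bar> < \<epsilon> / 2"
    by (auto simp: eventually_sequentially)
  obtain N where N: "N \<in> gram_matrices" "\<forall>i<b. \<forall>j<b. \<bar>S n i j - N i j\<bar> < \<epsilon> / 2"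
    using assms(1)[of n] half_gt_zero[OF e] unfolding gram_closure_def by blast
  have "\<bar>M i j - N i j\<bar> < \<epsilon>" if "i < b" "j < b" for i j
  proof -
    have "\<bar>M i j - S n i j\<bar> < \<epsilon> / 2" "\<bar>S n i j - N i j\<bar> < \<epsilon> / 2" using n N that by auto
    then show ?thesis by linarith
  qed
  with N(1) show "\<exists>N\<in>gram_matrices. \<forall>i<b. \<forall>j<b. \<bar>M i j - N i j\<bar> < \<epsilon>" by blast
qed

lemma gram_subset_closure: "M \<in> gram_matrices \<Longrightarrow> M \<in> gram_closure"
  unfolding gram_closure_seq by (intro exI[of _ "\<lambda>_. M"]) auto

lemma gram_closure_mult:
  assumes "M \<in> gram_closure" "N \<in> gram_closure" shows "(\<lambda>i j. M i j * N i j) \<in> gram_closure"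
proof -
  obtain S T where "\<And>n. S n \<in> gram_matrices" "\<And>i j. (\<lambda>n. S n i j) \<longlonglongrightarrow> M i j" "\<And>n. T n \<in> gram_matrices" "\<And>i j. (\<lambda>n. T n i j) \<longlonglongrightarrow> N i j"
    using assms unfolding gram_closure_seq by blast
  then show ?thesis unfolding gram_closure_seq
    by (intro exI[of _ "\<lambda>n i j. S n i j * T n i j"]) (auto intro: gram_mult tendsto_mult)
qed

lemma gram_closure_combine:
  assumes "M \<in> gram_closure" "N \<in> gram_closure" "\<bar>a\<bar> + \<bar>b\<bar> \<le> 1"
  shows "(\<lambda>i j. a * M i j + b * N i j) \<in> gram_closure"
proof -
  obtain S T where "\<And>n. S n \<in> gram_matrices" "\<And>i j. (\<lambda>n. S n i j) \<longlonglongrightarrow> M i j" "\<And>n. T n \<in> gram_matrices" "\<And>i j. (\<lambda>n. T n i j) \<longlonglongrightarrow> N i j"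
    using assms unfolding gram_closure_seq by blast
  then show ?thesis unfolding gram_closure_seq
    by (intro exI[of _ "\<lambda>n i j. a * S n i j + b * T n i j"]) (auto intro!: gram_combine tendsto_intros assms(3))
qed

lemma gram_closure_bound:
  assumes "M \<in> gram_closure" shows "\<bar>M i j\<bar> \<le> 1"
proof -
  obtain S where "\<And>n. S n \<in> gram_matrices" "(\<lambda>n. S n i j) \<longlonglongrightarrow> M i j"
    using assms unfolding gram_closure_seq by blast
  then show ?thesis
    using gram_bound by (intro tendsto_upperbound[OF tendsto_rabs, of "\<lambda>n. S n i j"]) auto
qed

text \<open>A bound on the gauge of \<open>gram_closure\<close>, the \<open>\<gamma>2\<close>-norm. This norm is subadditive and submultiplicative for entrywise
  products, which is what makes power series estimates available for matrices.\<close>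

definition gram_norm_le :: "real \<Rightarrow> (nat \<Rightarrow> nat \<Rightarrow> real) \<Rightarrow> bool" where
  "gram_norm_le r M \<longleftrightarrow> 0 \<le> r \<and> (\<exists>N\<in>gram_closure. M = (\<lambda>i j. r * N i j))"

lemma gram_norm_le_bound: "gram_norm_le r M \<Longrightarrow> \<bar>M i j\<bar> \<le> r"
  unfolding gram_norm_le_def using gram_closure_bound by (auto simp: abs_mult mult_left_le)

lemma gram_norm_le_closure: "M \<in> gram_closure \<Longrightarrow> gram_norm_le 1 M"
  unfolding gram_norm_le_def by auto

lemma gram_norm_le_combine:
  assumes "gram_norm_le r M" "gram_norm_le s N" "\<bar>a\<bar> * r + \<bar>b\<bar> * s \<le> q"
  shows "gram_norm_le q (\<lambda>i j. a * M i j + b * N i j)"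
proof -
  obtain M' N' where *: "0 \<le> r" "0 \<le> s" "M' \<in> gram_closure" "N' \<in> gram_closure" "M = (\<lambda>i j. r * M' i j)" "N = (\<lambda>i j. s * N' i j)"
    using assms unfolding gram_norm_le_def by auto
  have "0 \<le> \<bar>a\<bar> * r" "0 \<le> \<bar>b\<bar> * s" using * by auto
  then have q: "0 \<le> q" using assms(3) by linarith
  show ?thesis
  proof (cases "q = 0")
    case True
    then have "\<bar>a\<bar> * r = 0" "\<bar>b\<bar> * s = 0" using assms(3) \<open>0 \<le> \<bar>a\<bar> * r\<close> \<open>0 \<le> \<bar>b\<bar> * s\<close> by linarith+
    then show ?thesis unfolding gram_norm_le_def using True *
      by (auto intro!: bexI[OF _ gram_subset_closure[OF gram_zero]] simp: fun_eq_iff)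
  next
    case False
    then have qp: "q > 0" using q by simp
    have "\<bar>a * r / q\<bar> + \<bar>b * s / q\<bar> \<le> 1"
      using assms(3) qp * by (simp add: abs_mult abs_divide field_simps)
    from gram_closure_combine[OF *(3,4) this] show ?thesis unfolding gram_norm_le_def using q qp *
      by (auto intro!: bexI[rotated] simp: fun_eq_iff field_simps)
  qed
qed

lemma gram_norm_le_scale: "gram_norm_le r M \<Longrightarrow> gram_norm_le (\<bar>a\<bar> * r) (\<lambda>i j. a * M i j)"
  using gram_norm_le_combine[of r M r M a 0] by simp

lemma gram_norm_le_add: "gram_norm_le r M \<Longrightarrow> gram_norm_le s N \<Longrightarrow> gram_norm_le (r + s) (\<lambda>i j. M i j + N i j)"
  using gram_norm_le_combine[of r M s N 1 1] by simp

lemma gram_norm_le_mono: "gram_norm_le r M \<Longrightarrow> r \<le> s \<Longrightarrow> gram_norm_le s M"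
  using gram_norm_le_combine[of r M r M 1 0 s] by simp

lemma gram_norm_le_1: "gram_norm_le r M \<Longrightarrow> r \<le> 1 \<Longrightarrow> M \<in> gram_closure"
  using gram_norm_le_mono[of r M 1] unfolding gram_norm_le_def by auto

lemma gram_norm_le_zero: "gram_norm_le 0 (\<lambda>i j. 0)"
  unfolding gram_norm_le_def using gram_subset_closure[OF gram_zero] by auto

lemma gram_norm_le_mult:
  assumes "gram_norm_le r M" "gram_norm_le s N" shows "gram_norm_le (r * s) (\<lambda>i j. M i j * N i j)"
proof -
  obtain M' N' where *: "0 \<le> r" "0 \<le> s" "M' \<in> gram_closure" "N' \<in> gram_closure" "M = (\<lambda>i j. r * M' i j)" "N = (\<lambda>i j. s * N' i j)"
    using assms unfolding gram_norm_le_def by auto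
  then show ?thesis unfolding gram_norm_le_def
    by (auto intro!: bexI[OF _ gram_closure_mult[OF *(3,4)]] simp: fun_eq_iff)
qed

lemma gram_norm_le_power:
  assumes "gram_norm_le r M" shows "gram_norm_le (r ^ n) (\<lambda>i j. M i j ^ n)"
proof (induction n)
  case 0 then show ?case using gram_norm_le_closure[OF gram_subset_closure[OF gram_one]] by simp
next
  case (Suc n) then show ?case using gram_norm_le_mult[OF assms] by simp
qed

text \<open>The partial sums lie in the dilation of the closed set \<open>gram_closure\<close> by the total \<open>suminf r\<close>.\<close>

lemma gram_norm_le_suminf:
  assumes M: "\<And>k. gram_norm_le (r k) (M k)" and r: "summable r"
  shows "gram_norm_le (suminf r) (\<lambda>i j. \<Sum>k. M k i j)"
proof -
  have r0: "0 \<le> r k" for k using M[of k] by (simp add: gram_norm_le_def)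
  have fin: "gram_norm_le (sum r {..<n}) (\<lambda>i j. \<Sum>k<n. M k i j)" for n
    by (induction n) (auto intro: gram_norm_le_zero gram_norm_le_add M)
  have sm: "summable (\<lambda>k. M k i j)" for i j
    by (rule summable_comparison_test'[OF r, where N=0]) (use gram_norm_le_bound[OF M] in auto)
  have R0: "0 \<le> suminf r" using r r0 by (rule suminf_nonneg)
  show ?thesis
  proof (cases "suminf r = 0")
    case True
    then have "r k = 0" for k using suminf_eq_zero_iff[OF r r0] by auto
    then have "M k i j = 0" for k i j using gram_norm_le_bound[OF M[of k], of i j] by simp
    then show ?thesis using True gram_norm_le_zero by simp
  next
    case False
    then have R: "suminf r > 0" using R0 by simp
    have "(\<lambda>i j. 1 / suminf r * (\<Sum>k<n. M k i j)) \<in> gram_closure" for n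
    proof (rule gram_norm_le_1[OF gram_norm_le_scale[OF fin[of n]]])
      have "sum r {..<n} \<le> suminf r" using r r0 by (intro sum_le_suminf) auto
      then show "\<bar>1 / suminf r\<bar> * sum r {..<n} \<le> 1" using R by simp
    qed
    then have "(\<lambda>i j. 1 / suminf r * (\<Sum>k. M k i j)) \<in> gram_closure"
    proof (rule gram_closure_limit)
      show "(\<lambda>n. 1 / suminf r * (\<Sum>k<n. M k i j)) \<longlonglongrightarrow> 1 / suminf r * (\<Sum>k. M k i j)" for i j
        using summable_LIMSEQ[OF sm[of i j]] by (intro tendsto_intros)
    qed
    from gram_norm_le_scale[OF gram_norm_le_closure[OF this], of "suminf r"] show ?thesis using R by simp
  qed
qed

lemma gram_norm_le_powser:
  assumes "gram_norm_le r M" "summable (\<lambda>k. \<bar>c k\<bar> * r ^ k)"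
  shows "gram_norm_le (\<Sum>k. \<bar>c k\<bar> * r ^ k) (\<lambda>i j. \<Sum>k. c k * M i j ^ k)"
  by (rule gram_norm_le_suminf[OF gram_norm_le_scale[OF gram_norm_le_power[OF assms(1)]] assms(2)])

section \<open>Absolutely convergent power series and their value at \<open>\<i>\<close>\<close>

text \<open>An element of the Wiener algebra: the function \<open>f\<close> is represented on \<open>[-1, 1]\<close> by a real power series with absolutely summable coefficients,
  and \<open>v\<close> is the value of that series at \<open>\<i>\<close>. The value at \<open>\<i>\<close> is carried along as an argument because \<open>f\<close> is
  only a function of a real variable.\<close>

definition wiener :: "(real \<Rightarrow> real) \<Rightarrow> complex \<Rightarrow> bool" where
  "wiener f v \<longleftrightarrow> (\<exists>c. summable (\<lambda>k. \<bar>c k\<bar>) \<and> (\<forall>t. \<bar>t\<bar> \<le> 1 \<longrightarrow> (\<lambda>k. c k * t ^ k) sums f t) \<and>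
     (\<lambda>k. complex_of_real (c k) * \<i> ^ k) sums v)"

lemma wienerI:
  assumes "summable (\<lambda>k. \<bar>c k\<bar>)" "\<And>t. \<bar>t\<bar> \<le> 1 \<Longrightarrow> (\<lambda>k. c k * t ^ k) sums f t"
    "(\<lambda>k. complex_of_real (c k) * \<i> ^ k) sums v"
  shows "wiener f v"
  using assms unfolding wiener_def by blast

lemma wiener_lincomb:
  assumes "wiener f v" "wiener g w"
  shows "wiener (\<lambda>t. a * f t + b * g t) (of_real a * v + of_real b * w)"
proof -
  obtain c where c: "summable (\<lambda>k. \<bar>c k\<bar>)" "\<And>t. \<bar>t\<bar> \<le> 1 \<Longrightarrow> (\<lambda>k. c k * t ^ k) sums f t"
    "(\<lambda>k. complex_of_real (c k) * \<i> ^ k) sums v" using assms(1) unfolding wiener_def by blast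
  obtain d where d: "summable (\<lambda>k. \<bar>d k\<bar>)" "\<And>t. \<bar>t\<bar> \<le> 1 \<Longrightarrow> (\<lambda>k. d k * t ^ k) sums g t"
    "(\<lambda>k. complex_of_real (d k) * \<i> ^ k) sums w" using assms(2) unfolding wiener_def by blast
  show ?thesis
  proof (rule wienerI[of "\<lambda>k. a * c k + b * d k"])
    show "summable (\<lambda>k. \<bar>a * c k + b * d k\<bar>)"
    proof (rule summable_comparison_test'[where N=0])
      show "summable (\<lambda>k. \<bar>a\<bar> * \<bar>c k\<bar> + \<bar>b\<bar> * \<bar>d k\<bar>)" using c(1) d(1) by (intro summable_add summable_mult)
      show "norm \<bar>a * c k + b * d k\<bar> \<le> \<bar>a\<bar> * \<bar>c k\<bar> + \<bar>b\<bar> * \<bar>d k\<bar>" for k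
        using abs_triangle_ineq[of "a * c k" "b * d k"] by (simp add: abs_mult)
    qed
    show "(\<lambda>k. (a * c k + b * d k) * t ^ k) sums (a * f t + b * g t)" if "\<bar>t\<bar> \<le> 1" for t
      using sums_add[OF sums_mult[OF c(2)[OF that], of a] sums_mult[OF d(2)[OF that], of b]] by (simp add: algebra_simps)
    show "(\<lambda>k. complex_of_real (a * c k + b * d k) * \<i> ^ k) sums (of_real a * v + of_real b * w)"
      using sums_add[OF sums_mult[OF c(3), of "of_real a"] sums_mult[OF d(3), of "of_real b"]] by (simp add: algebra_simps)
  qed
qed

lemma wiener_scale: "wiener f v \<Longrightarrow> wiener (\<lambda>t. a * f t) (of_real a * v)"
  using wiener_lincomb[of f v f v a 0] by simp

text \<open>The Cauchy product of absolutely summable sequences is absolutely summable, and evaluation is multiplicative.\<close>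

lemma wiener_mult:
  assumes "wiener f v" "wiener g w"
  shows "wiener (\<lambda>t. f t * g t) (v * w)"
proof -
  obtain c where c: "summable (\<lambda>k. \<bar>c k\<bar>)" "\<And>t. \<bar>t\<bar> \<le> 1 \<Longrightarrow> (\<lambda>k. c k * t ^ k) sums f t"
    "(\<lambda>k. complex_of_real (c k) * \<i> ^ k) sums v" using assms(1) unfolding wiener_def by blast
  obtain d where d: "summable (\<lambda>k. \<bar>d k\<bar>)" "\<And>t. \<bar>t\<bar> \<le> 1 \<Longrightarrow> (\<lambda>k. d k * t ^ k) sums g t"
    "(\<lambda>k. complex_of_real (d k) * \<i> ^ k) sums w" using assms(2) unfolding wiener_def by blast
  let ?e = "\<lambda>k. \<Sum>i\<le>k. c i * d (k - i)"
  have bd: "summable (\<lambda>k. norm (c k * t ^ k))" "summable (\<lambda>k. norm (d k * t ^ k))" if "\<bar>t\<bar> \<le> 1" for t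
  proof -
    have "\<bar>x\<bar> * \<bar>t\<bar> ^ k \<le> \<bar>x\<bar>" for x k using that by (intro mult_left_le power_le_one) auto
    then show "summable (\<lambda>k. norm (c k * t ^ k))" "summable (\<lambda>k. norm (d k * t ^ k))"
      using summable_comparison_test'[OF c(1), of 0 "\<lambda>k. norm (c k * t ^ k)"]
        summable_comparison_test'[OF d(1), of 0 "\<lambda>k. norm (d k * t ^ k)"]
      by (auto simp: abs_mult power_abs)
  qed
  have e: "(\<Sum>i\<le>k. (of_real (c i) * z ^ i) * (of_real (d (k - i)) * z ^ (k - i))) = of_real (?e k) * z ^ k"
    for z :: "'a::real_normed_field" and k
    by (simp add: sum_distrib_right, intro sum.cong)
       (auto simp: mult_ac power_add[symmetric])
  show ?thesis
  proof (rule wienerI[of ?e])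
    have "summable (\<lambda>k. \<Sum>i\<le>k. \<bar>c i\<bar> * \<bar>d (k - i)\<bar>)"
      by (rule summable_Cauchy_product) (use c d in auto)
    then show "summable (\<lambda>k. \<bar>?e k\<bar>)"
    proof (rule summable_comparison_test'[where N=0])
      show "norm \<bar>?e k\<bar> \<le> (\<Sum>i\<le>k. \<bar>c i\<bar> * \<bar>d (k - i)\<bar>)" for k
        using sum_abs[of "\<lambda>i. c i * d (k - i)" "{..k}"] by (simp add: abs_mult)
    qed
    show "(\<lambda>k. ?e k * t ^ k) sums (f t * g t)" if "\<bar>t\<bar> \<le> 1" for t
      using Cauchy_product_sums[OF bd[OF that]] c(2)[OF that] d(2)[OF that] e[of t]
      by (simp add: sums_iff)
    have "summable (\<lambda>k. norm (complex_of_real (c k) * \<i> ^ k))" "summable (\<lambda>k. norm (complex_of_real (d k) * \<i> ^ k))"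
      using c(1) d(1) by (simp_all add: norm_mult norm_power)
    from Cauchy_product_sums[OF this] show "(\<lambda>k. complex_of_real (?e k) * \<i> ^ k) sums (v * w)"
      using c(3) d(3) unfolding e by (simp add: sums_iff)
  qed
qed

lemma wiener_power_id: "wiener (\<lambda>t. t ^ n) (\<i> ^ n)"
proof (rule wienerI[of "\<lambda>k. if k = n then 1 else 0"])
  have eq: "(\<lambda>k. of_real (if k = n then 1 else 0) * z ^ k) = (\<lambda>k. if k = n then z ^ k else 0)"
    for z :: "'a::real_field"
    by auto
  show "(\<lambda>k. (if k = n then 1 else 0) * t ^ k) sums t ^ n" for t :: real
    using sums_single[of n "\<lambda>k. t ^ k"] eq[of t] by simp
  show "(\<lambda>k. complex_of_real (if k = n then 1 else 0) * \<i> ^ k) sums \<i> ^ n"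
    unfolding eq by (rule sums_single)
  show "summable (\<lambda>k. \<bar>if k = n then 1 else 0 :: real\<bar>)"
    by (rule summable_finite[of "{n}"]) auto
qed

lemma wiener_id: "wiener (\<lambda>t. t) \<i>"
  using wiener_power_id[of 1] by simp

lemma wiener_zero: "wiener (\<lambda>t. 0) 0"
  using wiener_lincomb[OF wiener_power_id wiener_power_id, of 0 0 0 0] by simp

lemma wiener_sum:
  fixes n :: nat
  assumes "\<And>k. k < n \<Longrightarrow> wiener (f k) (v k)"
  shows "wiener (\<lambda>t. \<Sum>k<n. f k t) (\<Sum>k<n. v k)"
  using assms
proof (induction n)
  case 0 then show ?case using wiener_zero by simp
next
  case (Suc n)
  then show ?case using wiener_lincomb[OF Suc.IH, of "f n" "v n" 1 1] by simp
qed

lemma wiener_cos: "wiener (\<lambda>t. cos (l * t)) (of_real (cosh l))"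
proof (rule wienerI[of "\<lambda>k. cos_coeff k * l ^ k"])
  show "(\<lambda>k. cos_coeff k * l ^ k * t ^ k) sums cos (l * t)" for t
    using cos_converges[of "l * t"] by (simp add: power_mult_distrib mult.assoc)
  show "(\<lambda>k. complex_of_real (cos_coeff k * l ^ k) * \<i> ^ k) sums of_real (cosh l)"
  proof -
    have "cos (of_real l * \<i>) = cosh (complex_of_real l)"
      by (simp add: cosh_conv_cos mult.commute)
    also have "\<dots> = of_real (cosh l)"
      by (simp add: cosh_def exp_minus scaleR_conv_of_real exp_of_real)
    finally show ?thesis
      using cos_converges[of "of_real l * \<i>"]
      by (simp add: power_mult_distrib scaleR_conv_of_real mult_ac)
  qed
  show "summable (\<lambda>k. \<bar>cos_coeff k * l ^ k\<bar>)"
    using summable_norm_cos[of l] by simp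
qed

text \<open>Keeping the odd coefficients only does not change an odd function, and it does not change the imaginary part
  of the value at \<open>\<i>\<close>.\<close>

lemma wiener_odd:
  assumes "wiener f v" and odd: "\<And>t. \<bar>t\<bar> \<le> 1 \<Longrightarrow> f (- t) = - f t"
  obtains c where "summable (\<lambda>k. \<bar>c k\<bar>)" "\<And>t. \<bar>t\<bar> \<le> 1 \<Longrightarrow> (\<lambda>k. c k * t ^ k) sums f t"
    "\<And>k. even k \<Longrightarrow> c k = 0" "(\<lambda>k. c k * Im (\<i> ^ k)) sums Im v"
proof -
  obtain c where c: "summable (\<lambda>k. \<bar>c k\<bar>)" "\<And>t. \<bar>t\<bar> \<le> 1 \<Longrightarrow> (\<lambda>k. c k * t ^ k) sums f t"
    "(\<lambda>k. complex_of_real (c k) * \<i> ^ k) sums v" using assms(1) unfolding wiener_def by blast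
  let ?d = "\<lambda>k. if even k then 0 else c k"
  show ?thesis
  proof (rule that[of ?d])
    show "summable (\<lambda>k. \<bar>?d k\<bar>)" by (rule summable_comparison_test'[OF c(1), of 0]) auto
    show "(\<lambda>k. ?d k * t ^ k) sums f t" if "\<bar>t\<bar> \<le> 1" for t
    proof -
      have "(\<lambda>k. (c k * t ^ k - c k * (- t) ^ k) / 2) sums ((f t - f (- t)) / 2)"
        using that by (intro sums_divide sums_diff c(2)) auto
      moreover have "(c k * t ^ k - c k * (- t) ^ k) / 2 = ?d k * t ^ k" for k by simp
      ultimately show ?thesis using odd[OF that] by simp
    qed
    have "(\<lambda>k. Im (complex_of_real (c k) * \<i> ^ k)) sums Im v" using c(3) by (rule sums_Im)
    moreover have "(\<lambda>k. Im (complex_of_real (c k) * \<i> ^ k)) = (\<lambda>k. ?d k * Im (\<i> ^ k))"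
    proof
      fix k
      have "Im (\<i> ^ k) = 0" if "even k" using that by (auto elim!: evenE simp: power_mult)
      then show "Im (complex_of_real (c k) * \<i> ^ k) = ?d k * Im (\<i> ^ k)" by simp
    qed
    ultimately show "(\<lambda>k. ?d k * Im (\<i> ^ k)) sums Im v" by (simp only:)
  qed auto
qed

text \<open>All poles have modulus \<open>sqrt (1 + 1 / l\<^sup>2) > 1\<close>, so the Taylor series at 0 converges absolutely on the closed unit
  disc. At \<open>\<i>\<close> the two factors are \<open>1 + 2 * \<i> * l\<^sup>2\<close> and \<open>1 - 2 * \<i> * l\<^sup>2\<close>.\<close>

lemma wiener_rational:
  "wiener (\<lambda>t. 1 / ((1 + l\<^sup>2 * (1 + t)\<^sup>2) * (1 + l\<^sup>2 * (1 - t)\<^sup>2))) (1 / of_real (1 + 4 * l ^ 4))"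
proof (cases "l = 0")
  case True then show ?thesis using wiener_power_id[of 0] by simp
next
  case False
  define f where "f z = 1 / ((1 + (of_real l)\<^sup>2 * (1 + z)\<^sup>2) * (1 + (of_real l)\<^sup>2 * (1 - z)\<^sup>2))" for z :: complex
  define R where "R = sqrt (1 + 1 / l\<^sup>2)"
  have R: "R > 1" using False by (simp add: R_def)
  have nz: "1 + (of_real l)\<^sup>2 * (1 + z)\<^sup>2 \<noteq> 0" if "norm z < R" for z :: complex
  proof
    assume "1 + (of_real l)\<^sup>2 * (1 + z)\<^sup>2 = 0"
    then have "(of_real l * (1 + z))\<^sup>2 = \<i>\<^sup>2" by (simp add: power_mult_distrib add_eq_0_iff)
    then have "of_real l * (1 + z) = \<i> \<or> of_real l * (1 + z) = - \<i>" by (simp only: power2_eq_iff)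
    then have "l * (1 + Re z) = 0" "l * Im z = 1 \<or> l * Im z = -1"
      by (auto simp: complex_eq_iff)
    then have "Re z = -1" "(l * Im z)\<^sup>2 = 1" using False by auto
    then have "(norm z)\<^sup>2 = 1 + 1 / l\<^sup>2" using False
      unfolding cmod_power2 by (simp add: power_mult_distrib field_simps)
    then have "norm z = R" unfolding R_def by (metis norm_ge_zero real_sqrt_unique)
    with that show False by simp
  qed
  have nz2: "1 + (of_real l)\<^sup>2 * (1 - z)\<^sup>2 \<noteq> 0" if "norm z < R" for z :: complex
    using nz[of "- z"] that by simp
  have hol: "f holomorphic_on ball 0 R"
    unfolding f_def using nz nz2 by (auto intro!: holomorphic_intros)
  define a where "a n = (deriv ^^ n) f 0 / fact n" for n
  have sums: "(\<lambda>n. a n * z ^ n) sums f z" if "norm z < R" for z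
    using holomorphic_power_series[OF hol, of z] that by (simp add: a_def)
  have sa: "summable (\<lambda>n. norm (a n))"
  proof -
    have "norm (of_real ((1 + R) / 2) :: complex) < R" "norm (1::complex) < norm (of_real ((1 + R) / 2) :: complex)"
      using R by (auto simp: norm_of_real simp del: of_real_divide of_real_add)
    from powser_insidea[OF sums_summable[OF sums[OF this(1)]] this(2)] show ?thesis by simp
  qed
  have fi: "f \<i> = 1 / of_real (1 + 4 * l ^ 4)" "f (- \<i>) = 1 / of_real (1 + 4 * l ^ 4)"
    unfolding f_def by (auto simp: power2_eq_square algebra_simps power4_eq_xxxx)
  show ?thesis
  proof (rule wienerI[of "\<lambda>n. Re (a n)"])
    show "summable (\<lambda>n. \<bar>Re (a n)\<bar>)"
      by (rule summable_comparison_test'[OF sa, of 0]) (auto simp: abs_Re_le_cmod)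
    fix t :: real assume t: "\<bar>t\<bar> \<le> 1"
    have "(\<lambda>n. Re (a n * of_real t ^ n)) sums Re (f (of_real t))"
      using t R by (intro sums_Re sums) auto
    moreover have "Re (f (of_real t)) = 1 / ((1 + l\<^sup>2 * (1 + t)\<^sup>2) * (1 + l\<^sup>2 * (1 - t)\<^sup>2))"
    proof -
      have "f (of_real t) = of_real (1 / ((1 + l\<^sup>2 * (1 + t)\<^sup>2) * (1 + l\<^sup>2 * (1 - t)\<^sup>2)))"
        unfolding f_def by simp
      then show ?thesis by (simp only: Re_complex_of_real)
    qed
    moreover have "Re (a n * of_real t ^ n) = Re (a n) * t ^ n" for n
      by (simp flip: of_real_power)
    ultimately show "(\<lambda>n. Re (a n) * t ^ n) sums (1 / ((1 + l\<^sup>2 * (1 + t)\<^sup>2) * (1 + l\<^sup>2 * (1 - t)\<^sup>2)))" by simp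
  next
    \<comment> \<open>Passing to real parts of the coefficients averages \<open>f \<i>\<close> with the conjugate of \<open>f (- \<i>)\<close>.\<close>
    have "(\<lambda>n. cnj (a n * (- \<i>) ^ n)) sums cnj (f (- \<i>))"
      using sums[of "- \<i>"] R by (simp only: sums_cnj) simp
    then have "(\<lambda>n. (a n * \<i> ^ n + cnj (a n * (- \<i>) ^ n)) / 2) sums ((f \<i> + cnj (f (- \<i>))) / 2)"
      using R by (intro sums_divide sums_add sums) auto
    moreover have "(a n * \<i> ^ n + cnj (a n * (- \<i>) ^ n)) / 2 = of_real (Re (a n)) * \<i> ^ n" for n
    proof -
      have "(a n * \<i> ^ n + cnj (a n * (- \<i>) ^ n)) / 2 = ((a n + cnj (a n)) / 2) * \<i> ^ n"
        by (simp add: algebra_simps add_divide_distrib)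
      then show ?thesis by (simp add: complex_add_cnj)
    qed
    moreover have "(f \<i> + cnj (f (- \<i>))) / 2 = 1 / of_real (1 + 4 * l ^ 4)"
    proof -
      have g: "(of_real q + cnj (of_real q)) / 2 = (of_real q :: complex)" for q by simp
      have "1 / of_real (1 + 4 * l ^ 4) = complex_of_real (1 / (1 + 4 * l ^ 4))" by simp
      then show ?thesis unfolding fi using g[of "1 / (1 + 4 * l ^ 4)"] by (simp only:)
    qed
    ultimately show "(\<lambda>n. complex_of_real (Re (a n)) * \<i> ^ n) sums (1 / of_real (1 + 4 * l ^ 4))" by simp
  qed
qed

section \<open>Perturbing Krivine's sine transformation\<close>

text \<open>The sign pattern of the sine series is that of the powers of \<open>\<i>\<close>; the perturbation argument depends on this.\<close>

lemma sin_coeff_Im: "sin_coeff k = Im (\<i> ^ k) / fact k"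
  by (cases "even k") (auto elim!: evenE oddE simp: sin_coeff_def power_mult)

lemma abs_Im_i_power: "\<bar>Im (\<i> ^ k)\<bar> \<le> 1"
  using abs_Im_le_cmod[of "\<i> ^ k"] by (simp add: norm_power)

lemma abs_Im_i_power_odd: "odd k \<Longrightarrow> \<bar>Im (\<i> ^ k)\<bar> = 1"
  by (auto elim!: oddE simp: power_mult)

lemma Im_i_power_even: "even k \<Longrightarrow> Im (\<i> ^ k) = 0"
  by (auto elim!: evenE simp: power_mult)

lemma sin_coeff_sums_sinh:
  assumes "0 \<le> l"
  shows "(\<lambda>k. \<bar>sin_coeff k * l ^ k\<bar>) sums sinh l"
proof -
  have "(\<lambda>k. \<bar>sin_coeff k * l ^ k\<bar>) = (\<lambda>k. if even k then 0 else l ^ k /\<^sub>R fact k)"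
    using assms by (auto simp: fun_eq_iff sin_coeff_Im Im_i_power_even abs_mult abs_Im_i_power_odd divide_inverse)
  then show ?thesis using sinh_converges[of l] by simp
qed

text \<open>Series that start in degree 2, such as \<open>cos x - 1\<close> and \<open>sin x - x\<close>, contribute only at second order.\<close>

lemma gram_norm_le_second_order:
  assumes X: "gram_norm_le r X" and r: "r \<le> 1"
    and e: "\<And>k. \<bar>e k\<bar> \<le> 1 / fact k" and F: "\<And>x. (\<lambda>k. e k * x ^ k) sums F x"
  shows "gram_norm_le (r\<^sup>2) (\<lambda>i j. F (X i j) - (e 0 + e 1 * X i j))"
proof -
  have r0: "0 \<le> r" using X by (simp add: gram_norm_le_def)
  define d where "d k = (if k < 2 then 0 else e k)" for k
  have drop: "(\<lambda>k. if k < 2 then 0 else f k) sums (s - (f 0 + f 1))" if "f sums s" for f :: "nat \<Rightarrow> real" and s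
  proof -
    have "(\<lambda>k. f k - (if k \<in> {..<2} then f k else 0)) sums (s - (\<Sum>k<2. f k))"
      by (intro sums_diff that sums_If_finite_set) simp
    moreover have "(\<lambda>k. f k - (if k \<in> {..<2} then f k else 0)) = (\<lambda>k. if k < 2 then 0 else f k)" by auto
    ultimately show ?thesis by (simp add: numeral_2_eq_2)
  qed
  let ?g = "\<lambda>k. if k < 2 then 0 else r ^ k / fact k"
  have "(\<lambda>k. r ^ k / fact k) sums exp r"
    using exp_converges[of r] by (simp add: divide_inverse mult.commute)
  from drop[OF this] have g: "?g sums (exp r - (1 + r))" by simp
  have bd: "\<bar>d k\<bar> * r ^ k \<le> ?g k" for k
    using mult_right_mono[OF e[of k] zero_le_power[OF r0, of k]] by (simp add: d_def)
  have sm: "summable (\<lambda>k. \<bar>d k\<bar> * r ^ k)"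
    by (rule summable_comparison_test'[OF sums_summable[OF g], of 0]) (use bd r0 in auto)
  have "(\<Sum>k. \<bar>d k\<bar> * r ^ k) \<le> exp r - (1 + r)"
    using sums_unique[OF g] suminf_le[OF bd sm sums_summable[OF g]] by simp
  also have "\<dots> \<le> r\<^sup>2" using exp_bound[OF r0 r] by simp
  finally have "gram_norm_le (r\<^sup>2) (\<lambda>i j. \<Sum>k. d k * X i j ^ k)"
    using gram_norm_le_mono[OF gram_norm_le_powser[OF X sm]] by blast
  moreover have "(\<Sum>k. d k * X i j ^ k) = F (X i j) - (e 0 + e 1 * X i j)" for i j
  proof -
    have "(\<lambda>k. if k < 2 then 0 else e k * X i j ^ k) = (\<lambda>k. d k * X i j ^ k)" by (auto simp: d_def)
    then show ?thesis using drop[OF F[of "X i j"]] by (simp add: sums_iff)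
  qed
  ultimately show ?thesis by simp
qed

text \<open>Expanding, \<open>sin (l * t + p * b t)\<close> is \<open>sin (l * t) + p * b t * cos (l * t)\<close> up to an error of gauge \<open>O(p\<^sup>2)\<close>. Let
  \<open>s\<close> and \<open>d\<close> be the coefficients of \<open>sin (l * t)\<close> and of \<open>b t * cos (l * t)\<close>. For the finitely many odd
  \<open>k < N\<close> a small \<open>p\<close> leaves the sign of \<open>s k\<close> unchanged, so there the absolute sum of \<open>s k + p * d k\<close> is linear
  in \<open>p\<close>; over all \<open>k\<close> the linear terms add up to \<open>p * Im (v * cosh l) < 0\<close>. The remaining \<open>k\<close> cost at most
  twice \<open>p\<close> times the tail of the absolutely convergent series \<open>d\<close>. A first-order gain thus beats the
  second-order error. The range statement allows the sine to be inverted later.\<close>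

lemma sin_perturbation:
  assumes b: "wiener b v" "\<And>t. \<bar>t\<bar> \<le> 1 \<Longrightarrow> b (- t) = - b t" and v: "Im v < 0"
    and l: "0 < l" "sinh l = 1" "l < pi / 2"
  shows "\<exists>p>0. (\<forall>t. \<bar>t\<bar> \<le> 1 \<longrightarrow> \<bar>l * t + p * b t\<bar> \<le> pi / 2) \<and>
    (\<forall>T\<in>gram_closure. (\<lambda>i j. sin (l * T i j + p * b (T i j))) \<in> gram_closure)"
proof -
  obtain c where c: "summable (\<lambda>k. \<bar>c k\<bar>)" "\<And>t. \<bar>t\<bar> \<le> 1 \<Longrightarrow> (\<lambda>k. c k * t ^ k) sums b t"
    using b(1) unfolding wiener_def by blast
  define B where "B = (\<Sum>k. \<bar>c k\<bar>)"
  have B0: "0 \<le> B" unfolding B_def using c(1) by (intro suminf_nonneg) auto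
  have wd: "wiener (\<lambda>t. b t * cos (l * t)) (v * of_real (cosh l))"
    by (intro wiener_mult b(1) wiener_cos)
  obtain d where d: "summable (\<lambda>k. \<bar>d k\<bar>)" "\<And>t. \<bar>t\<bar> \<le> 1 \<Longrightarrow> (\<lambda>k. d k * t ^ k) sums (b t * cos (l * t))"
    "\<And>k. even k \<Longrightarrow> d k = 0" "(\<lambda>k. d k * Im (\<i> ^ k)) sums Im (v * of_real (cosh l))"
    using wiener_odd[OF wd] b(2) by auto
  define \<delta> where "\<delta> = - Im (v * of_real (cosh l))"
  have \<delta>: "\<delta> > 0" unfolding \<delta>_def using v cosh_real_pos[of l] by (simp add: mult_neg_pos)
  obtain N where N: "\<bar>\<Sum>k. \<bar>d (k + N)\<bar>\<bar> < \<delta> / 4"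
    using suminf_exist_split[OF _ d(1), of "\<delta>/4"] \<delta> by (auto simp: real_norm_def)
  define s where "s k = sin_coeff k * l ^ k" for k
  define sg where "sg k = Im (\<i> ^ k)" for k
  have s1: "(\<lambda>k. \<bar>s k\<bar>) sums 1" unfolding s_def using sin_coeff_sums_sinh[of l] l by simp
  have s_sg: "s k = \<bar>s k\<bar> * sg k" for k
  proof -
    have "sg k = sg k * \<bar>sg k\<bar>"
      by (cases "even k") (auto simp: sg_def Im_i_power_even abs_Im_i_power_odd)
    then show ?thesis using l(1) by (simp add: s_def sin_coeff_Im sg_def abs_mult mult_ac)
  qed
  define C0 where "C0 = (\<Sum>k. \<bar>cos_coeff k * l ^ k\<bar>)"
  have C0s: "summable (\<lambda>k. \<bar>cos_coeff k * l ^ k\<bar>)" using summable_norm_cos[of l] by simp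
  have C0: "0 \<le> C0" unfolding C0_def using C0s by (intro suminf_nonneg) auto
  \<comment> \<open>The second-order error has gauge at most \<open>C * p\<^sup>2\<close>.\<close>
  define C where "C = (1 + C0) * B\<^sup>2"
  have ev: "\<forall>\<^sub>F p in at_right 0. 0 < p \<and> (\<forall>k\<in>{k. k < N \<and> odd k}. p * \<bar>d k\<bar> < \<bar>s k\<bar>) \<and>
      p * B < 1 \<and> l + p * B < pi / 2 \<and> C * p < \<delta> / 2"
  proof (intro eventually_conj eventually_ball_finite ballI)
    show "\<forall>\<^sub>F p in at_right 0. 0 < (p::real)" by (rule eventually_at_right_less)
    have id0: "((\<lambda>p. p) \<longlongrightarrow> (0::real)) (at_right 0)" by (rule tendsto_ident_at)
    show "\<forall>\<^sub>F p in at_right 0. p * \<bar>d k\<bar> < \<bar>s k\<bar>" if "k \<in> {k. k < N \<and> odd k}" for k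
    proof (rule order_tendstoD(2))
      show "((\<lambda>p. p * \<bar>d k\<bar>) \<longlongrightarrow> 0 * \<bar>d k\<bar>) (at_right 0)" by (intro tendsto_mult id0 tendsto_const)
      have "Im (\<i> ^ k) \<noteq> 0" using abs_Im_i_power_odd[of k] that by auto
      then show "0 * \<bar>d k\<bar> < \<bar>s k\<bar>" using l by (auto simp: s_def sin_coeff_Im)
    qed
    have "((\<lambda>p. p * B) \<longlongrightarrow> 0 * B) (at_right 0)" by (intro tendsto_mult id0 tendsto_const)
    then show "\<forall>\<^sub>F p in at_right 0. p * B < 1" by (rule order_tendstoD(2)) simp
    have "((\<lambda>p. l + p * B) \<longlongrightarrow> l + 0 * B) (at_right 0)" by (intro tendsto_add tendsto_mult id0 tendsto_const)
    then show "\<forall>\<^sub>F p in at_right 0. l + p * B < pi / 2" by (rule order_tendstoD(2)) (use l in simp)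
    have "((\<lambda>p. C * p) \<longlongrightarrow> C * 0) (at_right 0)" by (intro tendsto_mult id0 tendsto_const)
    then show "\<forall>\<^sub>F p in at_right 0. C * p < \<delta> / 2" by (rule order_tendstoD(2)) (use \<delta> in simp)
  qed auto
  obtain p where p: "0 < p" "\<And>k. k < N \<Longrightarrow> odd k \<Longrightarrow> p * \<bar>d k\<bar> < \<bar>s k\<bar>"
      "p * B < 1" "l + p * B < pi / 2" "C * p < \<delta> / 2"
    using eventually_happens'[OF _ ev] by auto
  have bB: "\<bar>b t\<bar> \<le> B" if t: "\<bar>t\<bar> \<le> 1" for t
  proof -
    have le: "norm (c k * t ^ k) \<le> \<bar>c k\<bar>" for k
      using t by (auto simp: abs_mult power_abs intro!: mult_left_le power_le_one)
    have "norm (\<Sum>k. c k * t ^ k) \<le> (\<Sum>k. \<bar>c k\<bar>)"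
      by (rule norm_suminf_le[OF le c(1)])
    then show ?thesis using sums_unique[OF c(2)[OF t]] by (simp add: B_def)
  qed
  have range: "\<bar>l * t + p * b t\<bar> \<le> pi / 2" if t: "\<bar>t\<bar> \<le> 1" for t
  proof -
    have "\<bar>l * t\<bar> \<le> l" using t l by (simp add: abs_mult mult_left_le)
    moreover have "\<bar>p * b t\<bar> \<le> p * B" using bB[OF t] p by (simp add: abs_mult)
    ultimately show ?thesis using p(4) by linarith
  qed
  \<comment> \<open>The first-order part: compare each coefficient with a bound that is linear in \<open>p\<close>, and sum.\<close>
  have first: "summable (\<lambda>k. \<bar>s k + p * d k\<bar>)" "(\<Sum>k. \<bar>s k + p * d k\<bar>) \<le> 1 - p * \<delta> / 2"
  proof -
    define tail where "tail k = (if k < N then 0 else \<bar>d k\<bar>)" for k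
    have tail_summable: "summable tail"
      unfolding tail_def by (rule summable_comparison_test'[OF d(1), of 0]) auto
    have tail_sum: "suminf tail < \<delta> / 4"
    proof -
      have "suminf tail = (\<Sum>k. tail (k + N)) + (\<Sum>k<N. tail k)"
        by (rule suminf_split_initial_segment[OF tail_summable])
      also have "\<dots> = (\<Sum>k. \<bar>d (k + N)\<bar>)" by (simp add: tail_def)
      finally show ?thesis using N by simp
    qed
    have dsum: "(\<lambda>k. d k * sg k) sums (- \<delta>)" using d(4) by (simp add: sg_def \<delta>_def)
    have sums: "(\<lambda>k. \<bar>s k\<bar> + p * (d k * sg k) + 2 * p * tail k) sums (1 + p * (- \<delta>) + 2 * p * suminf tail)"
      by (intro sums_add sums_mult s1 dsum summable_sums tail_summable)
    have le: "\<bar>s k + p * d k\<bar> \<le> \<bar>s k\<bar> + p * (d k * sg k) + 2 * p * tail k" for k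
    proof (cases "k < N \<and> odd k")
      case True
      then have sgk: "sg k = 1 \<or> sg k = -1" using abs_Im_i_power_odd[of k] by (auto simp: sg_def abs_if split: if_splits)
      have *: "p * \<bar>d k\<bar> < \<bar>s k\<bar>" using True p(2) by auto
      have pd: "\<bar>p * d k\<bar> < \<bar>s k\<bar>" using * p(1) by (simp add: abs_mult)
      have t: "tail k = 0" using True by (simp add: tail_def)
      from sgk show ?thesis
      proof
        assume "sg k = 1"
        then show ?thesis using s_sg[of k] pd t by simp
      next
        assume "sg k = -1"
        then show ?thesis using s_sg[of k] pd t by simp
      qed
    next
      case False
      show ?thesis
      proof (cases "even k")
        case True
        then show ?thesis using d(3)[of k] p(1) by (simp add: s_def sin_coeff_Im Im_i_power_even tail_def)
      next
        case odd: False
        then have t: "tail k = \<bar>d k\<bar>" using False by (simp add: tail_def)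
        have "\<bar>d k * sg k\<bar> \<le> \<bar>d k\<bar>" using abs_Im_i_power[of k] by (simp add: abs_mult sg_def mult_left_le)
        then have "\<bar>p * (d k * sg k)\<bar> \<le> p * \<bar>d k\<bar>" using p(1) by (simp add: abs_mult)
        moreover have "\<bar>s k + p * d k\<bar> \<le> \<bar>s k\<bar> + p * \<bar>d k\<bar>" using p(1) abs_triangle_ineq[of "s k" "p * d k"] by (simp add: abs_mult)
        ultimately show ?thesis unfolding t by linarith
      qed
    qed
    show sm: "summable (\<lambda>k. \<bar>s k + p * d k\<bar>)"
      by (rule summable_comparison_test'[OF sums_summable[OF sums], of 0]) (use le in auto)
    have "(\<Sum>k. \<bar>s k + p * d k\<bar>) \<le> 1 + p * (- \<delta>) + 2 * p * suminf tail"
      using sums_unique[OF sums] suminf_le[OF le sm sums_summable[OF sums]] by simp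
    also have "2 * p * suminf tail \<le> 2 * p * (\<delta> / 4)" using tail_sum p(1) by (intro mult_left_mono) auto
    finally show "(\<Sum>k. \<bar>s k + p * d k\<bar>) \<le> 1 - p * \<delta> / 2" by (simp add: mult.commute)
  qed
  have "(\<lambda>i j. sin (l * T i j + p * b (T i j))) \<in> gram_closure" if T: "T \<in> gram_closure" for T
  proof -
    have T1: "gram_norm_le 1 T" by (rule gram_norm_le_closure[OF T])
    have Tb: "\<bar>T i j\<bar> \<le> 1" for i j by (rule gram_closure_bound[OF T])
    define X where "X i j = p * b (T i j)" for i j
    have "gram_norm_le (\<Sum>k. \<bar>c k\<bar> * 1 ^ k) (\<lambda>i j. \<Sum>k. c k * T i j ^ k)"
      by (rule gram_norm_le_powser[OF T1]) (use c(1) in simp)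
    then have "gram_norm_le B (\<lambda>i j. b (T i j))" using c(2)[OF Tb] by (simp add: B_def sums_iff)
    then have X: "gram_norm_le (p * B) X" using gram_norm_le_scale[of B _ p] p(1) by (simp add: X_def[abs_def])
    have "gram_norm_le (\<Sum>k. \<bar>s k + p * d k\<bar> * 1 ^ k) (\<lambda>i j. \<Sum>k. (s k + p * d k) * T i j ^ k)"
      by (rule gram_norm_le_powser[OF T1]) (use first in simp)
    moreover have "(\<Sum>k. (s k + p * d k) * T i j ^ k) = sin (l * T i j) + X i j * cos (l * T i j)" for i j
    proof -
      have "(\<lambda>k. s k * T i j ^ k) sums sin (l * T i j)"
        using sin_converges[of "l * T i j"] by (simp add: s_def power_mult_distrib mult.assoc)
      from sums_add[OF this sums_mult[OF d(2)[OF Tb, of i j], of p]]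
      show ?thesis by (simp add: sums_iff algebra_simps X_def)
    qed
    ultimately have A: "gram_norm_le (1 - p * \<delta> / 2) (\<lambda>i j. sin (l * T i j) + X i j * cos (l * T i j))"
      using first(2) gram_norm_le_mono by simp
    have "gram_norm_le (\<Sum>k. \<bar>s k\<bar> * 1 ^ k) (\<lambda>i j. \<Sum>k. s k * T i j ^ k)"
      by (rule gram_norm_le_powser[OF T1]) (use sums_summable[OF s1] in simp)
    moreover have "(\<Sum>k. s k * T i j ^ k) = sin (l * T i j)" for i j
      using sin_converges[of "l * T i j"] by (simp add: s_def power_mult_distrib mult.assoc sums_iff)
    ultimately have S: "gram_norm_le 1 (\<lambda>i j. sin (l * T i j))" using s1 by (simp add: sums_iff)
    have "gram_norm_le (\<Sum>k. \<bar>cos_coeff k * l ^ k\<bar> * 1 ^ k) (\<lambda>i j. \<Sum>k. cos_coeff k * l ^ k * T i j ^ k)"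
      by (rule gram_norm_le_powser[OF T1]) (use C0s in simp)
    moreover have "(\<Sum>k. cos_coeff k * l ^ k * T i j ^ k) = cos (l * T i j)" for i j
      using cos_converges[of "l * T i j"] by (simp add: power_mult_distrib mult.assoc sums_iff)
    ultimately have K: "gram_norm_le C0 (\<lambda>i j. cos (l * T i j))" by (simp add: C0_def)
    have cf: "\<bar>cos_coeff k\<bar> \<le> 1 / fact k" "\<bar>sin_coeff k\<bar> \<le> 1 / fact k" for k
      by (auto simp: cos_coeff_def sin_coeff_def abs_mult power_abs)
    have E1: "gram_norm_le ((p * B)\<^sup>2) (\<lambda>i j. cos (X i j) - 1)"
      using gram_norm_le_second_order[OF X _ cf(1), of cos] p(3) cos_converges[where 'a=real]
      by (simp add: cos_coeff_def)
    have E2: "gram_norm_le ((p * B)\<^sup>2) (\<lambda>i j. sin (X i j) - X i j)"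
      using gram_norm_le_second_order[OF X _ cf(2), of sin] p(3) sin_converges[where 'a=real]
      by (simp add: sin_coeff_def)
    have "gram_norm_le (1 - p * \<delta> / 2 + (1 * (p * B)\<^sup>2 + C0 * (p * B)\<^sup>2))
      (\<lambda>i j. (sin (l * T i j) + X i j * cos (l * T i j)) +
         (sin (l * T i j) * (cos (X i j) - 1) + cos (l * T i j) * (sin (X i j) - X i j)))"
      by (intro gram_norm_le_add gram_norm_le_mult A S K E1 E2)
    moreover have "(sin (l * T i j) + X i j * cos (l * T i j)) +
         (sin (l * T i j) * (cos (X i j) - 1) + cos (l * T i j) * (sin (X i j) - X i j)) = sin (l * T i j + p * b (T i j))" for i j
      unfolding X_def[symmetric] sin_add by (simp add: algebra_simps)
    moreover have "1 - p * \<delta> / 2 + (1 * (p * B)\<^sup>2 + C0 * (p * B)\<^sup>2) \<le> 1"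
    proof -
      have "1 * (p * B)\<^sup>2 + C0 * (p * B)\<^sup>2 = (C * p) * p" by (simp add: C_def power2_eq_square algebra_simps)
      also have "\<dots> \<le> \<delta> / 2 * p" using p by (intro mult_right_mono) auto
      finally show ?thesis by (simp add: mult.commute)
    qed
    ultimately show ?thesis using gram_norm_le_1 by simp
  qed
  with p(1) range show ?thesis by blast
qed

section \<open>A weighted integral of \<open>arsinh \<circ> cos\<close>\<close>

text \<open>The exponential distribution serves as the reference measure for integrals with weight \<open>exp (- y)\<close> on the
  half-line: bounded functions are then integrable.\<close>

definition exp_dist :: "real measure" where
  "exp_dist = density lborel (exponential_density 1)"

lemma prob_space_exp_dist: "prob_space exp_dist"
  unfolding exp_dist_def by (rule prob_space_exponential_density) simp

lemma sets_exp_dist[simp, measurable_cong]: "sets exp_dist = sets borel"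
  by (simp add: exp_dist_def)

lemma space_exp_dist[simp]: "space exp_dist = UNIV"
  by (simp add: exp_dist_def)

lemma integral_exp_dist:
  fixes h :: "real \<Rightarrow> real"
  assumes "h \<in> borel_measurable borel"
  shows "(LINT y|exp_dist. h y) = (LINT y|lborel. exponential_density 1 y * h y)"
    and "integrable exp_dist h \<longleftrightarrow> integrable lborel (\<lambda>y. exponential_density 1 y * h y)"
  using assms unfolding exp_dist_def
  by (auto simp: integral_density integrable_density exponential_density_def)

lemma integrable_exp_dist_id: "integrable exp_dist (\<lambda>y. y)"
proof -
  have "integrable lborel (\<lambda>y::real. exponential_density 1 y * y)"
  proof (rule integrableI_nonneg)
    have "(\<integral>\<^sup>+ y. ennreal (exponential_density 1 y * y) \<partial>lborel) = (\<integral>\<^sup>+ x. ennreal (x^1 * exp (-x)) * indicator {0 ..} x \<partial>lborel)"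
      by (intro nn_integral_cong) (auto simp: exponential_density_def mult.commute split: split_indicator)
    also have "\<dots> < \<infinity>" by (subst nn_intergal_power_times_exp_Ici) simp
    finally show "(\<integral>\<^sup>+ y. ennreal (exponential_density 1 y * y) \<partial>lborel) < \<infinity>" .
  qed (auto simp: exponential_density_def)
  then show ?thesis by (subst integral_exp_dist) auto
qed

lemma exp_dist_FTC:
  assumes deriv: "\<And>y. (F has_real_derivative h y * exp (- y)) (at y)"
    and cont: "continuous_on UNIV h" and int: "integrable exp_dist h"
    and lim: "(F \<longlongrightarrow> 0) at_top"
  shows "(LINT y|exp_dist. h y) = - F 0"
proof -
  have [measurable]: "h \<in> borel_measurable borel" using cont by (rule borel_measurable_continuous_onI)
  let ?f = "\<lambda>y. exponential_density 1 y * h y"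
  have l1: "((\<lambda>b. LINT y|lborel. indicator {..b} y *\<^sub>R ?f y) \<longlongrightarrow> (LINT y|lborel. ?f y)) at_top"
    by (rule tendsto_integral_at_top) (use int in \<open>auto simp: integral_exp_dist\<close>)
  have l2: "eventually (\<lambda>b. (LINT y|lborel. indicator {..b} y *\<^sub>R ?f y) = F b - F 0) at_top"
    using eventually_ge_at_top[of 0]
  proof eventually_elim
    case (elim b)
    have "(LINT y|lborel. indicator {..b} y *\<^sub>R ?f y) = (LINT y|lborel. (h y * exp (- y)) * indicator {0..b} y)"
      by (intro Bochner_Integration.integral_cong) (auto simp: exponential_density_def split: split_indicator)
    also have "\<dots> = F b - F 0"
      using elim cont by (intro integral_FTC_Icc_real deriv) (auto intro!: continuous_intros simp: continuous_on_eq_continuous_at)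
    finally show ?case .
  qed
  have "((\<lambda>b. F b - F 0) \<longlongrightarrow> 0 - F 0) at_top" by (intro tendsto_intros lim)
  then have "((\<lambda>b. LINT y|lborel. indicator {..b} y *\<^sub>R ?f y) \<longlongrightarrow> 0 - F 0) at_top"
    using tendsto_cong[OF l2] by blast
  with l1 have "(LINT y|lborel. ?f y) = 0 - F 0"
    using tendsto_unique trivial_limit_at_top_linorder by blast
  then show ?thesis by (simp add: integral_exp_dist)
qed

lemma exp_dist_decay:
  assumes "\<And>y. \<bar>G y\<bar> \<le> C"
  shows "((\<lambda>y. G y * exp (- y)) \<longlongrightarrow> (0::real)) at_top"
proof (rule Lim_null_comparison)
  have "((\<lambda>y::real. exp (- y)) \<longlongrightarrow> 0) at_top"
    by (intro filterlim_compose[OF exp_at_bot] filterlim_uminus_at_bot_at_top)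
  then have "((\<lambda>y::real. C * exp (- y)) \<longlongrightarrow> C * 0) at_top" by (intro tendsto_intros)
  then show "((\<lambda>y::real. C * exp (- y)) \<longlongrightarrow> 0) at_top" by simp
  show "eventually (\<lambda>y. norm (G y * exp (- y)) \<le> C * exp (- y)) at_top"
    using assms by (auto simp: abs_mult intro!: always_eventually mult_right_mono)
qed

lemma abs_cos_sin_le: "\<bar>cos y + sin y\<bar> \<le> (2::real)" "\<bar>cos y - sin y\<bar> \<le> (2::real)"
  using abs_cos_le_one[of y] abs_sin_le_one[of y] by linarith+

lemma exp_dist_integrable_bounded:
  assumes "h \<in> borel_measurable borel" "\<And>y. \<bar>h y\<bar> \<le> (C::real)"
  shows "integrable exp_dist h"
proof -
  interpret prob_space exp_dist by (rule prob_space_exp_dist)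
  show ?thesis by (rule integrable_const_bound[where B=C]) (use assms in auto)
qed

text \<open>Four integrations by parts reproduce the integral with the factor \<open>- \<mu> ^ 4 / 4\<close>. The function \<open>F\<close> in the proof
  is the antiderivative that they produce.\<close>

lemma integral_exp_dist_cos:
  "(LINT y|exp_dist. cos (\<mu> * y) * (cos y + sin y)) = 1 / (1 + \<mu> ^ 4 / 4)"
proof -
  define F where "F y = (- cos (\<mu>*y) * cos y + \<mu> * sin (\<mu>*y) * (cos y - sin y) / 2
      - \<mu>\<^sup>2 * cos (\<mu>*y) * sin y / 2 + \<mu>^3 * sin (\<mu>*y) * (cos y + sin y) / 4) * exp (- y)" for y
  have "(LINT y|exp_dist. (1 + \<mu>^4/4) * (cos (\<mu>*y) * (cos y + sin y))) = - F 0"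
  proof (rule exp_dist_FTC)
    show "(F has_real_derivative ((1 + \<mu>^4/4) * (cos (\<mu>*y) * (cos y + sin y))) * exp (- y)) (at y)" for y
      unfolding F_def
      by (auto intro!: derivative_eq_intros simp: field_simps power2_eq_square power3_eq_cube power4_eq_xxxx)
    have "\<bar>cos (\<mu>*y) * (cos y + sin y)\<bar> \<le> 1 * 2" for y
      unfolding abs_mult by (intro mult_mono abs_cos_sin_le) auto
    then show "integrable exp_dist (\<lambda>y. (1 + \<mu>^4/4) * (cos (\<mu>*y) * (cos y + sin y)))"
      by (intro integrable_mult_right exp_dist_integrable_bounded) auto
    have b: "\<bar>a * b / d\<bar> \<le> \<bar>A * 2 / d\<bar>" if "\<bar>a\<bar> \<le> \<bar>A\<bar>" "\<bar>b\<bar> \<le> 2" for a b d A :: real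
      using that by (auto simp: abs_mult abs_divide intro!: divide_right_mono mult_mono)
    show "(F \<longlongrightarrow> 0) at_top" unfolding F_def
    proof (rule exp_dist_decay)
      fix y
      have "\<bar>- cos (\<mu>*y) * cos y\<bar> \<le> 1"
        by (simp add: abs_mult mult_le_one)
      moreover have "\<bar>\<mu> * sin (\<mu>*y) * (cos y - sin y) / 2\<bar> \<le> \<bar>\<mu> * 2 / 2\<bar>"
        by (intro b abs_cos_sin_le) (simp add: abs_mult mult_left_le)
      moreover have "\<bar>\<mu>\<^sup>2 * cos (\<mu>*y) * sin y / 2\<bar> \<le> \<bar>\<mu>\<^sup>2 * 2 / 2\<bar>"
        by (intro b order_trans[OF abs_sin_le_one]) (auto simp: abs_mult mult_left_le)
      moreover have "\<bar>\<mu>^3 * sin (\<mu>*y) * (cos y + sin y) / 4\<bar> \<le> \<bar>\<mu>^3 * 2 / 4\<bar>"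
        by (intro b abs_cos_sin_le) (simp add: abs_mult mult_left_le)
      ultimately show "\<bar>- cos (\<mu>*y) * cos y + \<mu> * sin (\<mu>*y) * (cos y - sin y) / 2
      - \<mu>\<^sup>2 * cos (\<mu>*y) * sin y / 2 + \<mu>^3 * sin (\<mu>*y) * (cos y + sin y) / 4\<bar> \<le> 1 + \<bar>\<mu> * 2 / 2\<bar> + \<bar>\<mu>\<^sup>2 * 2 / 2\<bar> + \<bar>\<mu>^3 * 2 / 4\<bar>"
        by linarith
    qed
  qed (auto intro!: continuous_intros)
  moreover have "F 0 = -1" by (simp add: F_def)
  moreover have "1 + \<mu>^4/4 > 0" by (simp add: add_pos_nonneg)
  ultimately show ?thesis by (simp add: divide_simps) (simp add: mult.commute)
qed

text \<open>The functions \<open>psi1\<close>, \<open>psi2\<close>, \<open>psi3\<close> are the first three derivatives of \<open>arsinh \<circ> cos\<close>.\<close>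

definition psi1 :: "real \<Rightarrow> real" where "psi1 x = - sin x / sqrt (1 + (cos x)\<^sup>2)"
definition psi2 :: "real \<Rightarrow> real" where "psi2 x = - 2 * cos x / sqrt (1 + (cos x)\<^sup>2) ^ 3"
definition psi3 :: "real \<Rightarrow> real" where "psi3 x = 2 * sin x * (1 - 2 * (cos x)\<^sup>2) / sqrt (1 + (cos x)\<^sup>2) ^ 5"

lemma one_plus_cos_squared_pos: "0 < 1 + (cos x)\<^sup>2" for x :: real
  by (simp add: add_pos_nonneg)

lemma DERIV_arsinh_cos: "((\<lambda>x. arsinh (cos x)) has_real_derivative psi1 x) (at x)"
  using DERIV_chain2[OF arsinh_real_has_field_derivative[of "cos x" UNIV] DERIV_cos[of x]]
  unfolding psi1_def by (simp add: add.commute)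

lemma DERIV_sqrt_cos: "((\<lambda>x. sqrt (1 + (cos x)\<^sup>2)) has_real_derivative - (cos x * sin x) / sqrt (1 + (cos x)\<^sup>2)) (at x)"
proof -
  have "1 + (cos x)\<^sup>2 > 0" by (simp add: add_pos_nonneg)
  then show ?thesis
    by (auto intro!: derivative_eq_intros simp: divide_simps)
qed

lemma DERIV_psi1: "(psi1 has_real_derivative psi2 x) (at x)"
proof -
  define r where "r = sqrt (1 + (cos x)\<^sup>2)"
  have r: "r > 0" "r * r = 1 + (cos x)\<^sup>2" using one_plus_cos_squared_pos[of x] by (auto simp: r_def)
  have "(psi1 has_real_derivative ((- cos x * r - (- sin x) * (- (cos x * sin x) / r)) / (r * r))) (at x)"
    unfolding psi1_def[abs_def]
    by (rule derivative_eq_intros DERIV_sqrt_cos refl | use r in \<open>simp add: r_def[symmetric]\<close>)+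
  also have "(- cos x * r - (- sin x) * (- (cos x * sin x) / r)) / (r * r) = - cos x * (r * r + (sin x)\<^sup>2) / r ^ 3"
    using r(1) by (simp add: field_simps power2_eq_square power3_eq_cube)
  also have "r * r + (sin x)\<^sup>2 = 2" unfolding r(2) using sin_cos_squared_add[of x] by linarith
  finally show ?thesis unfolding psi2_def r_def by (simp add: mult.commute)
qed

lemma DERIV_psi2: "(psi2 has_real_derivative psi3 x) (at x)"
proof -
  define r where "r = sqrt (1 + (cos x)\<^sup>2)"
  have r: "r > 0" "r * r = 1 + (cos x)\<^sup>2" using one_plus_cos_squared_pos[of x] by (auto simp: r_def)
  have "(psi2 has_real_derivative ((2 * sin x * r ^ 3 - (- 2 * cos x) * (3 * r\<^sup>2 * (- (cos x * sin x) / r))) / (r ^ 3 * r ^ 3))) (at x)"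
    unfolding psi2_def[abs_def]
    by (rule derivative_eq_intros DERIV_sqrt_cos refl | use r in \<open>simp add: r_def[symmetric]\<close>)+
  also have "(2 * sin x * r ^ 3 - (- 2 * cos x) * (3 * r\<^sup>2 * (- (cos x * sin x) / r))) / (r ^ 3 * r ^ 3) = 2 * sin x * (r * r - 3 * (cos x)\<^sup>2) / r ^ 5"
    using r(1) by (simp add: field_simps power2_eq_square power3_eq_cube eval_nat_numeral)
  also have "r * r - 3 * (cos x)\<^sup>2 = 1 - 2 * (cos x)\<^sup>2" unfolding r(2) by simp
  finally show ?thesis unfolding psi3_def r_def .
qed

lemma psi1_bound: "\<bar>psi1 x\<bar> \<le> 1" and psi2_bound: "\<bar>psi2 x\<bar> \<le> 2" and psi3_bound: "\<bar>psi3 x\<bar> \<le> 2 * \<bar>x\<bar>"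
proof -
  define r where "r = sqrt (1 + (cos x)\<^sup>2)"
  have r: "1 \<le> r" by (simp add: r_def)
  have rn: "1 \<le> r ^ n" for n using r by (rule one_le_power)
  have q: "\<bar>a / r ^ n\<bar> \<le> \<bar>a\<bar>" for a n
    using rn[of n] mult_left_mono[of 1 "r ^ n" "\<bar>a\<bar>"] by (simp add: abs_divide divide_le_eq)
  show "\<bar>psi1 x\<bar> \<le> 1" unfolding psi1_def r_def[symmetric] using q[of "- sin x" 1] abs_sin_le_one[of x] by (simp del: abs_sin_le_one)
  show "\<bar>psi2 x\<bar> \<le> 2" unfolding psi2_def r_def[symmetric] using q[of "- 2 * cos x" 3] abs_cos_le_one[of x]
    by (simp add: abs_mult del: abs_cos_le_one)
  have "(cos x)\<^sup>2 \<le> 1" by (simp add: abs_square_le_1)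
  then have "\<bar>1 - 2 * (cos x)\<^sup>2\<bar> \<le> 1" using zero_le_power2[of "cos x"] by linarith
  then have "\<bar>2 * sin x * (1 - 2 * (cos x)\<^sup>2)\<bar> \<le> (2 * \<bar>x\<bar>) * 1"
    unfolding abs_mult by (intro mult_mono) (auto intro: abs_sin_x_le_abs_x)
  then show "\<bar>psi3 x\<bar> \<le> 2 * \<bar>x\<bar>" unfolding psi3_def r_def[symmetric] using q[of "2 * sin x * (1 - 2 * (cos x)\<^sup>2)" 5]
    by linarith
qed

lemma arsinh_cos_bound: "\<bar>arsinh (cos x)\<bar> \<le> arsinh (1::real)"
proof -
  have "arsinh (cos x) \<le> arsinh 1" by (meson arsinh_less_iff_real cos_le_one not_less)
  moreover have "arsinh (-1) \<le> arsinh (cos x)" by (meson arsinh_less_iff_real cos_ge_minus_one not_less)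
  ultimately show ?thesis by (simp add: abs_le_iff)
qed

lemma continuous_psi: "continuous_on A psi1" "continuous_on A psi2" "continuous_on A psi3"
  unfolding psi1_def[abs_def] psi2_def[abs_def] psi3_def[abs_def]
  using one_plus_cos_squared_pos
  by (auto intro!: continuous_intros simp: less_imp_neq[symmetric])

lemma continuous_psi3_scaled: "continuous_on UNIV (\<lambda>y. psi3 (\<sigma> * y))"
  by (rule continuous_on_compose2[OF continuous_psi(3)[of UNIV]]) (auto intro!: continuous_intros)

text \<open>The fourth derivative of \<open>arsinh \<circ> cos\<close> at 0 is \<open>- 1 / (2 * sqrt 2)\<close>. Its negative sign is the source of the
  improvement.\<close>

lemma psi3_limit:
  "((\<lambda>\<sigma>. psi3 (\<sigma> * y) / \<sigma>) \<longlongrightarrow> - y / (2 * sqrt 2)) (at 0)"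
proof -
  have "((\<lambda>s. sin (s * y)) has_real_derivative y) (at 0)"
    by (auto intro!: derivative_eq_intros)
  then have 1: "((\<lambda>s. sin (s * y) / s) \<longlongrightarrow> y) (at 0)"
    by (simp add: DERIV_def)
  have "((\<lambda>s. 2 * (sin (s * y) / s) * ((1 - 2 * (cos (s*y))\<^sup>2) / sqrt (1 + (cos (s*y))\<^sup>2) ^ 5)) \<longlongrightarrow>
      2 * y * ((1 - 2 * (cos (0*y))\<^sup>2) / sqrt (1 + (cos (0*y))\<^sup>2) ^ 5)) (at 0)"
    by (intro tendsto_intros 1) auto
  moreover have "2 * y * ((1 - 2 * (cos (0*y))\<^sup>2) / sqrt (1 + (cos (0*y))\<^sup>2) ^ 5) = - y / (2 * sqrt 2)"
  proof -
    have "sqrt 2 ^ 5 = (sqrt 2)\<^sup>2 * (sqrt 2)\<^sup>2 * sqrt 2" unfolding power_add[symmetric] power_Suc2[symmetric] by simp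
    then show ?thesis by simp
  qed
  moreover have "psi3 (s * y) / s = 2 * (sin (s * y) / s) * ((1 - 2 * (cos (s*y))\<^sup>2) / sqrt (1 + (cos (s*y))\<^sup>2) ^ 5)" for s
    unfolding psi3_def by simp
  ultimately show ?thesis by simp
qed

lemma integral_exp_dist_id_sin: "(LINT y|exp_dist. y * sin y) = 1 / 2"
proof -
  let ?F = "\<lambda>y::real. - (cos y / 2 + y * (cos y + sin y) / 2) * exp (- y)"
  have "(LINT y|exp_dist. y * sin y) = - ?F 0"
  proof (rule exp_dist_FTC)
    show "(?F has_real_derivative (y * sin y) * exp (- y)) (at y)" for y
      by (auto intro!: derivative_eq_intros simp: field_simps)
    show "integrable exp_dist (\<lambda>y. y * sin y)"
      by (rule Bochner_Integration.integrable_bound[OF integrable_exp_dist_id]) (auto simp: abs_mult mult_left_le)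
    have "((\<lambda>y::real. y * exp (- y)) \<longlongrightarrow> 0) at_top"
      using tendsto_power_div_exp_0[of 1] by (simp add: exp_minus divide_inverse)
    moreover have "((\<lambda>y::real. 1 * exp (- y)) \<longlongrightarrow> 0) at_top"
      by (rule exp_dist_decay[where C=1]) simp
    ultimately have "((\<lambda>y::real. 1 * exp (- y) + y * exp (- y)) \<longlongrightarrow> 0 + 0) at_top"
      by (intro tendsto_add)
    then have lim: "((\<lambda>y::real. (1 + y) * exp (- y)) \<longlongrightarrow> 0) at_top"
      by (simp add: algebra_simps)
    show "(?F \<longlongrightarrow> 0) at_top"
    proof (rule Lim_null_comparison[OF _ lim])
      have "\<bar>cos y / 2 + y * (cos y + sin y) / 2\<bar> \<le> 1 + y" if "0 \<le> y" for y :: real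
      proof -
        have "\<bar>y * (cos y + sin y)\<bar> \<le> y * 2"
          using that abs_cos_sin_le[of y] by (simp add: abs_mult mult_left_mono)
        then show ?thesis using abs_cos_le_one[of y] by linarith
      qed
      then have "norm (?F y) \<le> (1 + y) * exp (- y)" if "0 \<le> y" for y
        unfolding real_norm_def abs_mult abs_minus_cancel abs_exp_cancel using that by (intro mult_right_mono) auto
      then show "eventually (\<lambda>y. norm (?F y) \<le> (1 + y) * exp (- y)) at_top"
        using eventually_ge_at_top[of 0] by (rule eventually_mono[rotated])
    qed
  qed (auto intro!: continuous_intros)
  then show ?thesis by simp
qed

text \<open>Three integrations by parts. The boundary terms of first and second order in \<open>\<sigma>\<close> vanish at \<open>y = 0\<close>, because
  \<open>psi1 0 = 0\<close> and \<open>sin 0 = 0\<close>.\<close>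

lemma integral_arsinh_cos:
  "(LINT y|exp_dist. arsinh (cos (\<sigma> * y)) * (cos y + sin y)) =
    arsinh 1 - \<sigma>^3 / 2 * (LINT y|exp_dist. psi3 (\<sigma> * y) * sin y)"
proof -
  define F where "F y = (- arsinh (cos (\<sigma>*y)) * cos y - \<sigma> / 2 * psi1 (\<sigma>*y) * (cos y - sin y)
      + \<sigma>\<^sup>2 / 2 * psi2 (\<sigma>*y) * sin y) * exp (- y)" for y
  have c0: "continuous_on UNIV (\<lambda>y. arsinh (cos (\<sigma> * y)))" by (intro continuous_intros)
  have "\<bar>arsinh (cos (\<sigma> * y)) * (cos y + sin y)\<bar> \<le> arsinh 1 * 2" for y
    unfolding abs_mult
    by (intro mult_mono arsinh_cos_bound abs_cos_sin_le) (auto simp: less_imp_le)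
  then have i1: "integrable exp_dist (\<lambda>y. arsinh (cos (\<sigma> * y)) * (cos y + sin y))"
    by (intro exp_dist_integrable_bounded borel_measurable_continuous_onI continuous_intros)
  have i2: "integrable exp_dist (\<lambda>y. psi3 (\<sigma> * y) * sin y)"
  proof (rule Bochner_Integration.integrable_bound)
    show "integrable exp_dist (\<lambda>y. 2 * \<bar>\<sigma>\<bar> * \<bar>y\<bar>)" using integrable_exp_dist_id by (intro integrable_mult_right integrable_abs)
    have "norm (psi3 (\<sigma> * y) * sin y) \<le> norm (2 * \<bar>\<sigma>\<bar> * \<bar>y\<bar>)" for y
    proof -
      have "\<bar>psi3 (\<sigma> * y)\<bar> * \<bar>sin y\<bar> \<le> (2 * \<bar>\<sigma> * y\<bar>) * 1"
        by (intro mult_mono psi3_bound) auto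
      then show ?thesis by (simp add: abs_mult)
    qed
    then show "AE y in exp_dist. norm (psi3 (\<sigma> * y) * sin y) \<le> norm (2 * \<bar>\<sigma>\<bar> * \<bar>y\<bar>)"
      by (intro always_eventually allI)
    have "psi3 \<in> borel_measurable borel" by (rule borel_measurable_continuous_onI) (rule continuous_psi)
    then show "(\<lambda>y. psi3 (\<sigma> * y) * sin y) \<in> borel_measurable exp_dist" by simp
  qed
  have "(LINT y|exp_dist. arsinh (cos (\<sigma> * y)) * (cos y + sin y) + \<sigma>^3 / 2 * (psi3 (\<sigma> * y) * sin y)) = - F 0"
  proof (rule exp_dist_FTC)
    fix y
    have d: "((\<lambda>y. g (\<sigma> * y)) has_real_derivative g' * \<sigma>) (at y)" if "(g has_real_derivative g') (at (\<sigma>*y))" for g g'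
      using DERIV_chain2[of g g' "\<lambda>y. \<sigma> * y" y \<sigma> UNIV] that by (auto intro!: derivative_eq_intros)
    note ds = d[OF DERIV_arsinh_cos] d[OF DERIV_psi1] d[OF DERIV_psi2]
    show "(F has_real_derivative (arsinh (cos (\<sigma> * y)) * (cos y + sin y) + \<sigma>^3 / 2 * (psi3 (\<sigma> * y) * sin y)) * exp (- y)) (at y)"
      unfolding F_def
      by (rule derivative_eq_intros ds refl | simp)+ (simp add: field_simps power2_eq_square power3_eq_cube)
  next
    show "continuous_on UNIV (\<lambda>y. arsinh (cos (\<sigma> * y)) * (cos y + sin y) + \<sigma>^3 / 2 * (psi3 (\<sigma> * y) * sin y))"
      by (intro continuous_intros continuous_psi3_scaled)
    show "integrable exp_dist (\<lambda>y. arsinh (cos (\<sigma> * y)) * (cos y + sin y) + \<sigma>^3 / 2 * (psi3 (\<sigma> * y) * sin y))"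
      by (intro Bochner_Integration.integrable_add i1 integrable_mult_right i2)
    show "(F \<longlongrightarrow> 0) at_top" unfolding F_def
    proof (rule exp_dist_decay)
      fix y
      have "\<bar>- arsinh (cos (\<sigma>*y)) * cos y\<bar> \<le> arsinh 1 * 1"
        unfolding abs_mult abs_minus_cancel by (intro mult_mono arsinh_cos_bound) (auto simp: less_imp_le)
      moreover have "\<bar>\<sigma> / 2 * psi1 (\<sigma>*y) * (cos y - sin y)\<bar> \<le> \<bar>\<sigma> / 2\<bar> * 1 * 2"
        unfolding abs_mult by (intro mult_mono psi1_bound abs_cos_sin_le) auto
      moreover have "\<bar>\<sigma>\<^sup>2 / 2 * psi2 (\<sigma>*y) * sin y\<bar> \<le> \<bar>\<sigma>\<^sup>2 / 2\<bar> * 2 * 1"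
        unfolding abs_mult by (intro mult_mono psi2_bound) auto
      ultimately show "\<bar>- arsinh (cos (\<sigma>*y)) * cos y - \<sigma> / 2 * psi1 (\<sigma>*y) * (cos y - sin y)
        + \<sigma>\<^sup>2 / 2 * psi2 (\<sigma>*y) * sin y\<bar> \<le> arsinh 1 * 1 + \<bar>\<sigma> / 2\<bar> * 1 * 2 + \<bar>\<sigma>\<^sup>2 / 2\<bar> * 2 * 1"
        by linarith
    qed
  qed
  also have "- F 0 = arsinh 1" by (simp add: F_def psi1_def)
  finally show ?thesis using i1 i2 by simp
qed

text \<open>By dominated convergence the integral of \<open>psi3 (\<sigma> * y) / \<sigma> * sin y\<close> tends to
  \<open>- 1 / (4 * sqrt 2) < 0\<close> as \<open>\<sigma>\<close> tends to 0.\<close>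

lemma arsinh_cos_gain:
  "\<exists>\<sigma>>0. (LINT y|exp_dist. arsinh (cos (\<sigma> * y)) * (cos y + sin y)) > arsinh 1"
proof -
  define s where "s n = 1 / real (Suc n)" for n
  have s: "s n > 0" for n by (simp add: s_def)
  have s0: "s \<longlonglongrightarrow> 0" unfolding s_def using LIMSEQ_inverse_real_of_nat by (simp add: divide_inverse)
  have m[measurable]: "psi3 \<in> borel_measurable borel" by (rule borel_measurable_continuous_onI) (rule continuous_psi)
  have "(\<lambda>n. LINT y|exp_dist. psi3 (s n * y) / s n * sin y) \<longlonglongrightarrow> (LINT y|exp_dist. - y / (2 * sqrt 2) * sin y)"
  proof (rule integral_dominated_convergence)
    show "integrable exp_dist (\<lambda>y. 2 * \<bar>y\<bar>)" using integrable_exp_dist_id by (intro integrable_mult_right integrable_abs)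
    have "filterlim s (at 0) sequentially" using s0 s by (auto simp: filterlim_at intro!: always_eventually less_imp_neq[symmetric])
    then have "(\<lambda>n. psi3 (s n * y) / s n) \<longlonglongrightarrow> - y / (2 * sqrt 2)" for y
      by (rule filterlim_compose[OF psi3_limit])
    then show "AE y in exp_dist. (\<lambda>n. psi3 (s n * y) / s n * sin y) \<longlonglongrightarrow> - y / (2 * sqrt 2) * sin y"
      by (intro always_eventually allI tendsto_mult tendsto_const)
    have "norm (psi3 (s n * y) / s n * sin y) \<le> 2 * \<bar>y\<bar>" for n y
    proof -
      have "\<bar>psi3 (s n * y)\<bar> / s n * \<bar>sin y\<bar> \<le> (2 * \<bar>s n * y\<bar>) / s n * 1"
        using s[of n] by (intro mult_mono divide_right_mono psi3_bound) (auto simp: less_imp_le)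
      then show ?thesis using s[of n] by (simp add: abs_mult)
    qed
    then show "AE y in exp_dist. norm (psi3 (s n * y) / s n * sin y) \<le> 2 * \<bar>y\<bar>" for n
      by (intro always_eventually allI)
  qed auto
  also have "(LINT y|exp_dist. - y / (2 * sqrt 2) * sin y) = - (1 / (2 * sqrt 2)) * (LINT y|exp_dist. y * sin y)"
    unfolding integral_mult_right_zero[symmetric] by (intro Bochner_Integration.integral_cong) auto
  finally have "(\<lambda>n. LINT y|exp_dist. psi3 (s n * y) / s n * sin y) \<longlonglongrightarrow> - (1 / (4 * sqrt 2))"
    by (simp add: integral_exp_dist_id_sin)
  then have "eventually (\<lambda>n. (LINT y|exp_dist. psi3 (s n * y) / s n * sin y) < 0) sequentially"
    by (rule order_tendstoD) simp
  then obtain n where n: "(LINT y|exp_dist. psi3 (s n * y) / s n * sin y) < 0"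
    by (auto simp: eventually_sequentially)
  have "(LINT y|exp_dist. psi3 (s n * y) / s n * sin y) = (LINT y|exp_dist. psi3 (s n * y) * sin y) / s n"
    unfolding integral_divide_zero[symmetric] by (intro Bochner_Integration.integral_cong) auto
  with n s[of n] have "(LINT y|exp_dist. psi3 (s n * y) * sin y) < 0"
    by (simp add: divide_less_0_iff)
  then have "s n ^ 3 / 2 * (LINT y|exp_dist. psi3 (s n * y) * sin y) < 0"
    using s[of n] by (intro mult_pos_neg) auto
  then show ?thesis using s[of n] integral_arsinh_cos[of "s n"] by (intro exI[of _ "s n"]) auto
qed

section \<open>Gaussian integrals\<close>

definition gauss :: "'k set \<Rightarrow> ('k \<Rightarrow> real) measure" where
  "gauss I = PiM I (\<lambda>_. std_normal_distribution)"

lemma prob_space_std_normal: "prob_space std_normal_distribution"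
  by (rule prob_space_normal_density) simp

lemma prob_space_gauss: "prob_space (gauss I)"
  unfolding gauss_def by (intro prob_space_PiM prob_space_std_normal)

lemma measurable_gauss_component[measurable]:
  "k \<in> I \<Longrightarrow> (\<lambda>g. g k) \<in> borel_measurable (gauss I)"
proof -
  assume "k \<in> I"
  then have "(\<lambda>g. g k) \<in> measurable (gauss I) std_normal_distribution"
    unfolding gauss_def by simp
  then show ?thesis
    by (simp cong: measurable_cong_sets)
qed

lemma product_sigma_finite_std_normal: "product_sigma_finite (\<lambda>_. std_normal_distribution)"
  by (intro product_sigma_finite.intro prob_space_imp_sigma_finite prob_space_std_normal)

lemma integral_cos_std_normal:
  "(LINT x|std_normal_distribution. cos (s * x)) = exp (- s\<^sup>2 / 2)"
proof -
  interpret prob_space std_normal_distribution by (rule prob_space_std_normal)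
  have "char std_normal_distribution s = exp (- (s^2) / 2)"
    by (simp add: char_std_normal_distribution)
  then have "Re (CLINT x|std_normal_distribution. iexp (s * x)) = exp (- (s^2) / 2)"
    unfolding char_def by (simp)
  moreover have "integrable std_normal_distribution (\<lambda>x. iexp (s * x))"
    by (rule integrable_const_bound[where B=1]) auto
  ultimately show ?thesis
    by (subst (asm) integral_Re[symmetric]) (auto simp: Re_exp)
qed

text \<open>Independence of the coordinates.\<close>

lemma gauss_prod:
  fixes f :: "'k \<Rightarrow> real \<Rightarrow> 'b::{real_normed_field,banach,second_countable_topology}"
  assumes "finite I" "\<And>k. k \<in> I \<Longrightarrow> integrable std_normal_distribution (f k)"
  shows "(LINT g|gauss I. (\<Prod>k\<in>I. f k (g k))) = (\<Prod>k\<in>I. LINT x|std_normal_distribution. f k x)"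
    and "integrable (gauss I) (\<lambda>g. \<Prod>k\<in>I. f k (g k))"
  using product_sigma_finite.product_integral_prod[OF product_sigma_finite_std_normal assms]
    product_sigma_finite.product_integrable_prod[OF product_sigma_finite_std_normal assms]
  unfolding gauss_def by auto

text \<open>The characteristic function of a standard Gaussian vector. All later Gaussian expectations are reduced to this
  formula by Fubini's theorem; it stands in for the joint law of two projections.\<close>

lemma integral_gauss_cos:
  assumes "finite I"
  shows "(LINT g|gauss I. cos (\<Sum>k\<in>I. w k * g k)) = exp (- (\<Sum>k\<in>I. (w k)\<^sup>2) / 2)"
proof -
  interpret P: prob_space "gauss I" by (rule prob_space_gauss)
  interpret N: prob_space std_normal_distribution by (rule prob_space_std_normal)
  have int: "integrable std_normal_distribution (\<lambda>x. iexp (w k * x))" for k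
    by (rule N.integrable_const_bound[where B=1]) auto
  have 1: "(LINT x|std_normal_distribution. iexp (w k * x)) = exp (- (w k)\<^sup>2 / 2)" for k
    using char_std_normal_distribution unfolding char_def by (auto dest!: fun_cong[where x="w k"])
  have 2: "(\<Prod>k\<in>I. iexp (w k * g k)) = iexp (\<Sum>k\<in>I. w k * g k)" for g
    using assms by (simp add: exp_sum[symmetric] sum_distrib_left)
  have "(LINT g|gauss I. iexp (\<Sum>k\<in>I. w k * g k)) = of_real (\<Prod>k\<in>I. exp (- (w k)\<^sup>2 / 2))"
    using gauss_prod(1)[OF assms, of "\<lambda>k x. iexp (w k * x)"] int
    unfolding 2 1 by simp
  also have "(\<Prod>k\<in>I. exp (- (w k)\<^sup>2 / 2)) = exp (- (\<Sum>k\<in>I. (w k)\<^sup>2) / 2)"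
    using assms by (simp add: exp_sum[symmetric] sum_negf sum_divide_distrib)
  finally have "Re (LINT g|gauss I. iexp (\<Sum>k\<in>I. w k * g k)) = exp (- (\<Sum>k\<in>I. (w k)\<^sup>2) / 2)"
    by simp
  moreover have "integrable (gauss I) (\<lambda>g. iexp (\<Sum>k\<in>I. w k * g k))"
    using gauss_prod(2)[OF assms, of "\<lambda>k x. iexp (w k * x)"] int unfolding 2 by simp
  ultimately show ?thesis
    by (subst (asm) integral_Re[symmetric]) (auto simp: Re_exp)
qed

text \<open>The factor \<open>exp (- \<kappa> * x\<^sup>2 / 2)\<close> turns the standard normal density into a multiple of the one with variance
  \<open>1 / (1 + \<kappa>)\<close>.\<close>

lemma std_normal_gauss_moment:
  assumes "0 \<le> \<kappa>"
  shows "has_bochner_integral std_normal_distribution (\<lambda>x. x ^ (2*k) * exp (- \<kappa> * x\<^sup>2 / 2))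
    (fact (2*k) / (2 ^ k * fact k) / sqrt (1 + \<kappa>) ^ (2*k+1))"
proof -
  define \<sigma> where "\<sigma> = 1 / sqrt (1 + \<kappa>)"
  have s: "\<sigma> > 0" "\<sigma>\<^sup>2 = 1 / (1+\<kappa>)" using assms by (auto simp: \<sigma>_def power_divide)
  have 1: "std_normal_density x * (x ^ (2*k) * exp (- \<kappa> * x\<^sup>2 / 2)) = \<sigma> * (normal_density 0 \<sigma> x * (x - 0) ^ (2*k))" for x
  proof -
    have "- \<kappa> * x\<^sup>2 / 2 - x\<^sup>2 / 2 = - x\<^sup>2 / (2 * \<sigma>\<^sup>2)"
      unfolding s(2) using assms by (simp add: algebra_simps add_divide_distrib)
    then have "exp (-x\<^sup>2/2) * exp (- \<kappa> * x\<^sup>2 / 2) = exp (- x\<^sup>2 / (2 * \<sigma>\<^sup>2))"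
      unfolding exp_add[symmetric] by (simp add: algebra_simps)
    moreover have "sqrt (2 * pi * \<sigma>\<^sup>2) = sqrt (2*pi) * \<sigma>"
      using s(1) by (simp add: real_sqrt_mult)
    ultimately show ?thesis using s(1)
      unfolding normal_density_def by (simp add: field_simps)
  qed
  have "has_bochner_integral lborel (\<lambda>x. \<sigma> * (normal_density 0 \<sigma> x * (x - 0) ^ (2*k)))
     (\<sigma> * (fact (2*k) / ((2 / \<sigma>\<^sup>2)^k * fact k)))"
    by (intro has_bochner_integral_mult_right normal_moment_even s) 
  also have "\<sigma> * (fact (2*k) / ((2 / \<sigma>\<^sup>2)^k * fact k)) = (fact (2*k) / (2 ^ k * fact k) / sqrt (1 + \<kappa>) ^ (2*k+1))"
  proof -
    have "(2 / \<sigma>\<^sup>2) ^ k = 2 ^ k * (1 + \<kappa>) ^ k"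
      unfolding s(2) using assms by (simp add: power_mult_distrib[symmetric])
    moreover have "sqrt (1 + \<kappa>) ^ (2*k+1) = (1 + \<kappa>) ^ k * sqrt (1 + \<kappa>)"
      using assms by (simp add: power_mult)
    ultimately show ?thesis unfolding \<sigma>_def by auto
  qed
  finally show ?thesis
    unfolding 1[symmetric]
    by (intro has_bochner_integral_density) (auto simp: normal_density_nonneg)
qed

lemma AE_std_normal_nonzero: "AE z in std_normal_distribution. z \<noteq> 0"
proof -
  have "AE z in lborel. (z::real) \<noteq> 0" by (rule AE_lborel_singleton)
  then have "AE z in lborel. ennreal (std_normal_density z) > 0 \<longrightarrow> z \<noteq> 0"
    by eventually_elim auto
  then show ?thesis
    by (subst AE_density) auto
qed

lemma integral_half_gaussian:
  "has_bochner_integral lborel (\<lambda>s::real. indicator {0..} s * exp (- s\<^sup>2 / 2)) (sqrt (pi / 2))"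
proof -
  have "has_bochner_integral lborel (\<lambda>x. indicator {0..} (0 + 1 / sqrt 2 * x) *\<^sub>R exp (- (0 + 1 / sqrt 2 * x)\<^sup>2))
     ((sqrt pi / 2) /\<^sub>R \<bar>1 / sqrt 2\<bar>)"
    by (rule lborel_has_bochner_integral_real_affine_iff[THEN iffD1, OF _ gaussian_moment_0]) simp
  also have "(\<lambda>x. indicator {0..} (0 + 1 / sqrt 2 * x) *\<^sub>R exp (- (0 + 1 / sqrt 2 * x)\<^sup>2)) =
    (\<lambda>s::real. indicator {0..} s * exp (- s\<^sup>2 / 2))"
    by (auto simp: fun_eq_iff power_divide zero_le_divide_iff split: split_indicator)
  also have "(sqrt pi / 2) /\<^sub>R \<bar>1 / sqrt 2\<bar> = sqrt (pi / 2)"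
    by (simp add: real_sqrt_divide field_simps)
  finally show ?thesis .
qed

text \<open>This is the error function \<open>erf (x / sqrt 2)\<close>, written as a Fourier integral. The functions
  \<open>x \<mapsto> smooth_sign (\<tau> * x)\<close> tend to the sign function as \<open>\<tau>\<close> grows, and they are used in place of it because the sign
  function has no absolutely convergent Fourier integral.\<close>

definition smooth_sign :: "real \<Rightarrow> real" where
  "smooth_sign x = sqrt (2 / pi) * (LINT z|std_normal_distribution. sin (z * x) / z)"

text \<open>Both sides are the integral of \<open>cos (z * s)\<close> over \<open>s \<in> [0, x]\<close> and the Gaussian variable \<open>z\<close>. The point
  \<open>z = 0\<close>, where the quotient is 0 by convention, is a null set.\<close>

lemma integral_sinc_std_normal:
  assumes "0 \<le> x"
  shows "(LINT z|std_normal_distribution. sin (z * x) / z) =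
    (LINT s|lborel. indicator {0..x} s * exp (- s\<^sup>2 / 2))"
proof -
  interpret N: prob_space std_normal_distribution by (rule prob_space_std_normal)
  interpret pair_sigma_finite std_normal_distribution "lborel :: real measure" ..
  have meas: "(\<lambda>(z, s). indicator {0..x} s * cos (z * s)) \<in> borel_measurable (std_normal_distribution \<Otimes>\<^sub>M lborel)"
    by simp
  have int: "integrable (std_normal_distribution \<Otimes>\<^sub>M lborel) (\<lambda>(z, s). indicator {0..x} s * cos (z * s))"
  proof (rule Bochner_Integration.integrable_bound)
    show "integrable (std_normal_distribution \<Otimes>\<^sub>M lborel) (\<lambda>(z, s). indicator {0..x} s :: real)"
    proof -
      have "(\<lambda>(z::real, s). indicator {0..x} s :: real) = indicator (UNIV \<times> {0..x})"
        by (auto simp: fun_eq_iff split: split_indicator)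
      moreover have "emeasure (std_normal_distribution \<Otimes>\<^sub>M lborel) (UNIV \<times> {0..x}) < \<infinity>"
        using N.emeasure_space_1 assms by (subst lborel.emeasure_pair_measure_Times) auto
      ultimately show ?thesis by (simp add: integrable_indicator_iff)
    qed
    show "AE p in std_normal_distribution \<Otimes>\<^sub>M lborel.
      norm ((\<lambda>(z, s). indicator {0..x} s * cos (z * s)) p) \<le> norm ((\<lambda>(z, s). indicator {0..x} s :: real) p)"
      by (auto split: split_indicator)
  qed (use meas in simp)
  have 1: "(LINT s|lborel. indicator {0..x} s * cos (z * s)) = sin (z * x) / z" if "z \<noteq> 0" for z
  proof -
    have "(LINT s|lborel. cos (z * s) * indicator {0..x} s) = sin (z * x) / z - sin (z * 0) / z"
      using that assms by (intro integral_FTC_Icc_real) (auto intro!: derivative_eq_intros continuous_intros)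
    then show ?thesis by (simp add: mult.commute)
  qed
  have "(LINT z|std_normal_distribution. sin (z * x) / z) =
    (LINT z|std_normal_distribution. LINT s|lborel. indicator {0..x} s * cos (z * s))"
    using AE_std_normal_nonzero
    by (intro integral_cong_AE) (auto simp: 1)
  also have "\<dots> = (LINT s|lborel. LINT z|std_normal_distribution. indicator {0..x} s * cos (z * s))"
    using Fubini_integral[OF int] by simp
  also have "\<dots> = (LINT s|lborel. indicator {0..x} s * exp (- s\<^sup>2 / 2))"
    by (simp add: integral_cos_std_normal mult.commute[of _ "_::real"] del: integral_mult_right_zero)
  finally show ?thesis .
qed

lemma abs_smooth_sign_le_1: "\<bar>smooth_sign x\<bar> \<le> 1"
proof -
  have pos: "0 \<le> smooth_sign x \<and> smooth_sign x \<le> 1" if "0 \<le> x" for x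
  proof -
    have int: "integrable lborel (\<lambda>s::real. indicator {0..} s * exp (- s\<^sup>2 / 2))"
      using integral_half_gaussian by (simp add: has_bochner_integral_iff)
    have "(LINT s|lborel. indicator {0..x} s * exp (- s\<^sup>2 / 2)) \<le> (LINT s|lborel. indicator {0..} s * exp (- s\<^sup>2 / 2))"
      by (intro integral_mono Bochner_Integration.integrable_bound[OF int])
         (auto split: split_indicator)
    also have "\<dots> = sqrt (pi / 2)"
      using integral_half_gaussian by (rule has_bochner_integral_integral_eq)
    finally have "smooth_sign x \<le> sqrt (2 / pi) * sqrt (pi / 2)"
      unfolding smooth_sign_def integral_sinc_std_normal[OF that] by (intro mult_left_mono) auto
    also have "\<dots> = 1" by (simp add: real_sqrt_mult[symmetric])
    finally show ?thesis
      unfolding smooth_sign_def integral_sinc_std_normal[OF that]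
      by (auto intro!: mult_nonneg_nonneg Bochner_Integration.integral_nonneg split: split_indicator)
  qed
  have "smooth_sign (-x) = - smooth_sign x" for x unfolding smooth_sign_def by simp
  then show ?thesis using pos[of x] pos[of "-x"] by (cases "0 \<le> x") auto
qed

section \<open>Grothendieck's arcsine identity\<close>

text \<open>The coefficient of \<open>x ^ (2 * k + 1)\<close> in the Taylor series of \<open>arcsin x\<close>.\<close>

definition arcsin_coeff :: "nat \<Rightarrow> real" where
  "arcsin_coeff k = fact (2*k) / (4 ^ k * (fact k)\<^sup>2 * (2 * real k + 1))"

lemma arcsin_coeff_pos: "arcsin_coeff k > 0"
  unfolding arcsin_coeff_def by simp

lemma arcsin_coeff_le_1: "arcsin_coeff k \<le> 1"
proof -
  have "fact (2*k) / (fact k * fact k) = real ((2*k) choose k)"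
    using binomial_fact[of k "2*k", where 'a=real] by simp
  also have "\<dots> \<le> 2 ^ (2*k)"
    using binomial_le_pow2[of "2*k" k] of_nat_mono by fastforce
  finally have "fact (2*k) / (fact k)\<^sup>2 \<le> (4::real) ^ k"
    by (simp add: power_mult power2_eq_square)
  then have "fact (2*k) \<le> (4::real) ^ k * (fact k)\<^sup>2"
    by (simp add: divide_le_eq)
  also have "\<dots> \<le> 4 ^ k * (fact k)\<^sup>2 * (2 * real k + 1)"
    by simp
  finally show ?thesis unfolding arcsin_coeff_def by (simp add: divide_le_eq)
qed

lemma gauss_integrable_square:
  assumes "finite I" "k \<in> I"
  shows "integrable (gauss I) (\<lambda>g. (g k)\<^sup>2)"
proof -
  interpret N: prob_space std_normal_distribution by (rule prob_space_std_normal)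
  have "integrable (gauss I) (\<lambda>g. \<Prod>i\<in>I. (if i = k then (g i)\<^sup>2 else 1))"
    by (rule gauss_prod(2)[OF assms(1), where f="\<lambda>i x. if i = k then x\<^sup>2 else 1"])
       (case_tac "i = k"; use integrable_std_normal_distribution_moment[of 2] in simp)
  also have "(\<lambda>g. \<Prod>i\<in>I. (if i = k then (g i)\<^sup>2 else 1)) = (\<lambda>g. (g k)\<^sup>2)"
    using assms by (simp add: fun_eq_iff)
  finally show ?thesis .
qed

lemma measurable_gauss_lincomb[measurable]:
  "(\<lambda>g. \<Sum>k\<in>I. w k * g k) \<in> borel_measurable (gauss I)"
  by (intro borel_measurable_sum) simp

text \<open>By the product formula for the sine, this is a difference of two values of the characteristic function.\<close>

lemma integral_gauss_sin_sin:
  assumes "finite I" and u: "(\<Sum>k\<in>I. (u k)\<^sup>2) = 1" and v: "(\<Sum>k\<in>I. (v k)\<^sup>2) = 1"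
  shows "(LINT g|gauss I. sin (\<alpha> * (\<Sum>k\<in>I. u k * g k)) * sin (\<beta> * (\<Sum>k\<in>I. v k * g k))) =
     exp (- (\<alpha>\<^sup>2 + \<beta>\<^sup>2) / 2) * sinh (\<alpha> * \<beta> * (\<Sum>k\<in>I. u k * v k))"
proof -
  interpret P: prob_space "gauss I" by (rule prob_space_gauss)
  define t where "t = (\<Sum>k\<in>I. u k * v k)"
  have lin: "\<alpha> * (\<Sum>k\<in>I. u k * g k) + s * (\<beta> * (\<Sum>k\<in>I. v k * g k)) = (\<Sum>k\<in>I. (\<alpha> * u k + s * \<beta> * v k) * g k)" for g s
    by (simp add: sum_distrib_left sum.distrib[symmetric] algebra_simps)
  have nrm: "(\<Sum>k\<in>I. (\<alpha> * u k + s * \<beta> * v k)\<^sup>2) = \<alpha>\<^sup>2 + s\<^sup>2 * \<beta>\<^sup>2 + 2 * s * \<alpha> * \<beta> * t" for s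
  proof -
    have "(\<Sum>k\<in>I. (\<alpha> * u k + s * \<beta> * v k)\<^sup>2) =
      (\<Sum>k\<in>I. \<alpha>\<^sup>2 * (u k)\<^sup>2 + s\<^sup>2 * \<beta>\<^sup>2 * (v k)\<^sup>2 + 2 * s * \<alpha> * \<beta> * (u k * v k))"
      by (intro sum.cong) (auto simp: power2_eq_square algebra_simps)
    then show ?thesis by (simp add: sum.distrib sum_distrib_left[symmetric] u v t_def)
  qed
  have E: "(LINT g|gauss I. cos (\<alpha> * (\<Sum>k\<in>I. u k * g k) + s * (\<beta> * (\<Sum>k\<in>I. v k * g k)))) =
     exp (- (\<alpha>\<^sup>2 + s\<^sup>2 * \<beta>\<^sup>2 + 2 * s * \<alpha> * \<beta> * t) / 2)" for s
    unfolding lin using integral_gauss_cos[OF assms(1), of "\<lambda>k. \<alpha> * u k + s * \<beta> * v k"] by (simp add: nrm)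
  have int: "integrable (gauss I) (\<lambda>g. cos (\<alpha> * (\<Sum>k\<in>I. u k * g k) + s * (\<beta> * (\<Sum>k\<in>I. v k * g k))))" for s
    by (rule P.integrable_const_bound[where B=1]) auto
  have "(LINT g|gauss I. sin (\<alpha> * (\<Sum>k\<in>I. u k * g k)) * sin (\<beta> * (\<Sum>k\<in>I. v k * g k))) =
    (LINT g|gauss I. (cos (\<alpha> * (\<Sum>k\<in>I. u k * g k) + (-1) * (\<beta> * (\<Sum>k\<in>I. v k * g k))) -
       cos (\<alpha> * (\<Sum>k\<in>I. u k * g k) + 1 * (\<beta> * (\<Sum>k\<in>I. v k * g k)))) / 2)"
    by (intro Bochner_Integration.integral_cong) (auto simp: sin_times_sin)
  also have "\<dots> = (exp (- (\<alpha>\<^sup>2 + \<beta>\<^sup>2 - 2 * \<alpha> * \<beta> * t) / 2) - exp (- (\<alpha>\<^sup>2 + \<beta>\<^sup>2 + 2 * \<alpha> * \<beta> * t) / 2)) / 2"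
    using E[of "-1"] E[of 1] int[of "-1"] int[of 1] by simp
  also have "- (\<alpha>\<^sup>2 + \<beta>\<^sup>2 - 2 * \<alpha> * \<beta> * t) / 2 = - (\<alpha>\<^sup>2 + \<beta>\<^sup>2) / 2 + \<alpha> * \<beta> * t" by (simp add: field_simps)
  also have "- (\<alpha>\<^sup>2 + \<beta>\<^sup>2 + 2 * \<alpha> * \<beta> * t) / 2 = - (\<alpha>\<^sup>2 + \<beta>\<^sup>2) / 2 - \<alpha> * \<beta> * t" by (simp add: field_simps)
  also have "(exp (- (\<alpha>\<^sup>2 + \<beta>\<^sup>2) / 2 + \<alpha> * \<beta> * t) - exp (- (\<alpha>\<^sup>2 + \<beta>\<^sup>2) / 2 - \<alpha> * \<beta> * t)) / 2 =
      exp (- (\<alpha>\<^sup>2 + \<beta>\<^sup>2) / 2) * sinh (\<alpha> * \<beta> * t)" for c d :: real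
    unfolding exp_add diff_conv_add_uminus sinh_field_def
    by (simp add: algebra_simps diff_divide_distrib)
  finally show ?thesis
    unfolding t_def[symmetric] .
qed

lemma abs_sin_quot_le: "\<bar>sin (z * c) / z\<bar> \<le> \<bar>c :: real\<bar>"
proof (cases "z = 0")
  case False
  have "\<bar>sin (z * c)\<bar> \<le> \<bar>z * c\<bar>" by (rule abs_sin_x_le_abs_x)
  then show ?thesis using False by (simp add: abs_mult divide_le_eq mult.commute)
qed simp

lemma sinh_series: "(\<lambda>k. x ^ (2*k+1) / fact (2*k+1)) sums sinh (x::real)"
proof -
  let ?f = "\<lambda>n. if even n then 0 else x ^ n /\<^sub>R fact n"
  have "n \<in> range (\<lambda>k. 2*k+1)" if "odd n" for n :: nat using that by (auto elim!: oddE)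
  then have "(\<lambda>k. ?f (2*k+1)) sums sinh x"
    using sinh_converges[of x]
    by (subst sums_mono_reindex[of "\<lambda>k. 2*k+1" ?f]) (auto simp: strict_mono_def simp del: One_nat_def)
  then show ?thesis by (simp add: divide_inverse mult.commute del: fact_Suc power_Suc)
qed

lemma smooth_sign_product_integral:
  "smooth_sign a * smooth_sign b = 2 / pi * (LINT h|gauss UNIV. sin (h True * a) / h True * (sin (h False * b) / h False))"
proof -
  interpret N: prob_space std_normal_distribution by (rule prob_space_std_normal)
  let ?f = "\<lambda>c z. sin (z * (if c then a else b)) / z"
  have int: "integrable std_normal_distribution (?f c)" for c
    by (rule N.integrable_const_bound[where B="\<bar>if c then a else b\<bar>"]) (auto intro: abs_sin_quot_le simp del: abs_divide)
  have "(LINT h|gauss UNIV. (\<Prod>c\<in>UNIV. ?f c (h c))) = (\<Prod>c\<in>UNIV. (LINT z|std_normal_distribution. ?f c z))"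
    by (rule gauss_prod) (use int in auto)
  then have "(LINT h|gauss UNIV. sin (h True * a) / h True * (sin (h False * b) / h False)) =
    (LINT z|std_normal_distribution. sin (z * a) / z) * (LINT z|std_normal_distribution. sin (z * b) / z)"
    by (simp add: UNIV_bool mult.commute)
  moreover have "sqrt (2 / pi) * x * (sqrt (2 / pi) * y) = 2 / pi * (x * y)" for x y :: real
  proof -
    have "sqrt (2 / pi) * x * (sqrt (2 / pi) * y) = (sqrt (2 / pi) * sqrt (2 / pi)) * (x * y)" by (simp only: mult_ac)
    then show ?thesis by (simp del: real_sqrt_divide)
  qed
  ultimately show ?thesis unfolding smooth_sign_def by simp
qed

text \<open>Redefining the integrand as 0 at the origin matches the convention \<open>sin 0 / 0 = 0\<close> in the Fourier integral
  of \<open>smooth_sign\<close>.\<close>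

lemma integral_moment_punctured:
  assumes "0 \<le> \<kappa>"
  shows "(LINT x|std_normal_distribution. (if x = 0 then 0 else x ^ (2*k) * exp (- \<kappa> * x\<^sup>2 / 2)))
     = fact (2*k) / (2 ^ k * fact k) / sqrt (1 + \<kappa>) ^ (2*k+1)" (is "?L = _")
  and "integrable std_normal_distribution (\<lambda>x. if x = 0 then 0 else x ^ (2*k) * exp (- \<kappa> * x\<^sup>2 / 2))"
proof -
  note m = std_normal_gauss_moment[OF assms, of k]
  have "?L = (LINT x|std_normal_distribution. x ^ (2*k) * exp (- \<kappa> * x\<^sup>2 / 2))"
  proof (rule integral_cong_AE)
    show "AE x in std_normal_distribution. (if x = 0 then 0 else x ^ (2*k) * exp (- \<kappa> * x\<^sup>2 / 2))
        = x ^ (2*k) * exp (- \<kappa> * x\<^sup>2 / 2)"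
      using AE_std_normal_nonzero by eventually_elim simp
  qed auto
  then show "?L = fact (2*k) / (2 ^ k * fact k) / sqrt (1 + \<kappa>) ^ (2*k+1)"
    using has_bochner_integral_integral_eq[OF m] by simp
  show "integrable std_normal_distribution (\<lambda>x. if x = 0 then 0 else x ^ (2*k) * exp (- \<kappa> * x\<^sup>2 / 2))"
    using m unfolding has_bochner_integral_iff
    by (auto intro: Bochner_Integration.integrable_bound)
qed

text \<open>A smoothed form of Grothendieck's identity: the expected product of the signs of two Gaussian projections with
  correlation \<open>t\<close> is \<open>2 / pi * arcsin t\<close>, and smoothing contracts the correlation. Inserting the Fourier
  integral of \<open>smooth_sign\<close> and integrating over the Gaussian vector first leaves a double integral of
  \<open>sinh (\<tau>\<^sup>2 * z * w * t) / (z * w)\<close>, whose Taylor terms factorise into even Gaussian moments.\<close>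

lemma expectation_smooth_sign_smooth_sign:
  assumes I: "finite I" and u: "(\<Sum>k\<in>I. (u k)\<^sup>2) = 1" and v: "(\<Sum>k\<in>I. (v k)\<^sup>2) = 1"
    and t: "t = (\<Sum>k\<in>I. u k * v k)" "\<bar>t\<bar> \<le> 1" and \<tau>: "\<tau> > 0"
  shows "(LINT g|gauss I. smooth_sign (\<tau> * (\<Sum>k\<in>I. u k * g k)) * smooth_sign (\<tau> * (\<Sum>k\<in>I. v k * g k))) =
     2 / pi * (\<Sum>k. arcsin_coeff k * (\<tau>\<^sup>2 / (1 + \<tau>\<^sup>2) * t) ^ (2*k+1))"
proof -
  interpret P: prob_space "gauss I" by (rule prob_space_gauss)
  interpret B: prob_space "gauss (UNIV :: bool set)" by (rule prob_space_gauss)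
  interpret pair_sigma_finite "gauss I" "gauss (UNIV :: bool set)" ..
  let ?X = "\<lambda>g. \<Sum>k\<in>I. u k * g k" and ?Y = "\<lambda>g. \<Sum>k\<in>I. v k * g k"
  define S where "S g h = sin (h True * (\<tau> * ?X g)) / h True * (sin (h False * (\<tau> * ?Y g)) / h False)"
    for g :: "'a \<Rightarrow> real" and h :: "bool \<Rightarrow> real"
  define \<rho> where "\<rho> = \<tau>\<^sup>2 / (1 + \<tau>\<^sup>2)"
  have \<rho>: "0 < \<rho>" "\<rho> < 1" using \<tau> by (auto simp: \<rho>_def add_pos_pos)
  have quot: "(\<lambda>p. sin (a p * (\<tau> * X p)) / a p) \<in> borel_measurable N"
    if "X \<in> borel_measurable N" "a \<in> borel_measurable N"
    for X a :: "('a \<Rightarrow> real) \<times> (bool \<Rightarrow> real) \<Rightarrow> real" and N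
    using that by measurable
  have measS: "(\<lambda>(g, h). S g h) \<in> borel_measurable (gauss I \<Otimes>\<^sub>M gauss UNIV)"
    unfolding S_def split_beta
    by (intro borel_measurable_times quot measurable_compose[OF measurable_fst measurable_gauss_lincomb]
          measurable_compose[OF measurable_snd measurable_gauss_component] UNIV_I)
  have boundS: "\<bar>S g h\<bar> \<le> \<tau>\<^sup>2 * (\<Sum>k\<in>I. (g k)\<^sup>2)" for g h
  proof -
    have "\<bar>?X g\<bar> \<le> L2_set u I * L2_set g I" "\<bar>?Y g\<bar> \<le> L2_set v I * L2_set g I"
      using L2_set_mult_ineq[of u g I] L2_set_mult_ineq[of v g I]
      by (auto intro!: order_trans[OF sum_abs] simp: abs_mult)
    then have XY: "\<bar>?X g\<bar> \<le> L2_set g I" "\<bar>?Y g\<bar> \<le> L2_set g I"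
      using u v by (auto simp: L2_set_def)
    have "\<bar>S g h\<bar> \<le> \<bar>\<tau> * ?X g\<bar> * \<bar>\<tau> * ?Y g\<bar>"
      unfolding S_def abs_mult[of "_ / _"] by (intro mult_mono abs_sin_quot_le) auto
    also have "\<dots> = \<tau>\<^sup>2 * (\<bar>?X g\<bar> * \<bar>?Y g\<bar>)"
      using \<tau> by (simp add: abs_mult power2_eq_square)
    also have "\<dots> \<le> \<tau>\<^sup>2 * (L2_set g I * L2_set g I)"
      using XY by (intro mult_left_mono mult_mono) auto
    also have "L2_set g I * L2_set g I = (\<Sum>k\<in>I. (g k)\<^sup>2)"
      by (simp add: L2_set_def sum_nonneg)
    finally show ?thesis .
  qed
  have intsq: "integrable (gauss I) (\<lambda>g. \<tau>\<^sup>2 * (\<Sum>k\<in>I. (g k)\<^sup>2))"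
    using gauss_integrable_square[OF I] by (intro integrable_mult_right integrable_sum) auto
  have intS: "integrable (gauss I \<Otimes>\<^sub>M gauss UNIV) (\<lambda>(g, h). S g h)"
  proof (rule Bochner_Integration.integrable_bound)
    show "integrable (gauss I \<Otimes>\<^sub>M gauss (UNIV :: bool set)) (\<lambda>(g, h). \<tau>\<^sup>2 * (\<Sum>k\<in>I. (g k)\<^sup>2))"
      using intsq by (intro Fubini_integrable) (auto simp: sum_nonneg)
    show "AE x in gauss I \<Otimes>\<^sub>M gauss UNIV. norm (case x of (g, h) \<Rightarrow> S g h)
       \<le> norm (case x of (g, h::bool \<Rightarrow> real) \<Rightarrow> \<tau>\<^sup>2 * (\<Sum>k\<in>I. (g k)\<^sup>2))"
      using boundS by (auto simp: abs_mult sum_nonneg)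
  qed (rule measS)
  let ?w = "\<lambda>k h. \<Prod>b\<in>(UNIV::bool set). if h b = 0 then 0 else (h b) ^ (2*k) * exp (- \<tau>\<^sup>2 * (h b)\<^sup>2 / 2)"
  let ?m = "\<lambda>k. fact (2*k) / (2 ^ k * fact k) / sqrt (1 + \<tau>\<^sup>2) ^ (2*k+1)"
  \<comment> \<open>The terms of the Taylor expansion in \<open>t\<close>. They are set to 0 where a coordinate of \<open>h\<close> vanishes, as the
    quotients in \<open>S\<close> are there.\<close>
  define T where "T k h = \<tau> ^ (4*k+2) * t ^ (2*k+1) / fact (2*k+1) *
     ?w k h" for k and h :: "bool \<Rightarrow> real"
  have T_sums: "(\<lambda>k. T k h) sums (LINT g|gauss I. S g h)" for h
  proof (cases "h True = 0 \<or> h False = 0")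
    case True
    then have "T k h = 0" "S g h = 0" for k g by (auto simp: T_def S_def UNIV_bool)
    then show ?thesis by simp
  next
    case False
    define z where "z = h True" define w where "w = h False"
    have nz: "z \<noteq> 0" "w \<noteq> 0" using False by (auto simp: z_def w_def)
    have "(LINT g|gauss I. S g h) = (LINT g|gauss I. sin ((\<tau>*z) * ?X g) * sin ((\<tau>*w) * ?Y g)) / (z * w)"
      unfolding S_def z_def w_def by (simp add: mult_ac)
    also have "\<dots> = exp (- ((\<tau>*z)\<^sup>2 + (\<tau>*w)\<^sup>2) / 2) * sinh (\<tau>*z * (\<tau>*w) * t) / (z * w)"
      unfolding integral_gauss_sin_sin[OF I u v] t(1) ..
    finally have eq: "(LINT g|gauss I. S g h) = \<dots>" .
    have "(\<lambda>k. exp (- ((\<tau>*z)\<^sup>2 + (\<tau>*w)\<^sup>2) / 2) / (z * w) * ((\<tau>*z * (\<tau>*w) * t) ^ (2*k+1) / fact (2*k+1)))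
       sums (exp (- ((\<tau>*z)\<^sup>2 + (\<tau>*w)\<^sup>2) / 2) / (z * w) * sinh (\<tau>*z * (\<tau>*w) * t))"
      by (intro sums_mult sinh_series)
    moreover have "exp (- ((\<tau>*z)\<^sup>2 + (\<tau>*w)\<^sup>2) / 2) / (z * w) * ((\<tau>*z * (\<tau>*w) * t) ^ (2*k+1) / fact (2*k+1)) = T k h" for k
    proof -
      have "\<tau> ^ (2*k) * \<tau> ^ (2*k) = \<tau> ^ (4*k)"
        by (simp add: power_add[symmetric])
      moreover have "exp (- ((\<tau>*z)\<^sup>2 + (\<tau>*w)\<^sup>2) / 2) = exp (- \<tau>\<^sup>2 * z\<^sup>2 / 2) * exp (- \<tau>\<^sup>2 * w\<^sup>2 / 2)"
        unfolding exp_add[symmetric] by (simp add: power_mult_distrib add_divide_distrib diff_divide_distrib)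
      moreover have "T k h = \<tau> ^ (4*k+2) * t ^ (2*k+1) / fact (2*k+1) *
          ((w ^ (2*k) * exp (- \<tau>\<^sup>2 * w\<^sup>2 / 2)) * (z ^ (2*k) * exp (- \<tau>\<^sup>2 * z\<^sup>2 / 2)))"
        using nz unfolding T_def z_def w_def by (simp add: UNIV_bool)
      ultimately show ?thesis
        using nz by (simp add: power_mult_distrib del: fact_Suc)
    qed
    ultimately show ?thesis unfolding eq by simp
  qed
  have intprod: "integrable (gauss UNIV) (\<lambda>h. ?w k h)"
    and eqprod: "(LINT h|gauss UNIV. ?w k h) =
      (?m k)\<^sup>2" for k
    using gauss_prod[where I="UNIV::bool set" and f="\<lambda>b x. if x = 0 then 0 else x ^ (2*k) * exp (- \<tau>\<^sup>2 * x\<^sup>2 / 2)"]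
      integral_moment_punctured[of "\<tau>\<^sup>2" k]
    by (auto simp: power2_eq_square)
  have intT: "integrable (gauss UNIV) (T k)" for k
    unfolding T_def by (intro integrable_mult_right intprod)
  have T_eq: "(LINT h|gauss UNIV. norm (T k h)) = arcsin_coeff k * (\<rho> * \<bar>t\<bar>) ^ (2*k+1)"
    and T_eq': "(LINT h|gauss UNIV. T k h) = arcsin_coeff k * (\<rho> * t) ^ (2*k+1)" for k
  proof -
    have a: "\<tau> ^ (4*k+2) / fact (2*k+1) * (?m k)\<^sup>2 =
       arcsin_coeff k * \<rho> ^ (2*k+1)"
    proof -
      have gen: "P / (c * F) * (F\<^sup>2 / (q * r) / D) = F / (q * r * c) * (P / D)"
        if "F \<noteq> 0" for P c F q r D :: real
        using that by (simp add: power2_eq_square mult_ac)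
      have "\<tau> ^ (4*k+2) = (\<tau>\<^sup>2) ^ (2*k+1)" unfolding power_mult[symmetric] by (rule arg_cong[of _ _ "power \<tau>"]) simp
      moreover have "(sqrt (1 + \<tau>\<^sup>2) ^ (2*k+1))\<^sup>2 = (1 + \<tau>\<^sup>2) ^ (2*k+1)"
        unfolding power2_eq_square power_mult_distrib[symmetric] by simp
      moreover have "(2 ^ k)\<^sup>2 = (4::real) ^ k" unfolding power2_eq_square power_mult_distrib[symmetric] by simp
      moreover have "fact (2*k+1) = (2 * real k + 1) * fact (2*k)" by simp
      ultimately show ?thesis
        unfolding arcsin_coeff_def \<rho>_def
        using gen[of "fact (2*k)" _ "2 * real k + 1" "4 ^ k" "(fact k)\<^sup>2"]
        by (simp only: power_divide power_mult_distrib) simp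
    qed
    have "norm (T k h) = \<tau> ^ (4*k+2) * \<bar>t\<bar> ^ (2*k+1) / fact (2*k+1) *
       ?w k h" for h
      using \<tau> by (auto simp: T_def UNIV_bool abs_mult power_abs)
    then have "(LINT h|gauss UNIV. norm (T k h)) = \<tau> ^ (4*k+2) * \<bar>t\<bar> ^ (2*k+1) / fact (2*k+1) *
       (?m k)\<^sup>2"
      by (simp only: integral_mult_right_zero eqprod)
    also have "\<dots> = (\<tau> ^ (4*k+2) / fact (2*k+1) * (?m k)\<^sup>2) * \<bar>t\<bar> ^ (2*k+1)"
      by simp
    finally show "(LINT h|gauss UNIV. norm (T k h)) = arcsin_coeff k * (\<rho> * \<bar>t\<bar>) ^ (2*k+1)"
      unfolding a by (simp add: power_mult_distrib)
    have "(LINT h|gauss UNIV. T k h) = \<tau> ^ (4*k+2) * t ^ (2*k+1) / fact (2*k+1) *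
       (?m k)\<^sup>2"
      unfolding T_def by (simp only: integral_mult_right_zero eqprod)
    also have "\<dots> = (\<tau> ^ (4*k+2) / fact (2*k+1) * (?m k)\<^sup>2) * t ^ (2*k+1)"
      by simp
    finally show "(LINT h|gauss UNIV. T k h) = arcsin_coeff k * (\<rho> * t) ^ (2*k+1)"
      unfolding a by (simp add: power_mult_distrib)
  qed
  have "\<rho> * \<bar>t\<bar> \<le> \<rho> * 1" using \<rho> t(2) by (intro mult_left_mono) auto
  then have \<rho>t: "\<rho> * \<bar>t\<bar> < 1" "0 \<le> \<rho> * \<bar>t\<bar>"
    using \<rho> by (linarith, simp)
  have sumT: "summable (\<lambda>k. LINT h|gauss UNIV. norm (T k h))"
  proof (rule summable_comparison_test')
    show "summable (\<lambda>k. (\<rho> * \<bar>t\<bar>) ^ k)" using \<rho>t by (simp add: summable_geometric)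
    show "norm (LINT h|gauss UNIV. norm (T k h)) \<le> (\<rho> * \<bar>t\<bar>) ^ k" if "0 \<le> k" for k
    proof -
      have "arcsin_coeff k * (\<rho> * \<bar>t\<bar>) ^ (2*k+1) \<le> 1 * (\<rho> * \<bar>t\<bar>) ^ k"
        using \<rho>t arcsin_coeff_le_1 arcsin_coeff_pos[of k] by (intro mult_mono power_decreasing) auto
      moreover have "0 \<le> arcsin_coeff k * (\<rho> * \<bar>t\<bar>) ^ (2*k+1)"
        by (rule mult_nonneg_nonneg[OF less_imp_le[OF arcsin_coeff_pos] zero_le_power[OF \<rho>t(2)]])
      ultimately show ?thesis unfolding T_eq by simp
    qed
  qed
  have summT: "summable (\<lambda>k. norm (T k h))" for h
  proof (cases "h True = 0 \<or> h False = 0")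
    case True
    then have "T k h = 0" for k by (auto simp: T_def UNIV_bool)
    then show ?thesis by simp
  next
    case False
    define x where "x = \<bar>\<tau>\<^sup>2 * t * (h True * h False)\<bar>"
    have nn: "norm (T k h) = exp (- \<tau>\<^sup>2 * (h True)\<^sup>2 / 2) * exp (- \<tau>\<^sup>2 * (h False)\<^sup>2 / 2) / \<bar>h True * h False\<bar> * (x ^ (2*k+1) / fact (2*k+1))" for k
    proof -
      have "\<tau> ^ (4*k+2) = (\<tau>\<^sup>2) ^ (2*k+1)" unfolding power_mult[symmetric] by (rule arg_cong[of _ _ "power \<tau>"]) simp
      then show ?thesis using False
        by (simp add: T_def UNIV_bool abs_mult power_abs x_def power_mult_distrib del: fact_Suc)
    qed
    show ?thesis unfolding nn using sinh_series[of x] by (intro summable_mult) (rule sums_summable)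
  qed
  have "(LINT g|gauss I. smooth_sign (\<tau> * ?X g) * smooth_sign (\<tau> * ?Y g)) = 2 / pi * (LINT g|gauss I. LINT h|gauss UNIV. S g h)"
    unfolding smooth_sign_product_integral S_def by simp
  also have "(LINT g|gauss I. LINT h|gauss UNIV. S g h) = (LINT h|gauss UNIV. LINT g|gauss I. S g h)"
    using Fubini_integral[OF intS] by simp
  also have "\<dots> = (LINT h|gauss UNIV. (\<Sum>k. T k h))"
    using T_sums by (simp add: sums_iff)
  also have "\<dots> = (\<Sum>k. LINT h|gauss UNIV. T k h)"
    by (rule integral_suminf[OF intT]) (use summT sumT in auto)
  finally show ?thesis unfolding T_eq' \<rho>_def .
qed

lemma gbinomial_minus_half:
  "((-1/2 :: real) gchoose k) = (-1) ^ k * arcsin_coeff k * (2 * real k + 1)"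
proof (induction k)
  case 0 then show ?case by (simp add: arcsin_coeff_def)
next
  case (Suc k)
  have "((-1/2 :: real) gchoose Suc k) = ((-1/2) gchoose k) * ((-1/2 - real k) / (real k + 1))"
    using gbinomial_mult_1[of "-1/2::real" k] by (simp add: field_simps)
  also have "\<dots> = (-1) ^ Suc k * (arcsin_coeff k * (2 * real k + 1) * ((2 * real k + 1) / (2 * (real k + 1))))"
    unfolding Suc by (simp add: field_simps)
  also have "arcsin_coeff k * (2 * real k + 1) * ((2 * real k + 1) / (2 * (real k + 1))) = arcsin_coeff (Suc k) * (2 * real (Suc k) + 1)"
  proof -
    have "arcsin_coeff n * (2 * real n + 1) = fact (2*n) / (4 ^ n * (fact n)\<^sup>2)" for n
      unfolding arcsin_coeff_def by (simp add: add_nonneg_eq_0_iff)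
    note e = this
    have f1: "(fact (2 * Suc k) :: real) = 2 * (real k + 1) * ((2 * real k + 1) * fact (2*k))"
      by (simp add: algebra_simps)
    have f2: "(fact (Suc k))\<^sup>2 = (real k + 1)\<^sup>2 * (fact k :: real)\<^sup>2"
      by (simp add: power_mult_distrib add.commute)
    have g: "F / (q * r) * (c / (2 * d)) = 2 * d * (c * F) / (4 * q * (d\<^sup>2 * r))" if "d \<noteq> 0" for F q r c d :: real
      using that by (simp add: power2_eq_square)
    have nz: "real k + 1 \<noteq> 0" by simp
    show ?thesis unfolding e[of k] e[of "Suc k"] f1 f2 power_Suc g[OF nz] ..
  qed
  finally show ?case by simp
qed

lemma arcsin_coeff_deriv_sums:
  assumes "\<bar>x\<bar> < (1::real)" "\<bar>s\<bar> = (1::real)"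
  shows "(\<lambda>k. s ^ k * arcsin_coeff k * (2 * real k + 1) * x ^ (2*k)) sums (1 / sqrt (1 - s * x\<^sup>2))"
proof -
  have "x\<^sup>2 < 1" using assms by (simp add: abs_square_less_1)
  then have *: "\<bar>- s * x\<^sup>2\<bar> < 1" using assms(2) by (simp add: abs_mult)
  have "((-1/2) gchoose k) * (- s * x\<^sup>2) ^ k = s ^ k * arcsin_coeff k * (2 * real k + 1) * x ^ (2*k)" for k
  proof -
    have "(- s * x\<^sup>2) ^ k = (-1)^k * s ^ k * x ^ (2*k)"
      by (simp add: power_mult power_mult_distrib[symmetric])
    moreover have "(-1) ^ k * (-1) ^ k = (1::real)" by (simp add: power_mult_distrib[symmetric])
    ultimately show ?thesis unfolding gbinomial_minus_half by simp
  qed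
  then have eq: "(\<lambda>k. ((-1/2) gchoose k) * (- s * x\<^sup>2) ^ k) = (\<lambda>k. s ^ k * arcsin_coeff k * (2 * real k + 1) * x ^ (2*k))"
    by blast
  have pos: "0 \<le> 1 + - s * x\<^sup>2" using * by linarith
  have "(1 + - s * x\<^sup>2) powr (- (1/2)) = 1 / (1 + - s * x\<^sup>2) powr (1/2)"
    by (rule powr_minus_divide)
  also have "(1 + - s * x\<^sup>2) powr (1/2) = sqrt (1 + - s * x\<^sup>2)"
    using pos by (rule powr_half_sqrt)
  finally have "(1 + - s * x\<^sup>2) powr (-1/2) = 1 / sqrt (1 - s * x\<^sup>2)"
    unfolding minus_divide_left by simp
  then show ?thesis
    using Generalised_Binomial_Theorem.gen_binomial_real[OF *, of "-1/2"] unfolding eq by metis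
qed

text \<open>With \<open>s = 1\<close> this covers \<open>arcsin\<close> and with \<open>s = - 1\<close> it covers \<open>arsinh\<close>: the termwise derivative is the binomial
  series of \<open>(1 - s * x\<^sup>2) powr (- 1 / 2)\<close>.\<close>

lemma asin_type_series_aux:
  fixes s :: real and F :: "real \<Rightarrow> real"
  assumes s: "\<bar>s\<bar> = 1" and F0: "F 0 = 0"
    and dF: "\<And>x. \<bar>x\<bar> < 1 \<Longrightarrow> (F has_real_derivative 1 / sqrt (1 - s * x\<^sup>2)) (at x)"
    and x: "\<bar>x\<bar> < 1"
  shows "(\<lambda>k. s ^ k * arcsin_coeff k * x ^ (2*k+1)) sums F x"
proof -
  let ?c = "\<lambda>n. if odd n then s ^ (n div 2) * arcsin_coeff (n div 2) else 0"
  have mono: "strict_mono (\<lambda>k::nat. 2*k+1)" by (simp add: strict_mono_def)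
  have odd_range: "n \<in> range (\<lambda>k. 2*k+1)" if "odd n" for n :: nat using that by (auto elim!: oddE)
  have summ: "summable (\<lambda>n. ?c n * y ^ n)" if "\<bar>y\<bar> < 1" for y
  proof (rule summable_comparison_test')
    show "summable (\<lambda>n. \<bar>y\<bar> ^ n)" using that by (simp add: summable_geometric)
    show "norm (?c n * y ^ n) \<le> \<bar>y\<bar> ^ n" if "0 \<le> n" for n
      using mult_right_mono[OF arcsin_coeff_le_1[of "n div 2"], of "\<bar>y\<bar> ^ n"] arcsin_coeff_pos[of "n div 2"]
      by (simp add: abs_mult power_abs s abs_of_pos)
  qed
  have deriv: "((\<lambda>y. \<Sum>n. ?c n * y ^ n) has_real_derivative 1 / sqrt (1 - s * y\<^sup>2)) (at y)" if y1: "\<bar>y\<bar> < 1" for y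
  proof -
    obtain r where r: "\<bar>y\<bar> < r" "r < 1" using dense[OF y1] by auto
    then have sr: "summable (\<lambda>n. ?c n * r ^ n)" by (intro summ) auto
    have "((\<lambda>y. \<Sum>n. ?c n * y ^ n) has_real_derivative (\<Sum>n. diffs ?c n * y ^ n)) (at y)"
      by (rule termdiffs_strong[OF sr]) (use r in auto)
    moreover have "(\<Sum>n. diffs ?c n * y ^ n) = 1 / sqrt (1 - s * y\<^sup>2)"
    proof -
      have "(\<lambda>k. diffs ?c (2*k) * y ^ (2*k)) sums (1 / sqrt (1 - s * y\<^sup>2))"
        using arcsin_coeff_deriv_sums[OF y1 s] by (simp add: diffs_def mult_ac add_ac)
      then have "(\<lambda>n. diffs ?c n * y ^ n) sums (1 / sqrt (1 - s * y\<^sup>2))"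
        by (subst (asm) sums_mono_reindex[of "\<lambda>k. 2*k" "\<lambda>n. diffs ?c n * y ^ n"])
           (auto simp: strict_mono_def diffs_def elim!: evenE)
      then show ?thesis by (simp add: sums_iff)
    qed
    ultimately show ?thesis by simp
  qed
  define D where "D y = (\<Sum>n. ?c n * y ^ n) - F y" for y
  have "D x = D 0"
  proof (rule DERIV_isconst3[of "-1" 1 x 0])
    show "(D has_real_derivative 0) (at y)" if "y \<in> {-1<..<1}" for y
      unfolding D_def using DERIV_diff[OF deriv[of y] dF[of y]] that by auto
  qed (use x in auto)
  moreover have "D 0 = 0" unfolding D_def F0
    by (subst suminf_finite[of "{}"]) (auto simp: power_0_left)
  ultimately have "(\<Sum>n. ?c n * x ^ n) = F x" by (simp add: D_def)
  then have "(\<lambda>n. ?c n * x ^ n) sums F x" using summ[OF x] by (simp add: sums_iff)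
  moreover have "(\<lambda>k. (\<lambda>n. ?c n * x ^ n) (2*k+1)) sums F x \<longleftrightarrow> (\<lambda>n. ?c n * x ^ n) sums F x"
    by (rule sums_mono_reindex[OF mono]) (use odd_range in auto)
  ultimately have "(\<lambda>k. (\<lambda>n. ?c n * x ^ n) (2*k+1)) sums F x" by blast
  then show ?thesis by simp
qed

lemma arcsin_series_open:
  assumes "\<bar>x\<bar> < (1::real)" shows "(\<lambda>k. arcsin_coeff k * x ^ (2*k+1)) sums arcsin x"
proof -
  have "(arcsin has_real_derivative 1 / sqrt (1 - 1 * y\<^sup>2)) (at y)" if "\<bar>y\<bar> < 1" for y
    using DERIV_arcsin[of y] that by (simp add: abs_less_iff divide_inverse)
  from asin_type_series_aux[OF _ _ this assms] show ?thesis by simp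
qed

lemma arsinh_series_open:
  assumes "\<bar>x\<bar> < (1::real)" shows "(\<lambda>k. (-1) ^ k * arcsin_coeff k * x ^ (2*k+1)) sums arsinh x"
proof -
  have "(arsinh has_real_derivative 1 / sqrt (1 - (-1) * y\<^sup>2)) (at y)" for y :: real
    using arsinh_real_has_field_derivative[of y UNIV] by (simp add: add.commute)
  from asin_type_series_aux[OF _ _ this assms] show ?thesis by simp
qed

text \<open>The partial sums at \<open>x < 1\<close> are below \<open>arcsin x \<le> pi / 2\<close>; let \<open>x\<close> tend to 1.\<close>

lemma summable_arcsin_coeff: "summable arcsin_coeff"
proof (rule summableI_nonneg_bounded[where x="pi/2"])
  fix n
  show "sum arcsin_coeff {..<n} \<le> pi / 2"
  proof (rule tendsto_upperbound)
    show "((\<lambda>x. \<Sum>k<n. arcsin_coeff k * x ^ (2*k+1)) \<longlongrightarrow> sum arcsin_coeff {..<n}) (at_left (1::real))"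
      by (auto intro!: tendsto_eq_intros)
    have "(\<Sum>k<n. arcsin_coeff k * x ^ (2*k+1)) \<le> pi / 2" if "0 < x" "x < 1" for x
    proof -
      have "(\<Sum>k<n. arcsin_coeff k * x ^ (2*k+1)) \<le> arcsin x"
      proof -
        have sx: "(\<lambda>k. arcsin_coeff k * x ^ (2*k+1)) sums arcsin x"
          using that by (intro arcsin_series_open) auto
        have "(\<Sum>k<n. arcsin_coeff k * x ^ (2*k+1)) \<le> (\<Sum>k. arcsin_coeff k * x ^ (2*k+1))"
          by (rule sum_le_suminf[OF sums_summable[OF sx]])
             (use that arcsin_coeff_pos in \<open>auto intro!: mult_nonneg_nonneg simp: less_imp_le\<close>)
        then show ?thesis using sx by (simp add: sums_iff)
      qed
      also have "\<dots> \<le> pi / 2" using that arcsin_bounded[of x] by simp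
      finally show ?thesis .
    qed
    then show "eventually (\<lambda>x. (\<Sum>k<n. arcsin_coeff k * x ^ (2*k+1)) \<le> pi / 2) (at_left (1::real))"
      by (intro eventually_mono[OF eventually_at_left_real[of 0 1]]) auto
  qed simp
qed (simp add: arcsin_coeff_pos less_imp_le)

text \<open>The series converges uniformly on \<open>[-1, 1]\<close>, so the identity extends from the open interval by continuity.\<close>

lemma asin_type_series_closed:
  fixes s :: real and F :: "real \<Rightarrow> real"
  assumes s: "\<bar>s\<bar> = 1" and cont: "continuous_on {-1..1} F"
    and op: "\<And>x. \<bar>x\<bar> < 1 \<Longrightarrow> (\<lambda>k. s ^ k * arcsin_coeff k * x ^ (2*k+1)) sums F x"
    and x: "\<bar>x\<bar> \<le> 1"
  shows "(\<lambda>k. s ^ k * arcsin_coeff k * x ^ (2*k+1)) sums F x"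
proof -
  let ?f = "\<lambda>k x. s ^ k * arcsin_coeff k * x ^ (2*k+1)"
  have bd: "norm (?f k y) \<le> arcsin_coeff k" if "y \<in> {-1..1}" for k y
    using mult_left_mono[OF power_le_one[of "\<bar>y\<bar>" "2*k+1"], of "arcsin_coeff k"] that arcsin_coeff_pos[of k]
    by (simp add: abs_mult power_abs s abs_le_iff)
  have ul: "uniform_limit {-1..1} (\<lambda>n x. \<Sum>k<n. ?f k x) (\<lambda>x. \<Sum>k. ?f k x) sequentially"
    by (rule Weierstrass_m_test[OF bd summable_arcsin_coeff])
  have c1: "continuous_on {-1..1} (\<lambda>x. \<Sum>k. ?f k x)"
    by (rule uniform_limit_theorem[OF _ ul]) (auto intro!: always_eventually continuous_intros)
  have "continuous_on (closure {-1<..<1}) (\<lambda>x. (\<Sum>k. ?f k x) - F x)"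
    using continuous_on_diff[OF c1 cont] by simp
  then have "(\<Sum>k. ?f k x) - F x = 0"
  proof (rule continuous_constant_on_closure)
    show "(\<Sum>k. ?f k y) - F y = 0" if "y \<in> {-1<..<1}" for y
      using op[of y] that by (auto simp: sums_iff)
    show "x \<in> closure {-1<..<1}" using x by (auto simp: abs_le_iff)
  qed
  moreover have "summable (\<lambda>k. ?f k x)"
  proof (rule summable_comparison_test'[OF summable_arcsin_coeff, where N=0])
    show "norm (?f k x) \<le> arcsin_coeff k" if "0 \<le> k" for k using x by (intro bd) auto
  qed
  ultimately show ?thesis by (simp add: sums_iff)
qed

lemma arcsin_series:
  assumes "\<bar>x\<bar> \<le> (1::real)" shows "(\<lambda>k. arcsin_coeff k * x ^ (2*k+1)) sums arcsin x"
proof -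
  have "(\<lambda>k. 1 ^ k * arcsin_coeff k * x ^ (2*k+1)) sums arcsin x"
    by (rule asin_type_series_closed[OF _ continuous_on_arcsin' _ assms]) (use arcsin_series_open in auto)
  then show ?thesis by simp
qed

lemma arsinh_series:
  assumes "\<bar>x\<bar> \<le> (1::real)" shows "(\<lambda>k. (-1) ^ k * arcsin_coeff k * x ^ (2*k+1)) sums arsinh x"
  by (rule asin_type_series_closed[OF _ continuous_on_arsinh arsinh_series_open assms]) auto

section \<open>Rounding Gram matrices to signs\<close>

definition pairing :: "(nat \<Rightarrow> nat \<Rightarrow> real) \<Rightarrow> nat \<Rightarrow> nat \<Rightarrow> (nat \<Rightarrow> nat \<Rightarrow> real) \<Rightarrow> real" where
  "pairing a m n M = (\<Sum>i<m. \<Sum>j<n. a i j * M i j)"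

text \<open>Rounding is to \<open>[-1, 1]\<close> instead of \<open>{-1, 1}\<close>. A bilinear form has the same maximum on both
  (\<open>sign_bilinear_bound\<close>), and expectations of products of smooth functions can be bounded directly.\<close>

definition bilinear_bound :: "(nat \<Rightarrow> nat \<Rightarrow> real) \<Rightarrow> nat \<Rightarrow> nat \<Rightarrow> real \<Rightarrow> bool" where
  "bilinear_bound a m n \<beta> \<longleftrightarrow> (\<forall>f g. (\<forall>i. \<bar>f i\<bar> \<le> 1) \<longrightarrow> (\<forall>j. \<bar>g j\<bar> \<le> 1) \<longrightarrow> pairing a m n (\<lambda>i j. f i * g j) \<le> \<beta>)"

definition gram_sup :: "(nat \<Rightarrow> nat \<Rightarrow> real) \<Rightarrow> nat \<Rightarrow> nat \<Rightarrow> real" where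
  "gram_sup a m n = Sup (pairing a m n ` gram_matrices)"

lemma pairing_linear:
  "pairing a m n (\<lambda>i j. x * M i j + y * N i j) = x * pairing a m n M + y * pairing a m n N"
  unfolding pairing_def by (simp add: sum_distrib_left sum.distrib algebra_simps)

lemma pairing_scale: "pairing a m n (\<lambda>i j. x * M i j) = x * pairing a m n M"
  using pairing_linear[of a m n x M 0 M] by simp

lemma pairing_tendsto:
  assumes "\<And>i j. ((\<lambda>k. S k i j) \<longlongrightarrow> M i j) F"
  shows "((\<lambda>k. pairing a m n (S k)) \<longlongrightarrow> pairing a m n M) F"
  unfolding pairing_def by (intro tendsto_intros assms)

lemma mult_le_abs_mult: "x * y \<le> \<bar>x\<bar> * \<bar>y\<bar>" for x y :: real
  using abs_ge_self[of "x * y"] by (simp only: abs_mult)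

lemma pairing_gram_bdd: "bdd_above (pairing a m n ` gram_matrices)"
proof (rule bdd_aboveI2)
  fix M :: "nat \<Rightarrow> nat \<Rightarrow> real" assume "M \<in> gram_matrices"
  have "a i j * M i j \<le> \<bar>a i j\<bar>" for i j
  proof -
    have "a i j * M i j \<le> \<bar>a i j\<bar> * \<bar>M i j\<bar>" by (rule mult_le_abs_mult)
    also have "\<dots> \<le> \<bar>a i j\<bar> * 1" using \<open>M \<in> gram_matrices\<close> by (intro mult_left_mono gram_bound) auto
    finally show ?thesis by simp
  qed
  then show "pairing a m n M \<le> (\<Sum>i<m. \<Sum>j<n. \<bar>a i j\<bar>)"
    unfolding pairing_def by (intro sum_mono)
qed

lemma pairing_le_gram_sup:
  assumes "M \<in> gram_closure" shows "pairing a m n M \<le> gram_sup a m n"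
proof -
  obtain S where S: "\<And>k. S k \<in> gram_matrices" "\<And>i j. (\<lambda>k. S k i j) \<longlonglongrightarrow> M i j"
    using assms unfolding gram_closure_seq by blast
  show ?thesis
  proof (rule tendsto_upperbound[OF pairing_tendsto[OF S(2)]])
    show "\<forall>\<^sub>F k in sequentially. pairing a m n (S k) \<le> gram_sup a m n"
      unfolding gram_sup_def using S(1) pairing_gram_bdd by (auto intro!: always_eventually cSUP_upper)
  qed simp
qed

text \<open>Negation preserves \<open>gram_closure\<close>, so the supremum bounds the pairing from both sides. This estimate lets a small
  error matrix be absorbed into \<open>gram_sup\<close>.\<close>

lemma pairing_gram_norm_le:
  assumes "gram_norm_le r M" shows "\<bar>pairing a m n M\<bar> \<le> r * gram_sup a m n"
proof -
  obtain N where N: "0 \<le> r" "N \<in> gram_closure" "M = (\<lambda>i j. r * N i j)"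
    using assms unfolding gram_norm_le_def by blast
  have "(\<lambda>i j. (-1) * N i j + 0 * N i j) \<in> gram_closure" by (rule gram_closure_combine) (use N in auto)
  then have "- pairing a m n N \<le> gram_sup a m n"
    using pairing_le_gram_sup[of _ a m n] pairing_linear[of a m n "-1" N 0 N] by fastforce
  then have "\<bar>pairing a m n N\<bar> \<le> gram_sup a m n" using pairing_le_gram_sup[OF N(2), of a m n] by simp
  then show ?thesis unfolding N(3) pairing_scale using N(1) by (simp add: abs_mult mult_left_mono)
qed

lemma measurable_smooth_sign[measurable]: "smooth_sign \<in> borel_measurable borel"
proof -
  interpret N: prob_space std_normal_distribution by (rule prob_space_std_normal)
  have "(\<lambda>(x, z). sin (z * x) / z) \<in> borel_measurable (borel \<Otimes>\<^sub>M std_normal_distribution)"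
    by simp
  then show ?thesis unfolding smooth_sign_def[abs_def]
    by (intro borel_measurable_times borel_measurable_const N.borel_measurable_lebesgue_integral)
qed

text \<open>Average the bound for \<open>smooth_sign (\<tau> * \<langle>G, u i\<rangle>)\<close> and \<open>smooth_sign (\<tau> * \<langle>G, v j\<rangle>)\<close> over the Gaussian vector \<open>G\<close>, then
  let \<open>\<tau>\<close> tend to infinity.\<close>

lemma arcsin_rounding_gram:
  assumes \<beta>: "bilinear_bound a m n \<beta>" and M: "M \<in> gram_matrices"
  shows "pairing a m n (\<lambda>i j. 2 / pi * arcsin (M i j)) \<le> \<beta>"
proof -
  obtain I :: "nat set" and u v where I: "finite I" and u: "\<And>i. (\<Sum>k\<in>I. (u i k)\<^sup>2) = 1" and v: "\<And>j. (\<Sum>k\<in>I. (v j k)\<^sup>2) = 1"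
    and Meq: "\<And>i j. M i j = (\<Sum>k\<in>I. u i k * v j k)"
    using gram_unit[OF M] by blast
  interpret P: prob_space "gauss I" by (rule prob_space_gauss)
  have Mb: "\<bar>M i j\<bar> \<le> 1" for i j by (rule gram_bound[OF M])
  have le: "pairing a m n (\<lambda>i j. 2 / pi * arcsin (\<tau>\<^sup>2 / (1 + \<tau>\<^sup>2) * M i j)) \<le> \<beta>" if \<tau>: "\<tau> > 0" for \<tau>
  proof -
    let ?f = "\<lambda>g i. smooth_sign (\<tau> * (\<Sum>k\<in>I. u i k * g k))" and ?g = "\<lambda>g j. smooth_sign (\<tau> * (\<Sum>k\<in>I. v j k * g k))"
    have m: "(\<lambda>g. smooth_sign (\<tau> * (\<Sum>k\<in>I. w k * g k))) \<in> borel_measurable (gauss I)" for w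
      by (rule measurable_compose[OF borel_measurable_times[OF borel_measurable_const measurable_gauss_lincomb] measurable_smooth_sign])
    have int: "integrable (gauss I) (\<lambda>g. ?f g i * ?g g j)" for i j
    proof (rule P.integrable_const_bound[where B="1 * 1"])
      have "norm (?f g i * ?g g j) \<le> 1 * 1" for g
        unfolding real_norm_def abs_mult by (intro mult_mono abs_smooth_sign_le_1) auto
      then show "AE g in gauss I. norm (?f g i * ?g g j) \<le> 1 * 1" by (intro always_eventually allI)
    qed (intro borel_measurable_times m)
    have \<rho>: "0 \<le> \<tau>\<^sup>2 / (1 + \<tau>\<^sup>2)" "\<tau>\<^sup>2 / (1 + \<tau>\<^sup>2) \<le> 1" by (auto simp: divide_le_eq add_pos_nonneg)
    have E: "(LINT g|gauss I. ?f g i * ?g g j) = 2 / pi * arcsin (\<tau>\<^sup>2 / (1 + \<tau>\<^sup>2) * M i j)" for i j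
    proof -
      have "\<bar>\<tau>\<^sup>2 / (1 + \<tau>\<^sup>2) * M i j\<bar> \<le> 1 * 1" unfolding abs_mult using \<rho> Mb[of i j] by (intro mult_mono) auto
      then have "(\<Sum>k. arcsin_coeff k * (\<tau>\<^sup>2 / (1 + \<tau>\<^sup>2) * M i j) ^ (2*k+1)) = arcsin (\<tau>\<^sup>2 / (1 + \<tau>\<^sup>2) * M i j)"
        by (intro sums_unique[symmetric] arcsin_series) simp
      then show ?thesis using expectation_smooth_sign_smooth_sign[OF I u v Meq Mb \<tau>] by simp
    qed
    have "pairing a m n (\<lambda>i j. 2 / pi * arcsin (\<tau>\<^sup>2 / (1 + \<tau>\<^sup>2) * M i j)) = (LINT g|gauss I. pairing a m n (\<lambda>i j. ?f g i * ?g g j))"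
      unfolding pairing_def E[symmetric] using int by simp
    also have "\<dots> \<le> (LINT g|gauss I. \<beta>)"
    proof (rule integral_mono)
      show "integrable (gauss I) (\<lambda>g. pairing a m n (\<lambda>i j. ?f g i * ?g g j))"
        unfolding pairing_def using int by (intro Bochner_Integration.integrable_sum integrable_mult_right)
      show "pairing a m n (\<lambda>i j. ?f g i * ?g g j) \<le> \<beta>" for g
        by (rule \<beta>[unfolded bilinear_bound_def, rule_format]) (rule abs_smooth_sign_le_1)+
    qed simp
    finally show ?thesis by (simp add: P.prob_space)
  qed
  show ?thesis
  proof (rule tendsto_upperbound[OF pairing_tendsto])
    show "\<forall>\<^sub>F k in sequentially. pairing a m n (\<lambda>i j. 2 / pi * arcsin ((real (Suc k))\<^sup>2 / (1 + (real (Suc k))\<^sup>2) * M i j)) \<le> \<beta>"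
      by (intro always_eventually allI le) simp
    fix i j
    have "(\<lambda>k. (real (Suc k))\<^sup>2 / (1 + (real (Suc k))\<^sup>2)) \<longlonglongrightarrow> 1" by real_asymp
    then have "(\<lambda>k. (real (Suc k))\<^sup>2 / (1 + (real (Suc k))\<^sup>2) * M i j) \<longlonglongrightarrow> 1 * M i j"
      by (intro tendsto_mult tendsto_const)
    moreover have "(real (Suc k))\<^sup>2 / (1 + (real (Suc k))\<^sup>2) * M i j \<in> {-1..1}" for k
    proof -
      have "\<bar>(real (Suc k))\<^sup>2 / (1 + (real (Suc k))\<^sup>2) * M i j\<bar> \<le> 1 * 1"
        unfolding abs_mult using Mb[of i j] by (intro mult_mono) (auto simp: divide_le_eq add_pos_nonneg)
      then show ?thesis unfolding atLeastAtMost_iff by linarith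
    qed
    ultimately have "(\<lambda>k. arcsin ((real (Suc k))\<^sup>2 / (1 + (real (Suc k))\<^sup>2) * M i j)) \<longlonglongrightarrow> arcsin (M i j)"
      using Mb[of i j] by (intro continuous_on_tendsto_compose[OF continuous_on_arcsin']) (auto simp: abs_le_iff)
    then show "(\<lambda>k. 2 / pi * arcsin ((real (Suc k))\<^sup>2 / (1 + (real (Suc k))\<^sup>2) * M i j)) \<longlonglongrightarrow> 2 / pi * arcsin (M i j)"
      by (intro tendsto_mult tendsto_const)
  qed simp
qed

lemma arcsin_rounding:
  assumes \<beta>: "bilinear_bound a m n \<beta>" and M: "M \<in> gram_closure"
  shows "pairing a m n (\<lambda>i j. 2 / pi * arcsin (M i j)) \<le> \<beta>"
proof -
  obtain S where S: "\<And>k. S k \<in> gram_matrices" "\<And>i j. (\<lambda>k. S k i j) \<longlonglongrightarrow> M i j"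
    using M unfolding gram_closure_seq by blast
  show ?thesis
  proof (rule tendsto_upperbound[OF pairing_tendsto])
    show "\<forall>\<^sub>F k in sequentially. pairing a m n (\<lambda>i j. 2 / pi * arcsin (S k i j)) \<le> \<beta>"
      by (intro always_eventually allI arcsin_rounding_gram[OF \<beta>] S)
    show "(\<lambda>k. 2 / pi * arcsin (S k i j)) \<longlonglongrightarrow> 2 / pi * arcsin (M i j)" for i j
      using S(2) gram_bound[OF S(1)] gram_closure_bound[OF M, of i j]
      by (intro tendsto_mult tendsto_const continuous_on_tendsto_compose[OF continuous_on_arcsin']) (auto simp: abs_le_iff)
  qed simp
qed

text \<open>Take maximising signs. A bilinear form does not decrease when first \<open>f\<close> and then \<open>g\<close> is replaced by the signs of
  its coefficients.\<close>

lemma sign_bilinear_bound: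
  "\<exists>\<epsilon> \<delta> :: nat \<Rightarrow> real. (\<forall>i. \<epsilon> i \<in> {-1, 1}) \<and> (\<forall>j. \<delta> j \<in> {-1, 1}) \<and>
     bilinear_bound a m n (pairing a m n (\<lambda>i j. \<epsilon> i * \<delta> j))"
proof -
  \<comment> \<open>Signs outside the range of the sum are fixed to 1, which makes the set of sign vectors finite.\<close>
  define Sg where "Sg k = {f :: nat \<Rightarrow> real. (\<forall>i. f i \<in> {-1, 1}) \<and> (\<forall>i\<ge>k. f i = 1)}" for k
  define V where "V = (\<lambda>(\<epsilon>, \<delta>). pairing a m n (\<lambda>i j. \<epsilon> i * \<delta> j)) ` (Sg m \<times> Sg n)"
  have finSg: "finite (Sg k)" for k
  proof (rule finite_subset)
    show "Sg k \<subseteq> (\<lambda>A i. if i \<in> A then 1 else -1) ` {A. {k..} \<subseteq> A}"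
    proof
      fix f assume f: "f \<in> Sg k"
      then have "f = (\<lambda>i. if i \<in> {i. f i = 1} then 1 else -1)" "{k..} \<subseteq> {i. f i = 1}" by (auto simp: Sg_def fun_eq_iff)
      then show "f \<in> (\<lambda>A i. if i \<in> A then 1 else -1) ` {A. {k..} \<subseteq> A}" by blast
    qed
    have "{A. {k..} \<subseteq> A} \<subseteq> (\<lambda>B. B \<union> {k..}) ` Pow {..<k}"
    proof
      fix A assume "A \<in> {A. {k..} \<subseteq> A}"
      then have "A = (A \<inter> {..<k}) \<union> {k..}" by auto
      then show "A \<in> (\<lambda>B. B \<union> {k..}) ` Pow {..<k}" by blast
    qed
    then have "finite {A. {k..} \<subseteq> A}" by (rule finite_subset) simp
    then show "finite ((\<lambda>A i. if i \<in> A then 1 else -1 :: real) ` {A. {k..} \<subseteq> A})" by simp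
  qed
  have finV: "finite V" "V \<noteq> {}"
  proof -
    show "finite V" unfolding V_def using finSg by simp
    have "(\<lambda>_. 1) \<in> Sg k" for k by (simp add: Sg_def)
    then show "V \<noteq> {}" unfolding V_def by blast
  qed
  obtain \<epsilon> \<delta> where ed: "\<epsilon> \<in> Sg m" "\<delta> \<in> Sg n" "Max V = pairing a m n (\<lambda>i j. \<epsilon> i * \<delta> j)"
    using Max_in[OF finV] unfolding V_def by auto
  have "bilinear_bound a m n (Max V)" unfolding bilinear_bound_def
  proof (intro allI impI)
    fix f g :: "nat \<Rightarrow> real" assume f: "\<forall>i. \<bar>f i\<bar> \<le> 1" and g: "\<forall>j. \<bar>g j\<bar> \<le> 1"
    define sgn' where "sgn' x = (if x < 0 then -1 else 1 :: real)" for x :: real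
    have key: "x * s \<le> sgn' s * s" if "\<bar>x\<bar> \<le> 1" for x s
    proof -
      have "x * s \<le> \<bar>x\<bar> * \<bar>s\<bar>" by (rule mult_le_abs_mult)
      also have "\<dots> \<le> 1 * \<bar>s\<bar>" using that by (intro mult_right_mono) auto
      finally show ?thesis by (auto simp: sgn'_def)
    qed
    define e where "e i = (if i < m then sgn' (\<Sum>j<n. a i j * g j) else 1)" for i
    define d where "d j = (if j < n then sgn' (\<Sum>i<m. a i j * e i) else 1)" for j
    have eS: "e \<in> Sg m" "d \<in> Sg n" by (auto simp: Sg_def e_def d_def sgn'_def)
    have "pairing a m n (\<lambda>i j. f i * g j) = (\<Sum>i<m. f i * (\<Sum>j<n. a i j * g j))"
      unfolding pairing_def by (simp add: sum_distrib_left mult_ac)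
    also have "\<dots> \<le> (\<Sum>i<m. e i * (\<Sum>j<n. a i j * g j))"
      using f by (intro sum_mono) (auto simp: e_def intro: key)
    also have "\<dots> = (\<Sum>j<n. g j * (\<Sum>i<m. a i j * e i))"
      unfolding sum_distrib_left by (subst sum.swap) (simp add: mult_ac)
    also have "\<dots> \<le> (\<Sum>j<n. d j * (\<Sum>i<m. a i j * e i))"
      using g by (intro sum_mono) (auto simp: d_def intro: key)
    also have "\<dots> = pairing a m n (\<lambda>i j. e i * d j)"
      unfolding pairing_def sum_distrib_left by (subst sum.swap) (simp add: mult_ac)
    also have "\<dots> \<le> Max V"
    proof (rule Max_ge[OF finV(1)])
      show "pairing a m n (\<lambda>i j. e i * d j) \<in> V"
        unfolding V_def using eS by (intro image_eqI[of _ _ "(e, d)"]) auto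
    qed
    finally show "pairing a m n (\<lambda>i j. f i * g j) \<le> Max V" .
  qed
  then show ?thesis using ed unfolding Sg_def by auto
qed

section \<open>Random rotation angles\<close>

text \<open>The index \<open>s\<close> runs over two independent copies of the product of two Gaussian projections. One copy would give the
  square root of the rational function in \<open>expectation_cos_chaos\<close>.\<close>

definition chaos :: "'k set \<Rightarrow> ('k \<Rightarrow> real) \<Rightarrow> ('k \<times> bool \<Rightarrow> real) \<times> ('k \<times> bool \<Rightarrow> real) \<Rightarrow> real" where
  "chaos I w p = (\<Sum>s\<in>UNIV. (\<Sum>k\<in>I. fst p (k, s) * w k) * (\<Sum>k\<in>I. snd p (k, s) * w k))"

definition gauss_pair :: "'k set \<Rightarrow> (('k \<times> bool \<Rightarrow> real) \<times> ('k \<times> bool \<Rightarrow> real)) measure" where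
  "gauss_pair I = gauss (I \<times> UNIV) \<Otimes>\<^sub>M gauss (I \<times> UNIV)"

lemma prob_space_gauss_pair: "prob_space (gauss_pair I)"
proof -
  interpret G: prob_space "gauss (I \<times> (UNIV :: bool set))" by (rule prob_space_gauss)
  interpret pair_prob_space "gauss (I \<times> (UNIV :: bool set))" "gauss (I \<times> (UNIV :: bool set))" ..
  show ?thesis unfolding gauss_pair_def by unfold_locales
qed

lemma measurable_pair_component:
  shows "x \<in> J \<Longrightarrow> (\<lambda>p. fst p x) \<in> borel_measurable (gauss J \<Otimes>\<^sub>M N)"
    and "y \<in> K \<Longrightarrow> (\<lambda>p. snd p y) \<in> borel_measurable (N' \<Otimes>\<^sub>M gauss K)"
proof -
  show "(\<lambda>p. fst p x) \<in> borel_measurable (gauss J \<Otimes>\<^sub>M N)" if "x \<in> J"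
    by (rule measurable_compose[OF measurable_fst measurable_gauss_component[OF that]])
  show "(\<lambda>p. snd p y) \<in> borel_measurable (N' \<Otimes>\<^sub>M gauss K)" if "y \<in> K"
    by (rule measurable_compose[OF measurable_snd measurable_gauss_component[OF that]])
qed

lemma measurable_chaos: "chaos I w \<in> borel_measurable (gauss_pair I)"
  unfolding chaos_def[abs_def] gauss_pair_def
proof (rule borel_measurable_sum)
  fix s :: bool
  have 1: "(\<lambda>p. fst p (k, s) * w k) \<in> borel_measurable (gauss (I \<times> UNIV) \<Otimes>\<^sub>M gauss (I \<times> UNIV))"
    and 2: "(\<lambda>p. snd p (k, s) * w k) \<in> borel_measurable (gauss (I \<times> UNIV) \<Otimes>\<^sub>M gauss (I \<times> UNIV))"
    if "k \<in> I" for k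
    using that by (auto intro!: borel_measurable_times measurable_pair_component)
  show "(\<lambda>p. (\<Sum>k\<in>I. fst p (k, s) * w k) * (\<Sum>k\<in>I. snd p (k, s) * w k)) \<in> borel_measurable (gauss (I \<times> UNIV) \<Otimes>\<^sub>M gauss (I \<times> UNIV))"
    using borel_measurable_times[OF borel_measurable_sum[of I, OF 1] borel_measurable_sum[of I, OF 2]] .
qed

lemma measurable_cos_comp: "f \<in> borel_measurable M \<Longrightarrow> (\<lambda>x. cos (f x :: real)) \<in> borel_measurable M"
proof -
  assume f: "f \<in> borel_measurable M"
  have "(cos :: real \<Rightarrow> real) \<in> borel_measurable borel"
    by (intro borel_measurable_continuous_onI continuous_on_cos continuous_on_id)
  with f show ?thesis by (rule measurable_compose)
qed

text \<open>Write \<open>a\<close> and \<open>b\<close> for the projections of the vector \<open>h\<close> to \<open>u\<close> and \<open>v\<close>. Integrating out the other vector gives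
  \<open>exp (- l\<^sup>2 / 2 * q)\<close> with \<open>q = a\<^sup>2 + b\<^sup>2 + 2 * t * a * b = (1 + t) / 2 * (a + b)\<^sup>2 + (1 - t) / 2 * (a - b)\<^sup>2\<close>
  for each copy. This is in turn a characteristic function in auxiliary Gaussian variables \<open>x\<close>. As
  \<open>u + v\<close> and \<open>u - v\<close> are orthogonal with squared lengths \<open>2 * (1 + t)\<close> and \<open>2 * (1 - t)\<close>, integrating over \<open>h\<close>
  leaves a product of one-dimensional Gaussian integrals in \<open>x\<close>.\<close>

lemma expectation_cos_chaos:
  fixes u v :: "'k \<Rightarrow> real"
  assumes I: "finite I" and u: "(\<Sum>k\<in>I. (u k)\<^sup>2) = 1" and v: "(\<Sum>k\<in>I. (v k)\<^sup>2) = 1"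
    and t: "t = (\<Sum>k\<in>I. u k * v k)" "\<bar>t\<bar> \<le> 1"
  shows "(LINT p|gauss_pair I. cos (l * (chaos I u p + chaos I v p))) =
    1 / ((1 + l\<^sup>2 * (1 + t)\<^sup>2) * (1 + l\<^sup>2 * (1 - t)\<^sup>2))"
proof -
  let ?J = "I \<times> (UNIV :: bool set)" and ?K = "(UNIV :: (bool \<times> bool) set)"
  interpret G: prob_space "gauss ?J" by (rule prob_space_gauss)
  interpret X: prob_space "gauss ?K" by (rule prob_space_gauss)
  interpret GG: pair_prob_space "gauss ?J" "gauss ?J" ..
  interpret GX: pair_prob_space "gauss ?J" "gauss ?K" ..
  have fJ: "finite ?J" using I by simp
  define a where "a h s = (\<Sum>k\<in>I. h (k, s) * u k)" for h :: "'k \<times> bool \<Rightarrow> real" and s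
  define b where "b h s = (\<Sum>k\<in>I. h (k, s) * v k)" for h :: "'k \<times> bool \<Rightarrow> real" and s
  \<comment> \<open>The flag \<open>e\<close> selects the sum or the difference of the two directions, that is, an eigenspace of
    the correlation matrix.\<close>
  define c where "c e = (if e then sqrt ((1 + t) / 2) else sqrt ((1 - t) / 2))" for e
  define d where "d e x y = (if e then x + y else x - y :: real)" for e and x y :: real
  define \<kappa> where "\<kappa> e = (if e then l\<^sup>2 * (1 + t)\<^sup>2 else l\<^sup>2 * (1 - t)\<^sup>2)" for e
  let ?V = "\<lambda>h y. l * (c (snd y) * d (snd y) (a h (fst y)) (b h (fst y)))"
  let ?W = "\<lambda>x z. l * (\<Sum>e\<in>UNIV. x (snd z, e) * c e * d e (u (fst z)) (v (fst z)))"
  have csq: "(c True)\<^sup>2 = (1 + t) / 2" "(c False)\<^sup>2 = (1 - t) / 2" using t(2) by (auto simp: c_def)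
  have sumJ: "(\<Sum>x\<in>?J. f x) = (\<Sum>s\<in>UNIV. \<Sum>k\<in>I. f (k, s))" for f :: "'k \<times> bool \<Rightarrow> real"
    unfolding sum.cartesian_product' by (rule sum.swap)
  have sumK: "(\<Sum>x\<in>?K. f x) = (\<Sum>s\<in>UNIV. \<Sum>e\<in>UNIV. f (s, e))" for f :: "bool \<times> bool \<Rightarrow> real"
    unfolding UNIV_Times_UNIV[symmetric] by (rule sum.cartesian_product')
  have inner: "(LINT g|gauss ?J. cos (l * (chaos I u (h, g) + chaos I v (h, g)))) =
      (LINT x|gauss ?K. cos (\<Sum>y\<in>?K. (?V h y) * x y))" for h
  proof -
    have lin: "l * (chaos I u (h, g) + chaos I v (h, g)) = (\<Sum>x\<in>?J. (l * (a h (snd x) * u (fst x) + b h (snd x) * v (fst x))) * g x)" for g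
    proof -
      have "chaos I u (h, g) = (\<Sum>s\<in>UNIV. a h s * (\<Sum>k\<in>I. g (k, s) * u k))"
        "chaos I v (h, g) = (\<Sum>s\<in>UNIV. b h s * (\<Sum>k\<in>I. g (k, s) * v k))"
        unfolding chaos_def a_def b_def by simp_all
      then show ?thesis unfolding sumJ fst_conv snd_conv
        by (simp add: sum_distrib_left sum.distrib sum_distrib_right distrib_left distrib_right mult_ac)
    qed
    have eq: "(\<Sum>x\<in>?J. (l * (a h (snd x) * u (fst x) + b h (snd x) * v (fst x)))\<^sup>2) =
       (\<Sum>y\<in>?K. (?V h y)\<^sup>2)"
      unfolding sumJ sumK fst_conv snd_conv
    proof (rule sum.cong)
      fix s :: bool
      have "(\<Sum>k\<in>I. (l * (a h s * u k + b h s * v k))\<^sup>2) = (\<Sum>k\<in>I. l\<^sup>2 * ((a h s)\<^sup>2 * (u k)\<^sup>2 + (b h s)\<^sup>2 * (v k)\<^sup>2 + 2 * a h s * b h s * (u k * v k)))"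
        by (intro sum.cong) (auto simp: power2_eq_square algebra_simps)
      also have "\<dots> = l\<^sup>2 * ((a h s)\<^sup>2 + (b h s)\<^sup>2 + 2 * a h s * b h s * t)"
        by (simp add: sum_distrib_left[symmetric] sum.distrib u v t(1))
      also have "\<dots> = (\<Sum>e\<in>UNIV. (l * (c e * d e (a h s) (b h s)))\<^sup>2)"
        by (simp add: UNIV_bool power_mult_distrib csq d_def) (simp add: power2_eq_square field_simps)
      finally show "(\<Sum>k\<in>I. (l * (a h s * u k + b h s * v k))\<^sup>2) = (\<Sum>e\<in>UNIV. (l * (c e * d e (a h s) (b h s)))\<^sup>2)" .
    qed simp
    show ?thesis unfolding lin integral_gauss_cos[OF fJ] eq by (subst integral_gauss_cos) auto
  qed
  have meas1: "(\<lambda>p. cos (l * (chaos I u p + chaos I v p))) \<in> borel_measurable (gauss_pair I)"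
    by (intro measurable_cos_comp borel_measurable_times borel_measurable_add borel_measurable_const measurable_chaos)
  have int1: "integrable (gauss ?J \<Otimes>\<^sub>M gauss ?J) (\<lambda>p. cos (l * (chaos I u p + chaos I v p)))"
    by (rule GG.P.integrable_const_bound[where B=1], simp) (rule meas1[unfolded gauss_pair_def])
  have lin2: "(\<Sum>y\<in>?K. (?V h y) * x y) =
     (\<Sum>z\<in>?J. (?W x z) * h z)" for h and x :: "bool \<times> bool \<Rightarrow> real"
  proof -
    have dlin: "d e (\<Sum>k\<in>I. h (k, s) * u k) (\<Sum>k\<in>I. h (k, s) * v k) = (\<Sum>k\<in>I. h (k, s) * d e (u k) (v k))" for e s
      by (simp add: d_def sum.distrib[symmetric] sum_subtractf[symmetric] algebra_simps)
    show ?thesis unfolding sumJ sumK fst_conv snd_conv a_def b_def dlin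
    proof (rule sum.cong)
      fix s :: bool
      have "(\<Sum>e\<in>UNIV. l * (c e * (\<Sum>k\<in>I. h (k, s) * d e (u k) (v k))) * x (s, e)) =
         (\<Sum>e\<in>UNIV. \<Sum>k\<in>I. l * (x (s, e) * c e * d e (u k) (v k)) * h (k, s))"
        by (simp add: sum_distrib_left sum_distrib_right mult_ac)
      also have "\<dots> = (\<Sum>k\<in>I. \<Sum>e\<in>UNIV. l * (x (s, e) * c e * d e (u k) (v k)) * h (k, s))" by (rule sum.swap)
      finally show "(\<Sum>e\<in>UNIV. l * (c e * (\<Sum>k\<in>I. h (k, s) * d e (u k) (v k))) * x (s, e)) =
        (\<Sum>k\<in>I. l * (\<Sum>e\<in>UNIV. x (s, e) * c e * d e (u k) (v k)) * h (k, s))"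
        by (simp add: sum_distrib_left sum_distrib_right)
    qed simp
  qed
  have meas2: "(\<lambda>p. cos (\<Sum>z\<in>?J. (l * (\<Sum>e\<in>UNIV. snd p (snd z, e) * c e * d e (u (fst z)) (v (fst z)))) * fst p z))
      \<in> borel_measurable (gauss ?J \<Otimes>\<^sub>M gauss ?K)"
  proof (rule measurable_cos_comp, rule borel_measurable_sum, rule borel_measurable_times)
    fix z assume z: "z \<in> ?J"
    show "(\<lambda>p. fst p z) \<in> borel_measurable (gauss ?J \<Otimes>\<^sub>M gauss ?K)"
      using z by (rule measurable_pair_component)
    have "(\<lambda>p. snd p (snd z, e) * c e * d e (u (fst z)) (v (fst z))) \<in> borel_measurable (gauss ?J \<Otimes>\<^sub>M gauss ?K)" for e
      by (rule borel_measurable_times[OF borel_measurable_times[OF measurable_pair_component(2)[OF UNIV_I]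
             borel_measurable_const] borel_measurable_const])
    then show "(\<lambda>p. l * (\<Sum>e\<in>UNIV. snd p (snd z, e) * c e * d e (u (fst z)) (v (fst z)))) \<in> borel_measurable (gauss ?J \<Otimes>\<^sub>M gauss ?K)"
      by (rule borel_measurable_times[OF borel_measurable_const borel_measurable_sum])
  qed
  have int2: "integrable (gauss ?J \<Otimes>\<^sub>M gauss ?K) (\<lambda>(h, x). cos (\<Sum>z\<in>?J. (?W x z) * h z))"
    unfolding split_beta by (rule GX.P.integrable_const_bound[where B=1], simp) (rule meas2)
  have outer: "(LINT h|gauss ?J. cos (\<Sum>z\<in>?J. (?W x z) * h z)) =
     (\<Prod>y\<in>?K. exp (- \<kappa> (snd y) * (x y)\<^sup>2 / 2))" for x :: "bool \<times> bool \<Rightarrow> real"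
  proof -
    have "(\<Sum>z\<in>?J. (?W x z)\<^sup>2) = (\<Sum>y\<in>?K. \<kappa> (snd y) * (x y)\<^sup>2)"
      unfolding sumJ sumK fst_conv snd_conv
    proof (rule sum.cong)
      fix s :: bool
      define p where "p = x (s, True) * c True" define q where "q = x (s, False) * c False"
      have "(\<Sum>k\<in>I. (l * (\<Sum>e\<in>UNIV. x (s, e) * c e * d e (u k) (v k)))\<^sup>2) =
         (\<Sum>k\<in>I. l\<^sup>2 * ((p + q)\<^sup>2 * (u k)\<^sup>2 + (p - q)\<^sup>2 * (v k)\<^sup>2 + 2 * (p + q) * (p - q) * (u k * v k)))"
      proof (rule sum.cong)
        fix k
        have pq: "(\<Sum>e\<in>UNIV. x (s, e) * c e * d e (u k) (v k)) = (p + q) * u k + (p - q) * v k"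
          by (simp add: UNIV_bool d_def p_def q_def algebra_simps)
        show "(l * (\<Sum>e\<in>UNIV. x (s, e) * c e * d e (u k) (v k)))\<^sup>2 =
            l\<^sup>2 * ((p + q)\<^sup>2 * (u k)\<^sup>2 + (p - q)\<^sup>2 * (v k)\<^sup>2 + 2 * (p + q) * (p - q) * (u k * v k))"
          unfolding pq by (simp add: power2_eq_square algebra_simps)
      qed simp
      also have "\<dots> = l\<^sup>2 * ((p + q)\<^sup>2 + (p - q)\<^sup>2 + 2 * (p + q) * (p - q) * t)"
        by (simp add: sum_distrib_left[symmetric] sum.distrib u v t(1))
      also have "\<dots> = l\<^sup>2 * (p\<^sup>2 * (2 * (1 + t)) + q\<^sup>2 * (2 * (1 - t)))" by (simp add: power2_eq_square algebra_simps)
      also have "\<dots> = (\<Sum>e\<in>UNIV. \<kappa> e * (x (s, e))\<^sup>2)"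
        unfolding p_def q_def power_mult_distrib csq by (simp add: UNIV_bool \<kappa>_def power2_eq_square field_simps)
      finally show "(\<Sum>k\<in>I. (l * (\<Sum>e\<in>UNIV. x (s, e) * c e * d e (u k) (v k)))\<^sup>2) = (\<Sum>e\<in>UNIV. \<kappa> e * (x (s, e))\<^sup>2)" .
    qed simp
    then show ?thesis unfolding integral_gauss_cos[OF fJ]
      by (simp add: exp_sum[symmetric] sum_negf sum_divide_distrib)
  qed
  have k0: "0 \<le> \<kappa> e" for e by (simp add: \<kappa>_def)
  have fin: "(LINT x|gauss ?K. (\<Prod>y\<in>?K. exp (- \<kappa> (snd y) * (x y)\<^sup>2 / 2))) = (\<Prod>y\<in>?K. 1 / sqrt (1 + \<kappa> (snd y)))"
  proof -
    have m: "has_bochner_integral std_normal_distribution (\<lambda>z. exp (- \<kappa> e * z\<^sup>2 / 2)) (1 / sqrt (1 + \<kappa> e))" for e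
      using std_normal_gauss_moment[OF k0[of e], of 0] by simp
    have "(LINT x|gauss ?K. (\<Prod>y\<in>?K. exp (- \<kappa> (snd y) * (x y)\<^sup>2 / 2))) = (\<Prod>y\<in>?K. (LINT z|std_normal_distribution. exp (- \<kappa> (snd y) * z\<^sup>2 / 2)))"
      by (rule gauss_prod(1)[where f="\<lambda>y z. exp (- \<kappa> (snd y) * z\<^sup>2 / 2)"]) (use m in \<open>auto simp: has_bochner_integral_iff\<close>)
    then show ?thesis using m by (simp add: has_bochner_integral_iff)
  qed
  have "(LINT p|gauss_pair I. cos (l * (chaos I u p + chaos I v p))) =
     (LINT h|gauss ?J. LINT g|gauss ?J. cos (l * (chaos I u (h, g) + chaos I v (h, g))))"
    unfolding gauss_pair_def by (rule GG.integral_fst'[OF int1, symmetric])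
  also have "\<dots> = (LINT h|gauss ?J. LINT x|gauss ?K. cos (\<Sum>z\<in>?J. (?W x z) * h z))"
    unfolding inner lin2 ..
  also have "\<dots> = (LINT x|gauss ?K. LINT h|gauss ?J. cos (\<Sum>z\<in>?J. (?W x z) * h z))"
    by (rule GX.Fubini_integral[OF int2, symmetric])
  also have "\<dots> = (\<Prod>y\<in>?K. 1 / sqrt (1 + \<kappa> (snd y)))" unfolding outer fin ..
  also have "\<dots> = 1 / ((1 + \<kappa> True) * (1 + \<kappa> False))"
  proof -
    have K: "?K = {(True, True), (True, False), (False, True), (False, False)}" by auto
    have "sqrt (1 + \<kappa> e) * sqrt (1 + \<kappa> e) = 1 + \<kappa> e" for e using k0[of e] by simp
    then have "sqrt (1 + \<kappa> True) * (sqrt (1 + \<kappa> False) * (sqrt (1 + \<kappa> True) * sqrt (1 + \<kappa> False))) = (1 + \<kappa> True) * (1 + \<kappa> False)"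
      by (metis mult.assoc mult.left_commute)
    then show ?thesis unfolding K by simp
  qed
  finally show ?thesis by (simp add: \<kappa>_def)
qed

text \<open>The expectation of \<open>\<phi>\<close> at the sum of the two quadratic forms depends on the inner product only, through the
  power series \<open>f\<close>, and the value of that series at \<open>\<i>\<close> is an integral of \<open>\<phi>\<close> against a signed density. Formally, at
  correlation \<open>\<i>\<close> the sum behaves like \<open>2 * y\<close> where \<open>y\<close> has the signed density
  \<open>exp (- y) * (cos y + sin y)\<close> on the half-line.\<close>

definition chaos_series :: "(real \<Rightarrow> real) \<Rightarrow> (real \<Rightarrow> real) \<Rightarrow> bool" where
  "chaos_series \<phi> f \<longleftrightarrow> wiener f (of_real (LINT y|exp_dist. \<phi> (2 * y) * (cos y + sin y))) \<and>
     (\<forall>t. \<bar>t\<bar> \<le> 1 \<longrightarrow> f (- t) = f t) \<and>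
     (\<forall>(I :: nat set) u v. finite I \<longrightarrow> (\<Sum>k\<in>I. (u k)\<^sup>2) = 1 \<longrightarrow> (\<Sum>k\<in>I. (v k)\<^sup>2) = 1 \<longrightarrow> \<bar>\<Sum>k\<in>I. u k * v k\<bar> \<le> 1 \<longrightarrow>
        (LINT p|gauss_pair I. \<phi> (chaos I u p + chaos I v p)) = f (\<Sum>k\<in>I. u k * v k))"

lemma chaos_series_cos:
  "chaos_series (\<lambda>x. cos (l * x)) (\<lambda>t. 1 / ((1 + l\<^sup>2 * (1 + t)\<^sup>2) * (1 + l\<^sup>2 * (1 - t)\<^sup>2)))"
proof -
  have "(LINT y|exp_dist. cos (l * (2 * y)) * (cos y + sin y)) = 1 / (1 + 4 * l ^ 4)"
    using integral_exp_dist_cos[of "2 * l"] by (simp add: mult_ac power_mult_distrib)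
  then have "wiener (\<lambda>t. 1 / ((1 + l\<^sup>2 * (1 + t)\<^sup>2) * (1 + l\<^sup>2 * (1 - t)\<^sup>2)))
      (of_real (LINT y|exp_dist. cos (l * (2 * y)) * (cos y + sin y)))"
    using wiener_rational[of l] by simp
  moreover have "1 / ((1 + l\<^sup>2 * (1 + - t)\<^sup>2) * (1 + l\<^sup>2 * (1 - - t)\<^sup>2)) = 1 / ((1 + l\<^sup>2 * (1 + t)\<^sup>2) * (1 + l\<^sup>2 * (1 - t)\<^sup>2))" for t
    by (simp add: mult.commute)
  ultimately show ?thesis unfolding chaos_series_def
    using expectation_cos_chaos[OF _ _ _ refl] by blast
qed

lemma integrable_chaos:
  fixes \<phi> :: "real \<Rightarrow> real"
  assumes "continuous_on UNIV \<phi>" "\<And>x. \<bar>\<phi> x\<bar> \<le> 1"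
  shows "integrable (gauss_pair I) (\<lambda>p. \<phi> (chaos I u p + chaos I v p))"
proof -
  interpret P: prob_space "gauss_pair I" by (rule prob_space_gauss_pair)
  show ?thesis
  proof (rule P.integrable_const_bound[where B=1])
    show "AE p in gauss_pair I. norm (\<phi> (chaos I u p + chaos I v p)) \<le> 1"
      unfolding real_norm_def by (intro always_eventually allI assms)
    show "(\<lambda>p. \<phi> (chaos I u p + chaos I v p)) \<in> borel_measurable (gauss_pair I)"
      by (rule measurable_compose[OF borel_measurable_add[OF measurable_chaos measurable_chaos]
            borel_measurable_continuous_onI[OF assms(1)]])
  qed
qed

lemma integrable_exp_dist_weight:
  fixes \<phi> :: "real \<Rightarrow> real"
  assumes "continuous_on UNIV \<phi>" "\<And>x. \<bar>\<phi> x\<bar> \<le> C"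
  shows "integrable exp_dist (\<lambda>y. \<phi> (2 * y) * (cos y + sin y))"
proof (rule exp_dist_integrable_bounded)
  have "0 \<le> C" using order_trans[OF abs_ge_zero assms(2)] .
  then show "\<bar>\<phi> (2 * y) * (cos y + sin y)\<bar> \<le> C * 2" for y
    unfolding abs_mult by (intro mult_mono assms abs_cos_sin_le) auto
  have "continuous_on UNIV (\<lambda>y. \<phi> (2 * y))"
    by (rule continuous_on_compose2[OF assms(1)]) (auto intro!: continuous_intros)
  then show "(\<lambda>y. \<phi> (2 * y) * (cos y + sin y)) \<in> borel_measurable borel"
    by (intro borel_measurable_continuous_onI continuous_intros)
qed

lemma chaos_series_mean:
  assumes f: "chaos_series \<phi> f" "continuous_on UNIV \<phi>" "\<And>x. \<bar>\<phi> x\<bar> \<le> 1"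
    and g: "chaos_series \<psi> g" "continuous_on UNIV \<psi>" "\<And>x. \<bar>\<psi> x\<bar> \<le> 1"
  shows "chaos_series (\<lambda>x. 1/2 * \<phi> x + 1/2 * \<psi> x) (\<lambda>t. 1/2 * f t + 1/2 * g t)"
  unfolding chaos_series_def
proof (intro conjI allI impI)
  have "(LINT y|exp_dist. (1/2 * \<phi> (2 * y) + 1/2 * \<psi> (2 * y)) * (cos y + sin y)) =
     1/2 * (LINT y|exp_dist. \<phi> (2 * y) * (cos y + sin y)) + 1/2 * (LINT y|exp_dist. \<psi> (2 * y) * (cos y + sin y))"
    unfolding distrib_right[of "1/2 * _"] mult.assoc[of "1/2"]
    by (subst Bochner_Integration.integral_add)
       (intro integrable_mult_right integrable_exp_dist_weight[OF f(2,3)],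
        intro integrable_mult_right integrable_exp_dist_weight[OF g(2,3)], simp only: integral_mult_right_zero)
  then show "wiener (\<lambda>t. 1/2 * f t + 1/2 * g t) (of_real (LINT y|exp_dist. (1/2 * \<phi> (2 * y) + 1/2 * \<psi> (2 * y)) * (cos y + sin y)))"
    using wiener_lincomb[of f _ g _ "1/2" "1/2"] f(1) g(1) unfolding chaos_series_def
    by (simp only: of_real_add of_real_mult)
  show "1/2 * f (- t) + 1/2 * g (- t) = 1/2 * f t + 1/2 * g t" if "\<bar>t\<bar> \<le> 1" for t
    using f(1) g(1) that unfolding chaos_series_def by simp
  fix I :: "nat set" and u v :: "nat \<Rightarrow> real"
  assume *: "finite I" "(\<Sum>k\<in>I. (u k)\<^sup>2) = 1" "(\<Sum>k\<in>I. (v k)\<^sup>2) = 1" "\<bar>\<Sum>k\<in>I. u k * v k\<bar> \<le> 1"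
  have "(LINT p|gauss_pair I. \<phi> (chaos I u p + chaos I v p)) = f (\<Sum>k\<in>I. u k * v k)"
    "(LINT p|gauss_pair I. \<psi> (chaos I u p + chaos I v p)) = g (\<Sum>k\<in>I. u k * v k)"
    using f(1) g(1) * unfolding chaos_series_def by blast+
  then show "(LINT p|gauss_pair I. 1/2 * \<phi> (chaos I u p + chaos I v p) + 1/2 * \<psi> (chaos I u p + chaos I v p)) =
      1/2 * f (\<Sum>k\<in>I. u k * v k) + 1/2 * g (\<Sum>k\<in>I. u k * v k)"
    by (subst Bochner_Integration.integral_add)
       (intro integrable_mult_right integrable_chaos f g, intro integrable_mult_right integrable_chaos f g,
        simp only: integral_mult_right_zero)
qed

text \<open>Powers of the cosine are linear combinations of cosines of multiples, by the product formula
  \<open>2 * cos x * cos (m * x) = cos ((m + 1) * x) + cos ((m - 1) * x)\<close>. The additional factor \<open>cos (m * (l * x))\<close> makes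
  the induction go through.\<close>

lemma chaos_series_cos_power: "\<exists>f. chaos_series (\<lambda>x. cos (l * x) ^ n * cos (m * (l * x))) f"
proof (induction n arbitrary: m)
  case 0 then show ?case using chaos_series_cos[of "m * l"] by (auto simp: mult.assoc)
next
  case (Suc n)
  have step: "cos x ^ Suc n * cos (m * x) = 1/2 * (cos x ^ n * cos ((m + 1) * x)) + 1/2 * (cos x ^ n * cos ((m - 1) * x))" for x :: real
    by (simp add: cos_add cos_diff algebra_simps)
  obtain f g where fg: "chaos_series (\<lambda>x. cos (l * x) ^ n * cos ((m + 1) * (l * x))) f"
      "chaos_series (\<lambda>x. cos (l * x) ^ n * cos ((m - 1) * (l * x))) g"
    using Suc[of "m + 1"] Suc[of "m - 1"] by blast
  have "continuous_on UNIV (\<lambda>x. cos (l * x) ^ n * cos (c * (l * x)))" for c by (intro continuous_intros)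
  moreover have "\<bar>cos x ^ n * cos y\<bar> \<le> 1" for x y :: real
    by (auto simp: abs_mult power_abs intro!: mult_le_one power_le_one)
  ultimately show ?case unfolding step using chaos_series_mean[OF fg(1) _ _ fg(2)] by blast
qed

section \<open>The improved bound\<close>

lemma exp_dist_integral_bound:
  fixes h :: "real \<Rightarrow> real"
  assumes "h \<in> borel_measurable borel" "\<And>y. \<bar>h y\<bar> \<le> C"
  shows "\<bar>LINT y|exp_dist. h y\<bar> \<le> C"
proof -
  interpret prob_space exp_dist by (rule prob_space_exp_dist)
  have int: "integrable exp_dist h" by (rule exp_dist_integrable_bounded[OF assms])
  have "(LINT y|exp_dist. h y) \<le> C"
    using int assms(2) by (intro integral_le_const) (auto simp: abs_le_iff intro!: always_eventually)
  moreover have "- C \<le> (LINT y|exp_dist. h y)"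
  proof (rule integral_ge_const[OF int])
    have "- C \<le> h y" for y using assms(2)[of y] by linarith
    then show "AE y in exp_dist. - C \<le> h y" by (intro always_eventually allI)
  qed
  ultimately show ?thesis by (simp add: abs_le_iff)
qed

text \<open>The truncation error is uniform in \<open>x\<close>, by absolute convergence at the boundary.\<close>

lemma arcsin_coeff_tail_bound:
  fixes s x :: real
  assumes s: "\<bar>s\<bar> = 1" and x: "\<bar>x\<bar> \<le> 1" and S: "(\<lambda>k. s ^ k * arcsin_coeff k * x ^ (2*k+1)) sums y"
  shows "\<bar>y - (\<Sum>k<K. s ^ k * arcsin_coeff k * x ^ (2*k+1))\<bar> \<le> (\<Sum>k. arcsin_coeff (k + K))"
proof -
  let ?f = "\<lambda>k. s ^ k * arcsin_coeff k * x ^ (2*k+1)"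
  have le: "norm (?f (k + K)) \<le> arcsin_coeff (k + K)" for k
    unfolding real_norm_def abs_mult power_abs s power_one mult_1 abs_of_pos[OF arcsin_coeff_pos]
    using x arcsin_coeff_pos[of "k + K"] by (intro mult_left_le power_le_one) auto
  have "y = (\<Sum>k. ?f (k + K)) + (\<Sum>k<K. ?f k)"
    using suminf_split_initial_segment[OF sums_summable[OF S], of K] sums_unique[OF S] by simp
  then have "y - (\<Sum>k<K. ?f k) = (\<Sum>k. ?f (k + K))" by simp
  also have "\<bar>\<dots>\<bar> \<le> (\<Sum>k. arcsin_coeff (k + K))"
    using norm_suminf_le[OF le] summable_arcsin_coeff by (simp add: summable_iff_shift)
  finally show ?thesis .
qed

text \<open>The omitted part of the arcsine series has gauge at most the tail of its coefficients.\<close>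

lemma truncated_arcsin_rounding:
  assumes \<beta>: "bilinear_bound a m n \<beta>" and M: "M \<in> gram_matrices"
  shows "pairing a m n (\<lambda>i j. \<Sum>k<K. 2 / pi * arcsin_coeff k * M i j ^ (2*k+1)) \<le>
    \<beta> + 2 / pi * (\<Sum>k. arcsin_coeff (k + K)) * gram_sup a m n"
proof -
  let ?R = "\<lambda>i j. \<Sum>k. arcsin_coeff (k + K) * M i j ^ (2 * (k + K) + 1)"
  have nb: "gram_norm_le (\<Sum>k. arcsin_coeff (k + K)) ?R"
  proof (rule gram_norm_le_suminf)
    show "gram_norm_le (arcsin_coeff (k + K)) (\<lambda>i j. arcsin_coeff (k + K) * M i j ^ (2 * (k + K) + 1))" for k
      using gram_norm_le_scale[OF gram_norm_le_power[OF gram_norm_le_closure[OF gram_subset_closure[OF M]]], of "arcsin_coeff (k + K)" "2 * (k + K) + 1"]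
      by (simp add: abs_of_pos arcsin_coeff_pos)
    show "summable (\<lambda>k. arcsin_coeff (k + K))" using summable_arcsin_coeff by (simp add: summable_iff_shift)
  qed
  have eq: "(\<Sum>k<K. 2 / pi * arcsin_coeff k * M i j ^ (2*k+1)) = 1 * (2 / pi * arcsin (M i j)) + (- (2 / pi)) * ?R i j" for i j
  proof -
    have S: "(\<lambda>k. arcsin_coeff k * M i j ^ (2*k+1)) sums arcsin (M i j)"
      by (rule arcsin_series[OF gram_bound[OF M]])
    have "arcsin (M i j) = ?R i j + (\<Sum>k<K. arcsin_coeff k * M i j ^ (2*k+1))"
      using suminf_split_initial_segment[OF sums_summable[OF S], of K] sums_unique[OF S] by simp
    then show ?thesis by (simp add: sum_distrib_left algebra_simps)
  qed
  have "pairing a m n (\<lambda>i j. \<Sum>k<K. 2 / pi * arcsin_coeff k * M i j ^ (2*k+1)) =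
     1 * pairing a m n (\<lambda>i j. 2 / pi * arcsin (M i j)) + (- (2 / pi)) * pairing a m n ?R"
    unfolding eq by (rule pairing_linear)
  also have "\<dots> \<le> 1 * \<beta> + (2 / pi) * ((\<Sum>k. arcsin_coeff (k + K)) * gram_sup a m n)"
  proof (rule add_mono)
    show "1 * pairing a m n (\<lambda>i j. 2 / pi * arcsin (M i j)) \<le> 1 * \<beta>"
      using arcsin_rounding_gram[OF \<beta> M] by simp
    have "- pairing a m n ?R \<le> (\<Sum>k. arcsin_coeff (k + K)) * gram_sup a m n"
      using pairing_gram_norm_le[OF nb, of a m n] by linarith
    then have "(2 / pi) * (- pairing a m n ?R) \<le> (2 / pi) * ((\<Sum>k. arcsin_coeff (k + K)) * gram_sup a m n)"
      by (intro mult_left_mono) auto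
    then show "- (2 / pi) * pairing a m n ?R \<le> (2 / pi) * ((\<Sum>k. arcsin_coeff (k + K)) * gram_sup a m n)"
      by simp
  qed
  finally show ?thesis by (simp add: mult.assoc)
qed

text \<open>The function \<open>h\<close> is the expectation of the truncated series of \<open>2 / pi * arcsin (t * cos (\<theta> - \<phi>))\<close>, and \<open>\<tau>\<close> is
  the cost of the truncation. The truncation changes \<open>pi / 2 * Im v\<close> by at most twice the tail of the
  coefficients, so a tail below a third of the gain of \<open>arsinh_cos_gain\<close> is small enough for both purposes.\<close>

lemma improved_rounding:
  "\<exists>h v \<tau>. 0 \<le> \<tau> \<and> wiener h v \<and> (\<forall>t. \<bar>t\<bar> \<le> 1 \<longrightarrow> h (- t) = - h t) \<and> 2 / pi * arsinh 1 + \<tau> < Im v \<and>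
     (\<forall>a m n \<beta> T. bilinear_bound a m n \<beta> \<longrightarrow> T \<in> gram_matrices \<longrightarrow>
        pairing a m n (\<lambda>i j. h (T i j)) \<le> \<beta> + \<tau> * gram_sup a m n)"
proof -
  obtain \<sigma> where \<sigma>: "arsinh 1 < (LINT y|exp_dist. arsinh (cos (\<sigma> * y)) * (cos y + sin y))"
    using arsinh_cos_gain by blast
  define \<eta> where "\<eta> = \<sigma> / 2"
  define J where "J = (LINT y|exp_dist. arsinh (cos (\<eta> * (2 * y))) * (cos y + sin y))"
  have J: "arsinh 1 < J" using \<sigma> by (simp add: J_def \<eta>_def)
  define Jk where "Jk k = (LINT y|exp_dist. cos (\<eta> * (2 * y)) ^ k * (cos y + sin y))" for k
  define tail where "tail K = (\<Sum>k. arcsin_coeff (k + K))" for K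
  obtain K where "\<bar>tail K\<bar> < (J - arsinh 1) / 3"
    using suminf_exist_split[OF _ summable_arcsin_coeff, of "(J - arsinh 1) / 3"] J
    unfolding tail_def by auto
  then have "tail K < (J - arsinh 1) / 3" by (rule order.strict_trans1[OF abs_ge_self])
  then have K: "3 * tail K < J - arsinh 1" by (simp add: less_divide_eq mult.commute)
  have tail0: "0 \<le> tail K" unfolding tail_def
    using summable_arcsin_coeff arcsin_coeff_pos by (intro suminf_nonneg) (auto simp: summable_iff_shift less_imp_le)
  define S where "S = (\<Sum>k<K. (-1) ^ k * arcsin_coeff k * Jk (2*k+1))"
  have JS: "J - S \<le> 2 * tail K"
  proof -
    let ?P = "\<lambda>x. \<Sum>k<K. (-1) ^ k * arcsin_coeff k * x ^ (2*k+1)"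
    have i0: "integrable exp_dist (\<lambda>y. arsinh (cos (\<eta> * (2 * y))) * (cos y + sin y))"
      by (rule integrable_exp_dist_weight[OF _ arsinh_cos_bound]) (intro continuous_intros)
    have i1: "integrable exp_dist (\<lambda>y. cos (\<eta> * (2 * y)) ^ k * (cos y + sin y))" for k
      by (rule integrable_exp_dist_weight[where C=1])
         (intro continuous_intros, simp add: power_abs power_le_one)
    have "S = (LINT y|exp_dist. (\<Sum>k<K. (-1) ^ k * arcsin_coeff k * (cos (\<eta> * (2 * y)) ^ (2*k+1) * (cos y + sin y))))"
      unfolding S_def Jk_def
      by (subst Bochner_Integration.integral_sum) (intro integrable_mult_right i1, simp only: integral_mult_right_zero)
    also have "\<dots> = (LINT y|exp_dist. ?P (cos (\<eta> * (2 * y))) * (cos y + sin y))"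
      by (simp only: sum_distrib_right mult.assoc)
    finally have Seq: "S = (LINT y|exp_dist. ?P (cos (\<eta> * (2 * y))) * (cos y + sin y))" .
    have i2: "integrable exp_dist (\<lambda>y. ?P (cos (\<eta> * (2 * y))) * (cos y + sin y))"
      unfolding sum_distrib_right mult.assoc[of "_ * _"] by (intro Bochner_Integration.integrable_sum integrable_mult_right i1)
    have "J - S = (LINT y|exp_dist. (arsinh (cos (\<eta> * (2 * y))) - ?P (cos (\<eta> * (2 * y)))) * (cos y + sin y))"
      unfolding J_def Seq left_diff_distrib by (rule Bochner_Integration.integral_diff[OF i0 i2, symmetric])
    also have "\<dots> \<le> tail K * 2"
    proof (rule order_trans[OF abs_ge_self exp_dist_integral_bound])
      show "\<bar>(arsinh (cos (\<eta> * (2 * y))) - ?P (cos (\<eta> * (2 * y)))) * (cos y + sin y)\<bar> \<le> tail K * 2" for y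
        unfolding abs_mult tail_def
        by (intro mult_mono arcsin_coeff_tail_bound arsinh_series abs_cos_sin_le)
           (use tail0 in \<open>auto simp: tail_def\<close>)
    qed (intro borel_measurable_continuous_onI continuous_intros)
    finally show ?thesis by simp
  qed
  have "\<exists>f. chaos_series (\<lambda>x. cos (\<eta> * x) ^ (2*k+1)) f" for k
    using chaos_series_cos_power[of \<eta> "2*k+1" 0] by simp
  then obtain F where "\<And>k. chaos_series (\<lambda>x. cos (\<eta> * x) ^ (2*k+1)) (F k)" by metis
  then have F: "wiener (F k) (of_real (Jk (2*k+1)))" "\<bar>t\<bar> \<le> 1 \<Longrightarrow> F k (- t) = F k t"
     "finite I \<Longrightarrow> (\<Sum>k\<in>I. (u k)\<^sup>2) = 1 \<Longrightarrow> (\<Sum>k\<in>I. (v k)\<^sup>2) = 1 \<Longrightarrow> \<bar>\<Sum>k\<in>I. u k * v k\<bar> \<le> 1 \<Longrightarrow>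
        (LINT p|gauss_pair I. cos (\<eta> * (chaos I u p + chaos I v p)) ^ (2*k+1)) = F k (\<Sum>k\<in>I. u k * v k)"
    for k t and I :: "nat set" and u v :: "nat \<Rightarrow> real"
    unfolding chaos_series_def Jk_def by blast+
  define h where "h t = (\<Sum>k<K. 2 / pi * arcsin_coeff k * (t ^ (2*k+1) * F k t))" for t
  define v where "v = (\<Sum>k<K. of_real (2 / pi * arcsin_coeff k) * (\<i> ^ (2*k+1) * complex_of_real (Jk (2*k+1))))"
  have wh: "wiener h v" unfolding h_def[abs_def] v_def
    by (intro wiener_sum wiener_scale wiener_mult wiener_power_id F)
  have hodd: "h (- t) = - h t" if "\<bar>t\<bar> \<le> 1" for t
    unfolding h_def by (simp add: F(2)[OF that] sum_negf[symmetric])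
  have "Im v = 2 / pi * S"
  proof -
    have "Im (of_real (2 / pi * arcsin_coeff k) * (\<i> ^ (2*k+1) * complex_of_real (Jk (2*k+1)))) = 2 / pi * ((-1) ^ k * arcsin_coeff k * Jk (2*k+1))" for k
    proof -
      have "\<i> ^ (2*k+1) = complex_of_real ((-1) ^ k) * \<i>" by (simp add: power_mult)
      then have "of_real (2 / pi * arcsin_coeff k) * (\<i> ^ (2*k+1) * complex_of_real (Jk (2*k+1))) =
         complex_of_real (2 / pi * ((-1) ^ k * arcsin_coeff k * Jk (2*k+1))) * \<i>" by (simp add: mult_ac)
      moreover have "Im (complex_of_real r * \<i>) = r" for r by simp
      ultimately show ?thesis by (simp only:)
    qed
    then show ?thesis unfolding v_def S_def Im_sum sum_distrib_left by (intro sum.cong refl)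
  qed
  moreover have "2 / pi * (arsinh 1 + tail K) < 2 / pi * S" using JS K by (intro mult_strict_left_mono) auto
  ultimately have Imv: "2 / pi * arsinh 1 + 2 / pi * tail K < Im v" by (simp add: distrib_left)
  have bound: "pairing a m n (\<lambda>i j. h (T i j)) \<le> \<beta> + 2 / pi * tail K * gram_sup a m n"
    if \<beta>: "bilinear_bound a m n \<beta>" and T: "T \<in> gram_matrices" for a m n \<beta> T
  proof -
    obtain I :: "nat set" and u w where I: "finite I" and u: "\<And>i. (\<Sum>k\<in>I. (u i k)\<^sup>2) = 1" and w: "\<And>j. (\<Sum>k\<in>I. (w j k)\<^sup>2) = 1"
      and Teq: "\<And>i j. T i j = (\<Sum>k\<in>I. u i k * w j k)"
      using gram_unit[OF T] by blast
    interpret P: prob_space "gauss_pair I" by (rule prob_space_gauss_pair)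
    let ?c = "\<lambda>p i j. cos (\<eta> * (chaos I (u i) p + chaos I (w j) p))"
    let ?m = "\<lambda>p. pairing a m n (\<lambda>i j. \<Sum>k<K. 2 / pi * arcsin_coeff k * (T i j * ?c p i j) ^ (2*k+1))"
    have le: "?m p \<le> \<beta> + 2 / pi * tail K * gram_sup a m n" for p
    proof -
      have "(\<lambda>i j. T i j * cos (\<eta> * chaos I (u i) p - (- \<eta> * chaos I (w j) p))) \<in> gram_matrices"
        by (rule gram_mult[OF T gram_cos])
      then have "(\<lambda>i j. T i j * ?c p i j) \<in> gram_matrices" by (simp add: distrib_left)
      from truncated_arcsin_rounding[OF \<beta> this, of K] show ?thesis unfolding tail_def .
    qed
    have intc: "integrable (gauss_pair I) (\<lambda>p. ?c p i j ^ l)" for i j l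
      by (rule integrable_chaos[of "\<lambda>x. cos (\<eta> * x) ^ l"]) (intro continuous_intros, simp add: power_abs power_le_one)
    have intk: "integrable (gauss_pair I) (\<lambda>p. a i j * (\<Sum>k<K. 2 / pi * arcsin_coeff k * (T i j * ?c p i j) ^ (2*k+1)))" for i j
      unfolding power_mult_distrib
      by (intro integrable_mult_right Bochner_Integration.integrable_sum intc)
    have "(LINT p|gauss_pair I. ?m p) = (\<Sum>i<m. \<Sum>j<n. (LINT p|gauss_pair I. a i j * (\<Sum>k<K. 2 / pi * arcsin_coeff k * (T i j * ?c p i j) ^ (2*k+1))))"
      unfolding pairing_def
      by (subst Bochner_Integration.integral_sum, intro Bochner_Integration.integrable_sum intk,
          subst Bochner_Integration.integral_sum, rule intk) simp
    also have "\<dots> = pairing a m n (\<lambda>i j. h (T i j))"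
      unfolding pairing_def
    proof (intro sum.cong refl)
      fix i j
      have "(LINT p|gauss_pair I. a i j * (\<Sum>k<K. 2 / pi * arcsin_coeff k * (T i j * ?c p i j) ^ (2*k+1))) =
        a i j * (\<Sum>k<K. 2 / pi * arcsin_coeff k * (T i j ^ (2*k+1) * (LINT p|gauss_pair I. ?c p i j ^ (2*k+1))))"
        unfolding power_mult_distrib integral_mult_right_zero
        by (subst Bochner_Integration.integral_sum, intro integrable_mult_right intc) (simp only: integral_mult_right_zero)
      also have "\<dots> = a i j * h (T i j)"
        unfolding h_def using F(3)[OF I u w, of i j] gram_bound[OF T, of i j] by (simp only: Teq)
      finally show "(LINT p|gauss_pair I. a i j * (\<Sum>k<K. 2 / pi * arcsin_coeff k * (T i j * ?c p i j) ^ (2*k+1))) = a i j * h (T i j)" .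
    qed
    finally have "pairing a m n (\<lambda>i j. h (T i j)) = (LINT p|gauss_pair I. ?m p)" by simp
    also have "\<dots> \<le> \<beta> + 2 / pi * tail K * gram_sup a m n"
    proof (rule P.integral_le_const)
      show "integrable (gauss_pair I) ?m"
        unfolding pairing_def by (intro Bochner_Integration.integrable_sum intk)
      show "AE p in gauss_pair I. ?m p \<le> \<beta> + 2 / pi * tail K * gram_sup a m n"
        by (intro always_eventually allI le)
    qed
    finally show ?thesis .
  qed
  show ?thesis
    using tail0 wh hodd Imv bound by (intro exI[of _ h] exI[of _ v] exI[of _ "2 / pi * tail K"]) auto
qed

text \<open>The perturbed Krivine function with \<open>b = pi / 2 * ((c + \<kappa>) * t - h t)\<close> and the function \<open>p * h\<close> add up to a linear
  function of slope \<open>q = c + p * (c + \<kappa>)\<close>, while the right-hand sides add up to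
  \<open>(1 + p) * \<beta> + p * \<tau> * gram_sup a m n\<close>. As \<open>\<kappa> > \<tau>\<close>, this is a gain over the slope \<open>c\<close>.\<close>

lemma gram_sup_bound:
  "\<exists>K>0. K < pi / (2 * arsinh 1) \<and> (\<forall>a m n \<beta>. bilinear_bound a m n \<beta> \<longrightarrow> gram_sup a m n \<le> K * \<beta>)"
proof -
  obtain h v \<tau> where h: "0 \<le> \<tau>" "wiener h v" "\<And>t. \<bar>t\<bar> \<le> 1 \<Longrightarrow> h (- t) = - h t" "2 / pi * arsinh 1 + \<tau> < Im v"
     and hb: "\<And>a m n \<beta> T. bilinear_bound a m n \<beta> \<Longrightarrow> T \<in> gram_matrices \<Longrightarrow> pairing a m n (\<lambda>i j. h (T i j)) \<le> \<beta> + \<tau> * gram_sup a m n"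
    using improved_rounding by blast
  define l where "l = arsinh (1::real)"
  define c where "c = 2 / pi * l"
  have l: "0 < l" "sinh l = 1" by (auto simp: l_def)
  have l1: "l < pi / 2"
  proof -
    \<comment> \<open>From \<open>exp 1 \<ge> 5 / 2\<close> one gets \<open>sinh 1 > 1 = sinh l\<close>, and hence \<open>l < 1 < pi / 2\<close>.\<close>
    have e: "exp (1::real) \<ge> 2.5" using exp_lower_Taylor_quadratic[of 1] by simp
    have "exp (- 1 :: real) \<le> 1 / 2.5" unfolding exp_minus using e by (simp add: inverse_eq_divide divide_le_eq)
    with e have "(1::real) < sinh 1" unfolding sinh_field_def by simp
    then have "l < arsinh (sinh 1)" unfolding l_def arsinh_less_iff_real .
    then have "l < 1" by (simp add: arsinh_sinh_real)
    then show ?thesis using pi_gt3 by simp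
  qed
  have c0: "0 < c" unfolding c_def using l by simp
  \<comment> \<open>A slope gain \<open>\<kappa>\<close> that outweighs the truncation cost and still leaves \<open>Im\<close> of the direction negative.\<close>
  obtain \<kappa> where \<kappa>: "\<tau> < \<kappa>" "\<kappa> < Im v - c" using dense[of \<tau> "Im v - c"] h(4) unfolding c_def l_def by auto
  define b where "b t = (- (pi / 2)) * h t + (pi / 2 * (c + \<kappa>)) * t" for t
  have wb: "wiener b (of_real (- (pi / 2)) * v + of_real (pi / 2 * (c + \<kappa>)) * \<i>)"
    unfolding b_def[abs_def] by (intro wiener_lincomb h wiener_id)
  have Imb: "Im (of_real (- (pi / 2)) * v + of_real (pi / 2 * (c + \<kappa>)) * \<i>) < 0"
  proof -
    have "Im (of_real (- (pi / 2)) * v + of_real (pi / 2 * (c + \<kappa>)) * \<i>) = pi / 2 * (c + \<kappa> - Im v)"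
      by (simp add: algebra_simps)
    then show ?thesis using \<kappa>(2) by (simp add: mult_pos_neg)
  qed
  have bodd: "b (- t) = - b t" if "\<bar>t\<bar> \<le> 1" for t
    using h(3)[OF that] by (simp add: b_def)
  obtain p where p: "0 < p" "\<And>t. \<bar>t\<bar> \<le> 1 \<Longrightarrow> \<bar>l * t + p * b t\<bar> \<le> pi / 2"
     "\<And>T. T \<in> gram_closure \<Longrightarrow> (\<lambda>i j. sin (l * T i j + p * b (T i j))) \<in> gram_closure"
    using sin_perturbation[OF wb bodd Imb l l1] by blast
  define q where "q = c + p * (c + \<kappa>)"
  define K where "K = (1 + p) / (q - p * \<tau>)"
  have q: "q - p * \<tau> > (1 + p) * c"
  proof -
    have "q - p * \<tau> = (1 + p) * c + p * (\<kappa> - \<tau>)" by (simp add: q_def algebra_simps)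
    then show ?thesis using p(1) \<kappa>(1) by simp
  qed
  have pc: "0 < (1 + p) * c" using p(1) c0 by simp
  have qp: "0 < q - p * \<tau>" using q pc by linarith
  have q0: "0 < q" using qp p(1) h(1) mult_nonneg_nonneg[of p \<tau>] by linarith
  have K0: "0 < K" unfolding K_def using qp p(1) by simp
  have "K < (1 + p) / ((1 + p) * c)" unfolding K_def using q pc p(1) by (intro divide_strict_left_mono) auto
  also have "\<dots> = 1 / c" using p(1) by simp
  also have "\<dots> = pi / (2 * arsinh 1)" by (simp add: c_def l_def)
  finally have Klt: "K < pi / (2 * arsinh 1)" .
  have "gram_sup a m n \<le> K * \<beta>" if \<beta>: "bilinear_bound a m n \<beta>" for a m n \<beta>
  proof -
    let ?G = "gram_sup a m n"
    have le: "pairing a m n T \<le> ((1 + p) * \<beta> + p * \<tau> * ?G) / q" if T: "T \<in> gram_matrices" for T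
    proof -
      have "pairing a m n (\<lambda>i j. 2 / pi * arcsin (sin (l * T i j + p * b (T i j)))) \<le> \<beta>"
        by (rule arcsin_rounding[OF \<beta> p(3)[OF gram_subset_closure[OF T]]])
      moreover have "2 / pi * arcsin (sin (l * T i j + p * b (T i j))) = q * T i j + (- p) * h (T i j)" for i j
      proof -
        have asn: "arcsin (sin (l * T i j + p * b (T i j))) = l * T i j + p * b (T i j)"
          using p(2)[OF gram_bound[OF T, of i j]] by (intro arcsin_sin) linarith+
        have lc: "l = pi / 2 * c" by (simp add: c_def)
        show ?thesis unfolding asn unfolding b_def q_def lc by (simp add: field_simps)
      qed
      ultimately have "q * pairing a m n T + (- p) * pairing a m n (\<lambda>i j. h (T i j)) \<le> \<beta>"
        by (simp only: pairing_linear)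
      moreover have "p * pairing a m n (\<lambda>i j. h (T i j)) \<le> p * (\<beta> + \<tau> * ?G)"
        using hb[OF \<beta> T] p(1) by (intro mult_left_mono) auto
      ultimately have "q * pairing a m n T \<le> (1 + p) * \<beta> + p * \<tau> * ?G" by (simp add: algebra_simps)
      then show ?thesis using q0 by (simp add: le_divide_eq mult.commute)
    qed
    have "?G \<le> ((1 + p) * \<beta> + p * \<tau> * ?G) / q"
      unfolding gram_sup_def[of a m n] using gram_zero le[unfolded gram_sup_def] by (intro cSUP_least) auto
    then have "(q - p * \<tau>) * ?G \<le> (1 + p) * \<beta>" using q0 by (simp add: le_divide_eq algebra_simps)
    then have "?G \<le> (1 + p) * \<beta> / (q - p * \<tau>)" using qp by (simp add: le_divide_eq mult.commute)
    then show ?thesis by (simp add: K_def)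
  qed
  with K0 Klt show ?thesis by blast
qed

lemma grothendieck_boundI:
  assumes K: "\<And>a m n \<beta>. bilinear_bound a m n \<beta> \<Longrightarrow> gram_sup a m n \<le> K * \<beta>"
  shows "grothendieck_bound K"
  unfolding grothendieck_bound_def
proof (intro allI impI)
  fix m n :: nat and a x y
  assume mn: "1 \<le> m" "1 \<le> n"
    and x: "\<forall>i<m. x i \<in> topspace (nsphere (m + n - 1))" and y: "\<forall>j<n. y j \<in> topspace (nsphere (m + n - 1))"
  obtain \<epsilon> \<delta> :: "nat \<Rightarrow> real" where ed: "\<forall>i. \<epsilon> i \<in> {-1, 1}" "\<forall>j. \<delta> j \<in> {-1, 1}"
    "bilinear_bound a m n (pairing a m n (\<lambda>i j. \<epsilon> i * \<delta> j))"
    using sign_bilinear_bound by blast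
  have idx: "{..m + n - 1} = {..<m + n}" using mn by auto
  \<comment> \<open>Gram matrices have rows and columns for all of \<open>nat\<close>; those out of range repeat the first vector.\<close>
  define x' where "x' i = (if i < m then x i else x 0)" for i
  define y' where "y' j = (if j < n then y j else y 0)" for j
  have unit: "(\<Sum>k<m + n. (x' i k)\<^sup>2) = 1" "(\<Sum>k<m + n. (y' j k)\<^sup>2) = 1" for i j
    using x y mn by (auto simp: x'_def y'_def nsphere_def idx simp del: One_nat_def)
  have "(\<lambda>i j. \<Sum>k<m + n. x' i k * y' j k) \<in> gram_matrices"
    by (rule gramI[of "{..<m + n}" x' y']) (use unit in auto)
  then have "pairing a m n (\<lambda>i j. \<Sum>k<m + n. x' i k * y' j k) \<le> gram_sup a m n"
    by (intro pairing_le_gram_sup gram_subset_closure)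
  also have "\<dots> \<le> K * pairing a m n (\<lambda>i j. \<epsilon> i * \<delta> j)" by (rule K[OF ed(3)])
  finally have "(\<Sum>i<m. \<Sum>j<n. a i j * std_inner (m + n) (x i) (y j)) \<le> K * (\<Sum>i<m. \<Sum>j<n. a i j * \<epsilon> i * \<delta> j)"
    unfolding pairing_def std_inner_def by (simp add: x'_def y'_def mult.assoc)
  with ed(1,2) show "\<exists>\<epsilon> \<delta> :: nat \<Rightarrow> real. (\<forall>i<m. \<epsilon> i \<in> {-1, 1}) \<and> (\<forall>j<n. \<delta> j \<in> {-1, 1}) \<and>
        (\<Sum>i<m. \<Sum>j<n. a i j * std_inner (m + n) (x i) (y j)) \<le> K * (\<Sum>i<m. \<Sum>j<n. a i j * \<epsilon> i * \<delta> j)"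
    by blast
qed

theorem theorem1p1:
  shows "\<exists>\<epsilon>\<^sub>0 > (0::real). grothendieck_constant < pi / (2 * ln (1 + sqrt 2)) - \<epsilon>\<^sub>0"
proof -
  obtain K where K: "0 < K" "K < pi / (2 * arsinh 1)" "\<And>a m n \<beta>. bilinear_bound a m n \<beta> \<Longrightarrow> gram_sup a m n \<le> K * \<beta>"
    using gram_sup_bound by blast
  have "grothendieck_constant \<le> K" unfolding grothendieck_constant_def
    using K(1) grothendieck_boundI[OF K(3)] by (intro cInf_lower) (auto intro!: bdd_belowI[of _ 0])
  moreover have "arsinh (1::real) = ln (1 + sqrt 2)" by (simp add: arsinh_real_def)
  ultimately show ?thesis using K(2)
    by (intro exI[of _ "(pi / (2 * ln (1 + sqrt 2)) - K) / 2"]) (auto simp: field_simps)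
qed

end
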